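(* The generalized braiding $\sigma:\Omega\otimes_{\mathcal{B}}\Omega\to\Omega\otimes_{\mathcal{B}}\Omega$ on the quantum projective space satisfies, as maps $\Omega\otimes_{\mathcal{B}}\Omega\otimes_{\mathcal{B}}\Omega\to\Omega^2\otimes_{\mathcal{B}}\Omega$, $$(\wedge\otimes\mathrm{id})\circ\sigma_1\circ\sigma_2\circ\sigma_1=(\wedge\otimes\mathrm{id})\circ\sigma_2\circ\sigma_1\circ\sigma_2,$$ where $\sigma_1=\sigma\otimes\mathrm{id}$ and $\sigma_2=\mathrm{id}\otimes\sigma$.
   Context: **Quantum group data.** Fix an integer $r\ge 1$, a real number $0<q<1$ and $s\in\{1,r\}$. $U_q(\mathfrak{sl}_{r+1})$ is the quantized enveloping algebra with generators $K_i^{\pm1},E_i,F_i$, $1\le i\le r$ (Klimyk–Schmüdgen conventions: $\Delta(K_i)=K_i\otimes K_i$, $\Delta(E_i)=E_i\otimes K_i+1\otimes E_i$, $\Delta(F_i)=F_i\otimes 1+K_i^{-1}\otimes F_i$; $K_i$ acts on a vector of weight $\mu$ by $q^{(\alpha_i,\mu)}$). Here $\alpha_i$ are the simple roots, $\omega_i$ the fundamental weights, $\rho=\sum_i\omega_i$, $w_0$ the longest Weyl group element, $(\cdot,\cdot)$ the invariant form with $(\alpha_i,\alpha_i)=2$. Put $a=(\alpha_s,\alpha_s)=2$, $w=(\omega_s,\omega_s)$, $m=(\omega_s,2\rho)=r$. $V(\lambda)$ is the simple type 1 module of highest weight $\lambda$, $V=V(\omega_s)$, and $V^*$ is its dual with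 $(Xf)(v)=f(S(X)v)$, $S$ the antipode. $\hat{R}_{X,Y}:X\otimes Y\to Y\otimes X$ is the braiding on finite-dimensional type 1 modules determined by being a module map with $\hat{R}_{V(\lambda),V(\mu)}(v\otimes u)=q^{(\lambda,w_0\mu)}u\otimes v$ for $v$ a highest weight vector of $V(\lambda)$ and $u$ a lowest weight vector of $V(\mu)$. Let $(v_i)$ be a weight basis of $V$ with weights $\lambda_i$ and dual basis $(f^i)$ of $V^*$. Define $\mathsf{E}:V^*\otimes V\to\mathbb{C}$, $\mathsf{E}(f^i\otimes v_j)=\delta_{ij}$, and $\mathsf{E}':V\otimes V^*\to\mathbb{C}$, $\mathsf{E}'(v_i\otimes f^j)=q^{(\lambda_i,2\rho)}\delta_{ij}$. Subscripts indicate the tensor legs on which a map acts; products of maps are compositions (rightmost first), legs being renumbered after each contraction. Put $$\mathsf{S}_{123}=(\hat{R}_{V,V^*})_{23}(\hat{R}_{V,V})_{12}(\hat{R}_{V,V^*}^{-1})_{23},\quad \tilde{\mathsf{S}}_{234}=(\hat{R}_{V,V^*})_{23}(\hat{R}_{V^*,V^*}^{-1})_{34}(\hat{R}_{V,V^*}^{-1})_{23},\quad \mathsf{T}_{1234}=\mathsf{S}_{123}\tilde{\mathsf{S}}_{234}=\tilde{\mathsf{S}}_{234}\mathsf{S}_{123}$$ (acting on $V\otimes V^*\otimes V$, $V^*\otimes V\otimes V^*$, $V\otimes V^*\otimes V\otimes V^*$ at the indicated legs). **Index-free notation.** A family $x=(x^{ij})_{1\le i,j\le r+1}$ is identified with $\sum_{i,j}v_i\otimes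 f^j\otimes x^{ij}$; products of families $xy$ (also $x\otimes y$, $x\wedge y$) denote $\sum v_i\otimes f^j\otimes v_k\otimes f^l\otimes x^{ij}y^{kl}$ (resp. with $\otimes_{\mathcal{B}}$, $\wedge$), and similarly for more factors. The maps above act on the $V,V^*$ legs; other maps act on components. Elements such as $g_{+-}$ below carry no legs. **Algebra and first-order calculus.** $\mathcal{B}$ is the unital algebra generated by $p^{ij}$, $1\le i,j\le r+1$, with relations $\mathsf{S}_{123}pp=q^{w}pp$, $\tilde{\mathsf{S}}_{234}pp=q^{-w}pp$, $\mathsf{E}'_{12}p=q^{m}$. The Heckenberger–Kolb first-order differential calculus is $\Omega=\Omega_+\oplus\Omega_-$, with $\Omega_+,\Omega_-$ generated as left $\mathcal{B}$-modules by $\partial p^{ij}$, resp. $\bar\partial p^{ij}$, with relations $$\tilde{\mathsf{S}}_{234}p\,\partial p=q^{-w}p\,\partial p,\quad \mathsf{E}'_{12}\partial p=0,\qquad \mathsf{S}_{123}p\,\bar\partial p=q^{w}p\,\bar\partial p,\quad \mathsf{E}'_{12}\bar\partial p=0,$$ right module structure $\partial p\,p=q^{a}\mathsf{T}_{1234}p\,\partial p$, $\bar\partial p\,p=q^{-a}\mathsf{T}_{1234}p\,\bar\partial p$, and differential $\mathrm{d}=\partial+\bar\partial$, where $\partial,\bar\partial:\mathcal{B}\to\Omega_\pm$ are the derivations with $p^{ij}\mapsto\partial p^{ij},\bar\partial p^{ij}$. **Universal calculus.** $\Omega^\bullet$ is the quotient of the tensor algebra $T_{\mathcal{B}}(\Omega)$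 by the two-sided ideal generated by $\{\sum_i\mathrm{d}a_i\otimes\mathrm{d}b_i:\sum_i a_i\mathrm{d}b_i=0\}\subset\Omega\otimes_{\mathcal{B}}\Omega$; its product is $\wedge$. **Metric components.** $g_{+-}=\mathsf{E}'_{12}\mathsf{E}_{23}\,\partial p\otimes\bar\partial p$ and $g_{-+}=\mathsf{E}'_{12}\mathsf{E}_{23}\,\bar\partial p\otimes\partial p$ in $\Omega\otimes_{\mathcal{B}}\Omega$ (central elements). **Generalized braiding.** $\sigma$ is the (well-defined) $\mathcal{B}$-bimodule map $\Omega\otimes_{\mathcal{B}}\Omega\to\Omega\otimes_{\mathcal{B}}\Omega$ given by $$\sigma(\partial p\otimes\partial p)=q^{a}\mathsf{S}_{123}\tilde{\mathsf{S}}_{234}\,\partial p\otimes\partial p,\qquad \sigma(\bar\partial p\otimes\bar\partial p)=q^{-a}\mathsf{S}_{123}\tilde{\mathsf{S}}_{234}\,\bar\partial p\otimes\bar\partial p,$$ $$\sigma(\partial p\otimes\bar\partial p)=q^{2a-2w}\mathsf{S}_{123}\tilde{\mathsf{S}}_{234}^{-1}\,\bar\partial p\otimes\partial p+(1-q^{a})q^{a}q^{-m}\,p\,g_{-+}\,p,$$ $$\sigma(\bar\partial p\otimes\partial p)=q^{2w-2a}\mathsf{S}_{123}^{-1}\tilde{\mathsf{S}}_{234}\,\partial p\otimes\bar\partial p+(1-q^{-a})q^{-m}\,p\,g_{+-}\,p.$$ *)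

theory Defs
  imports "HOL-Analysis.Analysis" "HOL-Library.Poly_Mapping"
begin

class complex_space = ab_group_add +
  fixes scaleC :: "complex \<Rightarrow> 'a \<Rightarrow> 'a"  (infixr "*\<^sub>C" 75)
  assumes scaleC_add_right: "c *\<^sub>C (x + y) = c *\<^sub>C x + c *\<^sub>C y"
    and scaleC_add_left: "(c + d) *\<^sub>C x = c *\<^sub>C x + d *\<^sub>C x"
    and scaleC_scaleC: "c *\<^sub>C d *\<^sub>C x = (c * d) *\<^sub>C x"
    and scaleC_one: "1 *\<^sub>C x = x"

class complex_algebra_1 = complex_space + ring_1 +
  assumes scaleC_mult_left: "(c *\<^sub>C x) * y = c *\<^sub>C (x * y)"
    and scaleC_mult_right: "x * (c *\<^sub>C y) = c *\<^sub>C (x * y)"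

global_interpretation complex_space: vector_space "scaleC :: complex \<Rightarrow> 'a \<Rightarrow> 'a::complex_space"
  by standard (auto simp: scaleC_add_right scaleC_add_left scaleC_scaleC scaleC_one)

instantiation complex :: complex_algebra_1
begin
definition scaleC_complex :: "complex \<Rightarrow> complex \<Rightarrow> complex"
  where "scaleC_complex c x = c * x"
instance
  by standard (auto simp: scaleC_complex_def algebra_simps)
end

instantiation prod :: (complex_space, complex_space) complex_space
begin
definition scaleC_prod :: "complex \<Rightarrow> 'a \<times> 'b \<Rightarrow> 'a \<times> 'b"
  where "scaleC_prod c x = (c *\<^sub>C fst x, c *\<^sub>C snd x)"
instance
  by standard (auto simp: scaleC_prod_def scaleC_add_right scaleC_add_left scaleC_scaleC scaleC_one)
end

instantiation vec :: (complex_space, finite) complex_space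
begin
definition scaleC_vec :: "complex \<Rightarrow> 'a ^ 'b \<Rightarrow> 'a ^ 'b"
  where "scaleC_vec c x = (\<chi> i. c *\<^sub>C (x $ i))"
instance
  by standard
    (auto simp: scaleC_vec_def vec_eq_iff scaleC_add_right scaleC_add_left scaleC_scaleC scaleC_one)
end

instantiation poly_mapping :: (type, complex_space) complex_space
begin
definition scaleC_poly_mapping :: "complex \<Rightarrow> ('a \<Rightarrow>\<^sub>0 'b) \<Rightarrow> ('a \<Rightarrow>\<^sub>0 'b)"
  where "scaleC_poly_mapping c f = Poly_Mapping.map (scaleC c) f"
instance
proof
  have l: "Poly_Mapping.lookup (c *\<^sub>C f) x = c *\<^sub>C Poly_Mapping.lookup f x" for c x and f :: "'a \<Rightarrow>\<^sub>0 'b"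
    by (simp add: scaleC_poly_mapping_def Poly_Mapping.map.rep_eq when_def)
  fix c d :: complex and f g :: "'a \<Rightarrow>\<^sub>0 'b"
  show "c *\<^sub>C (f + g) = c *\<^sub>C f + c *\<^sub>C g"
    by (rule poly_mapping_eqI) (simp add: l Poly_Mapping.lookup_add scaleC_add_right)
  show "(c + d) *\<^sub>C f = c *\<^sub>C f + d *\<^sub>C f"
    by (rule poly_mapping_eqI) (simp add: l Poly_Mapping.lookup_add scaleC_add_left)
  show "c *\<^sub>C d *\<^sub>C f = (c * d) *\<^sub>C f"
    by (rule poly_mapping_eqI) (simp add: l scaleC_scaleC)
  show "1 *\<^sub>C f = f"
    by (rule poly_mapping_eqI) (simp add: l scaleC_one)
qed
end

text \<open>Linear extension of \<open>\<phi>\<close> to the free vector space on its domain.\<close>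

definition lin_ext :: "('x \<Rightarrow> 'v::complex_space) \<Rightarrow> ('x \<Rightarrow>\<^sub>0 complex) \<Rightarrow> 'v" where
  "lin_ext \<phi> f = (\<Sum>x\<in>Poly_Mapping.keys f. Poly_Mapping.lookup f x *\<^sub>C \<phi> x)"

text \<open>The whole type \<open>'v\<close> is the quotient of the free vector space on \<open>'x\<close> by the span of
  \<open>R\<close>, the class of the generator \<open>x\<close> being \<open>\<phi> x\<close>.\<close>

definition presented_space :: "('x \<Rightarrow> 'v::complex_space) \<Rightarrow> ('x \<Rightarrow>\<^sub>0 complex) set \<Rightarrow> bool" where
  "presented_space \<phi> R \<longleftrightarrow>
     surj (lin_ext \<phi>) \<and> (\<forall>f. lin_ext \<phi> f = 0 \<longleftrightarrow> f \<in> complex_space.span R)"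

text \<open>The unital algebra with generators \<open>gen x\<close> and relations \<open>R\<close>. Words in the generators form
  the standard basis of the free algebra, so the two-sided ideal generated by \<open>R\<close> is the span of
  all \<open>u \<rho> v\<close> with words \<open>u\<close>, \<open>v\<close> and \<open>\<rho> \<in> R\<close>.\<close>

definition presented_algebra ::
  "('x \<Rightarrow> 'b::complex_algebra_1) \<Rightarrow> ('x list \<Rightarrow>\<^sub>0 complex) set \<Rightarrow> bool" where
  "presented_algebra gen R \<longleftrightarrow>
     presented_space (\<lambda>w. prod_list (map gen w))
       {lin_ext (\<lambda>w. Poly_Mapping.single (u @ w @ v) 1) \<rho> | u v \<rho>. \<rho> \<in> R}"

record ('b, 'm) bimod =
  lact :: "'b \<Rightarrow> 'm \<Rightarrow> 'm"
  ract :: "'m \<Rightarrow> 'b \<Rightarrow> 'm"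

definition bimodule :: "('b::complex_algebra_1, 'm::complex_space) bimod \<Rightarrow> bool" where
  "bimodule M \<longleftrightarrow>
     (\<forall>a b x. lact M (a + b) x = lact M a x + lact M b x) \<and>
     (\<forall>a x y. lact M a (x + y) = lact M a x + lact M a y) \<and>
     (\<forall>a b x. lact M (a * b) x = lact M a (lact M b x)) \<and>
     (\<forall>a b x. ract M x (a + b) = ract M x a + ract M x b) \<and>
     (\<forall>a x y. ract M (x + y) a = ract M x a + ract M y a) \<and>
     (\<forall>a b x. ract M x (a * b) = ract M (ract M x a) b) \<and>
     (\<forall>a b x. ract M (lact M a x) b = lact M a (ract M x b)) \<and>
     (\<forall>c x. lact M (c *\<^sub>C 1) x = c *\<^sub>C x \<and> ract M x (c *\<^sub>C 1) = c *\<^sub>C x)"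

definition bimodule_hom ::
  "('b, 'm::complex_space) bimod \<Rightarrow> ('b, 'n::complex_space) bimod \<Rightarrow> ('m \<Rightarrow> 'n) \<Rightarrow> bool" where
  "bimodule_hom M N h \<longleftrightarrow>
     (\<forall>x y. h (x + y) = h x + h y) \<and>
     (\<forall>b x. h (lact M b x) = lact N b (h x)) \<and>
     (\<forall>b x. h (ract M x b) = ract N (h x) b)"

definition bimod_sum :: "('b, 'm) bimod \<Rightarrow> ('b, 'n) bimod \<Rightarrow> ('b, 'm \<times> 'n) bimod" where
  "bimod_sum M N = \<lparr> lact = (\<lambda>b x. (lact M b (fst x), lact N b (snd x))),
                     ract = (\<lambda>x b. (ract M (fst x) b, ract N (snd x) b)) \<rparr>"

inductive_set sub_bimodule_generated :: "('b, 'm::complex_space) bimod \<Rightarrow> 'm set \<Rightarrow> 'm set"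
  for M :: "('b, 'm) bimod" and R :: "'m set" where
  zero: "0 \<in> sub_bimodule_generated M R"
| base: "x \<in> R \<Longrightarrow> x \<in> sub_bimodule_generated M R"
| add: "x \<in> sub_bimodule_generated M R \<Longrightarrow> y \<in> sub_bimodule_generated M R \<Longrightarrow>
    x + y \<in> sub_bimodule_generated M R"
| lact: "x \<in> sub_bimodule_generated M R \<Longrightarrow> lact M b x \<in> sub_bimodule_generated M R"
| ract: "x \<in> sub_bimodule_generated M R \<Longrightarrow> ract M x b \<in> sub_bimodule_generated M R"

text \<open>The free left module on the finite type \<open>'k\<close> is \<open>'b ^ 'k\<close>, with basis \<open>axis k 1\<close> and left
  action \<open>*s\<close>.\<close>

inductive_set left_submodule_generated :: "('b::complex_algebra_1 ^ 'k::finite) set \<Rightarrow> ('b ^ 'k) set"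
  for R :: "('b ^ 'k) set" where
  zero: "0 \<in> left_submodule_generated R"
| base: "x \<in> R \<Longrightarrow> x \<in> left_submodule_generated R"
| add: "x \<in> left_submodule_generated R \<Longrightarrow> y \<in> left_submodule_generated R \<Longrightarrow>
    x + y \<in> left_submodule_generated R"
| smult: "x \<in> left_submodule_generated R \<Longrightarrow> b *s x \<in> left_submodule_generated R"

definition presented_left_module ::
  "('b::complex_algebra_1, 'm::complex_space) bimod \<Rightarrow> ('k::finite \<Rightarrow> 'm) \<Rightarrow> ('b ^ 'k) set \<Rightarrow> bool"
where
  "presented_left_module M gen R \<longleftrightarrow>
     (\<forall>x. \<exists>c. x = (\<Sum>k\<in>UNIV. lact M (c $ k) (gen k))) \<and>
     (\<forall>c. (\<Sum>k\<in>UNIV. lact M (c $ k) (gen k)) = 0 \<longleftrightarrow> c \<in> left_submodule_generated R)"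

text \<open>The tensor product over the algebra is the quotient of the free vector space on pairs by the
  multilinear and balancing relations.\<close>

definition tensor_relations ::
  "('b, 'm::complex_space) bimod \<Rightarrow> ('b, 'n::complex_space) bimod \<Rightarrow> ('m \<times> 'n \<Rightarrow>\<^sub>0 complex) set"
where
  "tensor_relations M N =
     {Poly_Mapping.single (x + x', y) 1 - Poly_Mapping.single (x, y) 1
        - Poly_Mapping.single (x', y) 1 | x x' y. True} \<union>
     {Poly_Mapping.single (x, y + y') 1 - Poly_Mapping.single (x, y) 1
        - Poly_Mapping.single (x, y') 1 | x y y'. True} \<union>
     {Poly_Mapping.single (c *\<^sub>C x, y) 1 - c *\<^sub>C Poly_Mapping.single (x, y) 1 | c x y. True} \<union>
     {Poly_Mapping.single (ract M x b, y) 1 - Poly_Mapping.single (x, lact N b y) 1 | x b y. True}"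

definition tensor_product ::
  "('b::complex_algebra_1, 'm::complex_space) bimod \<Rightarrow> ('b, 'n::complex_space) bimod \<Rightarrow>
   ('b, 't::complex_space) bimod \<Rightarrow> ('m \<Rightarrow> 'n \<Rightarrow> 't) \<Rightarrow> bool" where
  "tensor_product M N T tens \<longleftrightarrow>
     bimodule T \<and>
     presented_space (\<lambda>(x, y). tens x y) (tensor_relations M N) \<and>
     (\<forall>b x y. lact T b (tens x y) = tens (lact M b x) y) \<and>
     (\<forall>b x y. ract T (tens x y) b = tens x (ract N y b))"

text \<open>\<open>f \<otimes> g\<close>; pure tensors generate a tensor product additively, so there is at most one such map.\<close>

definition tensor_map ::
  "('m \<Rightarrow> 'n \<Rightarrow> 't::complex_space) \<Rightarrow> ('m' \<Rightarrow> 'n' \<Rightarrow> 't'::complex_space) \<Rightarrow>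
   ('m \<Rightarrow> 'm') \<Rightarrow> ('n \<Rightarrow> 'n') \<Rightarrow> 't \<Rightarrow> 't'" where
  "tensor_map tens tens' f g =
     (THE h. (\<forall>x y. h (x + y) = h x + h y) \<and> (\<forall>x y. h (tens x y) = tens' (f x) (g y)))"

definition derivation ::
  "('b::complex_algebra_1, 'm::complex_space) bimod \<Rightarrow> ('b \<Rightarrow> 'm) \<Rightarrow> bool" where
  "derivation M D \<longleftrightarrow>
     (\<forall>a b. D (a + b) = D a + D b) \<and>
     (\<forall>c a. D (c *\<^sub>C a) = c *\<^sub>C D a) \<and>
     (\<forall>a b. D (a * b) = ract M (D a) b + lact M a (D b))"

text \<open>Weights are realised as vectors with coordinates \<open>1, ..., r+1\<close> and coordinate sum \<open>0\<close>,
  extended by \<open>0\<close>; the invariant form is the restriction of the standard inner product, so that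
  \<open>(\<alpha>\<^sub>i, \<alpha>\<^sub>i) = 2\<close>.\<close>

type_synonym weight = "nat \<Rightarrow> real"

definition wform :: "nat \<Rightarrow> weight \<Rightarrow> weight \<Rightarrow> real" where
  "wform r \<mu> \<nu> = (\<Sum>k = 1..r + 1. \<mu> k * \<nu> k)"

definition simple_root :: "nat \<Rightarrow> weight" where
  "simple_root i = (\<lambda>k. if k = i then 1 else if k = i + 1 then - 1 else 0)"

definition fund_weight :: "nat \<Rightarrow> nat \<Rightarrow> weight" where
  "fund_weight r i =
     (\<lambda>k. if k \<in> {1..r + 1} then (if k \<le> i then 1 else 0) - real i / (real r + 1) else 0)"

definition weight_lattice :: "nat \<Rightarrow> weight set" where
  "weight_lattice r = {(\<lambda>k. \<Sum>i = 1..r. of_int (c i) * fund_weight r i k) | c :: nat \<Rightarrow> int. True}"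

definition two_rho :: "nat \<Rightarrow> weight" where
  "two_rho r = (\<lambda>k. 2 * (\<Sum>i = 1..r. fund_weight r i k))"

text \<open>The longest element of the Weyl group (the symmetric group) reverses the coordinates.\<close>

definition w0 :: "nat \<Rightarrow> weight \<Rightarrow> weight" where
  "w0 r \<mu> = (\<lambda>k. \<mu> (r + 2 - k))"

definition qpow :: "real \<Rightarrow> real \<Rightarrow> complex" where
  "qpow q x = complex_of_real (q powr x)"

text \<open>A module with underlying space \<open>complex ^ 'i\<close>, given by the matrices of the generators
  \<open>K\<^sub>i\<close>, \<open>K\<^sub>i\<^sup>-\<^sup>1\<close>, \<open>E\<^sub>i\<close>, \<open>F\<^sub>i\<close> (only \<open>1 \<le> i \<le> r\<close> is relevant).\<close>

record 'i uq_rep =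
  Kop :: "nat \<Rightarrow> complex ^ 'i ^ 'i"
  Kiop :: "nat \<Rightarrow> complex ^ 'i ^ 'i"
  Eop :: "nat \<Rightarrow> complex ^ 'i ^ 'i"
  Fop :: "nat \<Rightarrow> complex ^ 'i ^ 'i"

definition serre :: "real \<Rightarrow> complex ^ 'i::finite ^ 'i \<Rightarrow> complex ^ 'i ^ 'i \<Rightarrow> bool" where
  "serre q X Y \<longleftrightarrow>
     X ** X ** Y - (qpow q 1 + qpow q (- 1)) *\<^sub>C (X ** Y ** X) + Y ** X ** X = 0"

definition is_uq_module :: "nat \<Rightarrow> real \<Rightarrow> 'i::finite uq_rep \<Rightarrow> bool" where
  "is_uq_module r q M \<longleftrightarrow>
     (\<forall>i\<in>{1..r}. Kop M i ** Kiop M i = mat 1 \<and> Kiop M i ** Kop M i = mat 1) \<and>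
     (\<forall>i\<in>{1..r}. \<forall>j\<in>{1..r}.
        Kop M i ** Kop M j = Kop M j ** Kop M i \<and>
        Kop M i ** Eop M j ** Kiop M i
          = qpow q (wform r (simple_root i) (simple_root j)) *\<^sub>C Eop M j \<and>
        Kop M i ** Fop M j ** Kiop M i
          = qpow q (- wform r (simple_root i) (simple_root j)) *\<^sub>C Fop M j \<and>
        Eop M i ** Fop M j - Fop M j ** Eop M i
          = (if i = j then (1 / (qpow q 1 - qpow q (- 1))) *\<^sub>C (Kop M i - Kiop M i) else 0) \<and>
        (i = j + 1 \<or> j = i + 1 \<longrightarrow> serre q (Eop M i) (Eop M j) \<and> serre q (Fop M i) (Fop M j)) \<and>
        (i > j + 1 \<or> j > i + 1 \<longrightarrow>
          Eop M i ** Eop M j = Eop M j ** Eop M i \<and> Fop M i ** Fop M j = Fop M j ** Fop M i))"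

definition weight_vector :: "nat \<Rightarrow> real \<Rightarrow> 'i::finite uq_rep \<Rightarrow> weight \<Rightarrow> complex ^ 'i \<Rightarrow> bool" where
  "weight_vector r q M \<mu> v \<longleftrightarrow>
     v \<noteq> 0 \<and> (\<forall>i\<in>{1..r}. Kop M i *v v = qpow q (wform r (simple_root i) \<mu>) *\<^sub>C v)"

definition highest_weight_vector ::
  "nat \<Rightarrow> real \<Rightarrow> 'i::finite uq_rep \<Rightarrow> weight \<Rightarrow> complex ^ 'i \<Rightarrow> bool" where
  "highest_weight_vector r q M \<mu> v \<longleftrightarrow>
     weight_vector r q M \<mu> v \<and> (\<forall>i\<in>{1..r}. Eop M i *v v = 0)"

definition lowest_weight_vector ::
  "nat \<Rightarrow> real \<Rightarrow> 'i::finite uq_rep \<Rightarrow> weight \<Rightarrow> complex ^ 'i \<Rightarrow> bool" where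
  "lowest_weight_vector r q M \<mu> v \<longleftrightarrow>
     weight_vector r q M \<mu> v \<and> (\<forall>i\<in>{1..r}. Fop M i *v v = 0)"

definition simple_uq_module :: "nat \<Rightarrow> real \<Rightarrow> 'i::finite uq_rep \<Rightarrow> bool" where
  "simple_uq_module r q M \<longleftrightarrow> is_uq_module r q M \<and>
     (\<forall>U :: (complex ^ 'i) set. complex_space.subspace U \<and>
        (\<forall>i\<in>{1..r}. \<forall>v\<in>U. Kop M i *v v \<in> U \<and> Kiop M i *v v \<in> U \<and> Eop M i *v v \<in> U \<and> Fop M i *v v \<in> U)
        \<longrightarrow> U = {0} \<or> U = UNIV)"

text \<open>\<open>M\<close> is a copy of \<open>V(\<mu>)\<close>; type 1 is part of the form of the eigenvalues in
  \<^const>\<open>weight_vector\<close>.\<close>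

definition is_V :: "nat \<Rightarrow> real \<Rightarrow> 'i::finite uq_rep \<Rightarrow> weight \<Rightarrow> bool" where
  "is_V r q M \<mu> \<longleftrightarrow> simple_uq_module r q M \<and> \<mu> \<in> weight_lattice r \<and>
     (\<exists>v. highest_weight_vector r q M \<mu> v)"

definition weight_basis :: "nat \<Rightarrow> real \<Rightarrow> 'i::finite uq_rep \<Rightarrow> ('i \<Rightarrow> weight) \<Rightarrow> bool" where
  "weight_basis r q M wt \<longleftrightarrow>
     (\<forall>j. wt j \<in> weight_lattice r \<and> weight_vector r q M (wt j) (axis j 1))"

text \<open>The dual module in the dual basis: \<open>X\<close> acts by the transpose of \<open>S(X)\<close>, where
  \<open>S(K\<^sub>i) = K\<^sub>i\<^sup>-\<^sup>1\<close>, \<open>S(E\<^sub>i) = - E\<^sub>i K\<^sub>i\<^sup>-\<^sup>1\<close>, \<open>S(F\<^sub>i) = - K\<^sub>i F\<^sub>i\<close>.\<close>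

definition dual_rep :: "'i::finite uq_rep \<Rightarrow> 'i uq_rep" where
  "dual_rep M = \<lparr> Kop = (\<lambda>i. transpose (Kiop M i)),
                  Kiop = (\<lambda>i. transpose (Kop M i)),
                  Eop = (\<lambda>i. transpose (- (Eop M i ** Kiop M i))),
                  Fop = (\<lambda>i. transpose (- (Kop M i ** Fop M i))) \<rparr>"

definition kron :: "complex ^ 'i::finite ^ 'i \<Rightarrow> complex ^ 'j::finite ^ 'j \<Rightarrow> complex ^ ('i \<times> 'j) ^ ('i \<times> 'j)" where
  "kron A B = (\<chi> x y. A $ fst x $ fst y * B $ snd x $ snd y)"

definition kron_vec :: "complex ^ 'i::finite \<Rightarrow> complex ^ 'j::finite \<Rightarrow> complex ^ ('i \<times> 'j)" where
  "kron_vec v u = (\<chi> x. v $ fst x * u $ snd x)"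

definition tensor_rep :: "'i::finite uq_rep \<Rightarrow> 'j::finite uq_rep \<Rightarrow> ('i \<times> 'j) uq_rep" where
  "tensor_rep M N =
     \<lparr> Kop = (\<lambda>i. kron (Kop M i) (Kop N i)),
       Kiop = (\<lambda>i. kron (Kiop M i) (Kiop N i)),
       Eop = (\<lambda>i. kron (Eop M i) (Kop N i) + kron (mat 1) (Eop N i)),
       Fop = (\<lambda>i. kron (Fop M i) (mat 1) + kron (Kiop M i) (Fop N i)) \<rparr>"

definition uq_module_map ::
  "nat \<Rightarrow> 'i::finite uq_rep \<Rightarrow> 'j::finite uq_rep \<Rightarrow> complex ^ 'i ^ 'j \<Rightarrow> bool" where
  "uq_module_map r M N A \<longleftrightarrow> (\<forall>i\<in>{1..r}.
     A ** Kop M i = Kop N i ** A \<and> A ** Kiop M i = Kiop N i ** A \<and>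
     A ** Eop M i = Eop N i ** A \<and> A ** Fop M i = Fop N i ** A)"

text \<open>The matrix of \<open>X \<otimes> Y \<rightarrow> Y \<otimes> X\<close>, for simple \<open>X\<close> and \<open>Y\<close> only: then \<open>v \<otimes> u\<close> generates
  \<open>X \<otimes> Y\<close>, and the two conditions determine the map.\<close>

definition braiding ::
  "nat \<Rightarrow> real \<Rightarrow> 'i::finite uq_rep \<Rightarrow> 'j::finite uq_rep \<Rightarrow> complex ^ ('i \<times> 'j) ^ ('j \<times> 'i)" where
  "braiding r q X Y = (THE R. uq_module_map r (tensor_rep X Y) (tensor_rep Y X) R \<and>
     (\<forall>\<nu> \<mu> v u. is_V r q X \<nu> \<and> is_V r q Y \<mu> \<and>
        highest_weight_vector r q X \<nu> v \<and> lowest_weight_vector r q Y (w0 r \<mu>) u \<longrightarrow>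
        R *v kron_vec v u = qpow q (wform r \<nu> (w0 r \<mu>)) *\<^sub>C kron_vec u v))"

definition lift12 :: "complex ^ ('i::finite \<times> 'i) ^ ('i \<times> 'i) \<Rightarrow> complex ^ ('i \<times> 'i \<times> 'i) ^ ('i \<times> 'i \<times> 'i)"
where
  "lift12 A = (\<chi> x y. case x of (i, j, k) \<Rightarrow> case y of (i', j', k') \<Rightarrow>
     if k = k' then A $ (i, j) $ (i', j') else 0)"

definition lift23 :: "complex ^ ('i::finite \<times> 'i) ^ ('i \<times> 'i) \<Rightarrow> complex ^ ('i \<times> 'i \<times> 'i) ^ ('i \<times> 'i \<times> 'i)"
where
  "lift23 A = (\<chi> x y. case x of (i, j, k) \<Rightarrow> case y of (i', j', k') \<Rightarrow>
     if i = i' then A $ (j, k) $ (j', k') else 0)"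

definition S_map ::
  "nat \<Rightarrow> real \<Rightarrow> 'i::finite uq_rep \<Rightarrow> complex ^ ('i \<times> 'i \<times> 'i) ^ ('i \<times> 'i \<times> 'i)" where
  "S_map r q V = lift23 (braiding r q V (dual_rep V)) ** lift12 (braiding r q V V)
     ** lift23 (matrix_inv (braiding r q V (dual_rep V)))"

definition St_map ::
  "nat \<Rightarrow> real \<Rightarrow> 'i::finite uq_rep \<Rightarrow> complex ^ ('i \<times> 'i \<times> 'i) ^ ('i \<times> 'i \<times> 'i)" where
  "St_map r q V = lift12 (braiding r q V (dual_rep V))
     ** lift23 (matrix_inv (braiding r q (dual_rep V) (dual_rep V)))
     ** lift12 (matrix_inv (braiding r q V (dual_rep V)))"

text \<open>A family \<open>x\<close> with legs \<open>i j k l\<close> stands for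
  \<open>\<Sum> v\<^sub>i \<otimes> f\<^sup>j \<otimes> v\<^sub>k \<otimes> f\<^sup>l \<otimes> x i j k l\<close>, so maps of the legs act on families by their matrices.\<close>

type_synonym ('i, 'x) fam2 = "'i \<Rightarrow> 'i \<Rightarrow> 'x"
type_synonym ('i, 'x) fam4 = "'i \<Rightarrow> 'i \<Rightarrow> 'i \<Rightarrow> 'i \<Rightarrow> 'x"

definition act123 ::
  "complex ^ ('i \<times> 'i \<times> 'i) ^ ('i \<times> 'i \<times> 'i) \<Rightarrow> ('i::finite, 'x::complex_space) fam4 \<Rightarrow> ('i, 'x) fam4"
where
  "act123 A x = (\<lambda>i j k l. \<Sum>(i', j', k')\<in>UNIV. A $ (i, j, k) $ (i', j', k') *\<^sub>C x i' j' k' l)"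

definition act234 ::
  "complex ^ ('i \<times> 'i \<times> 'i) ^ ('i \<times> 'i \<times> 'i) \<Rightarrow> ('i::finite, 'x::complex_space) fam4 \<Rightarrow> ('i, 'x) fam4"
where
  "act234 A x = (\<lambda>i j k l. \<Sum>(j', k', l')\<in>UNIV. A $ (j, k, l) $ (j', k', l') *\<^sub>C x i j' k' l')"

definition T_act ::
  "nat \<Rightarrow> real \<Rightarrow> 'i::finite uq_rep \<Rightarrow> ('i, 'x::complex_space) fam4 \<Rightarrow> ('i, 'x) fam4" where
  "T_act r q V x = act123 (S_map r q V) (act234 (St_map r q V) x)"

definition E23 :: "('i::finite, 'x::complex_space) fam4 \<Rightarrow> ('i, 'x) fam2" where
  "E23 x = (\<lambda>i l. \<Sum>j\<in>UNIV. x i j j l)"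

definition E'12 ::
  "nat \<Rightarrow> real \<Rightarrow> ('i \<Rightarrow> weight) \<Rightarrow> ('i::finite, 'x::complex_space) fam2 \<Rightarrow> 'x" where
  "E'12 r q wt x = (\<Sum>i\<in>UNIV. qpow q (wform r (wt i) (two_rho r)) *\<^sub>C x i i)"

definition fam_prod :: "('x \<Rightarrow> 'y \<Rightarrow> 'z) \<Rightarrow> ('i, 'x) fam2 \<Rightarrow> ('i, 'y) fam2 \<Rightarrow> ('i, 'z) fam4" where
  "fam_prod m x y = (\<lambda>i j k l. m (x i j) (y k l))"

definition a_const :: "nat \<Rightarrow> nat \<Rightarrow> real" where
  "a_const r s = wform r (simple_root s) (simple_root s)"

definition w_const :: "nat \<Rightarrow> nat \<Rightarrow> real" where
  "w_const r s = wform r (fund_weight r s) (fund_weight r s)"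

definition m_const :: "nat \<Rightarrow> nat \<Rightarrow> real" where
  "m_const r s = wform r (fund_weight r s) (two_rho r)"

text \<open>The weight basis of \<open>V(\<omega>\<^sub>s)\<close> is used to identify its underlying space with
  \<open>complex ^ 'i\<close>, so that \<open>v\<^sub>i = axis i 1\<close>.\<close>

definition quantum_data ::
  "nat \<Rightarrow> nat \<Rightarrow> real \<Rightarrow> 'i::finite uq_rep \<Rightarrow> ('i \<Rightarrow> weight) \<Rightarrow> bool" where
  "quantum_data r s q V wt \<longleftrightarrow>
     1 \<le> r \<and> s \<in> {1, r} \<and> 0 < q \<and> q < 1 \<and> CARD('i) = r + 1 \<and>
     is_V r q V (fund_weight r s) \<and> weight_basis r q V wt"

text \<open>In the free algebra, the generator \<open>p\<^sup>i\<^sup>j\<close> is the one-letter word \<open>[(i, j)]\<close>.\<close>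

definition algebra_relations ::
  "nat \<Rightarrow> nat \<Rightarrow> real \<Rightarrow> 'i::finite uq_rep \<Rightarrow> ('i \<Rightarrow> weight) \<Rightarrow> (('i \<times> 'i) list \<Rightarrow>\<^sub>0 complex) set" where
  "algebra_relations r s q V wt =
     (let pp = (\<lambda>i j k l. Poly_Mapping.single [(i, j), (k, l)] 1);
          w = w_const r s
      in {act123 (S_map r q V) pp i j k l - qpow q w *\<^sub>C pp i j k l | i j k l. True} \<union>
         {act234 (St_map r q V) pp i j k l - qpow q (- w) *\<^sub>C pp i j k l | i j k l. True} \<union>
         {E'12 r q wt (\<lambda>i j. Poly_Mapping.single [(i, j)] 1)
            - Poly_Mapping.single [] (qpow q (m_const r s))})"

definition is_algebra_B ::
  "nat \<Rightarrow> nat \<Rightarrow> real \<Rightarrow> 'i::finite uq_rep \<Rightarrow> ('i \<Rightarrow> weight) \<Rightarrow> ('i, 'b::complex_algebra_1) fam2 \<Rightarrow> bool"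
where
  "is_algebra_B r s q V wt p \<longleftrightarrow>
     presented_algebra (\<lambda>(i, j). p i j) (algebra_relations r s q V wt)"

definition plus_relations ::
  "nat \<Rightarrow> nat \<Rightarrow> real \<Rightarrow> 'i::finite uq_rep \<Rightarrow> ('i \<Rightarrow> weight) \<Rightarrow> ('i, 'b::complex_algebra_1) fam2 \<Rightarrow>
   ('b ^ ('i \<times> 'i)) set" where
  "plus_relations r s q V wt p =
     (let dp = (\<lambda>i j. axis (i, j) 1);
          pdp = fam_prod (*s) p dp
      in {act234 (St_map r q V) pdp i j k l - qpow q (- w_const r s) *\<^sub>C pdp i j k l | i j k l. True} \<union>
         {E'12 r q wt dp})"

definition minus_relations ::
  "nat \<Rightarrow> nat \<Rightarrow> real \<Rightarrow> 'i::finite uq_rep \<Rightarrow> ('i \<Rightarrow> weight) \<Rightarrow> ('i, 'b::complex_algebra_1) fam2 \<Rightarrow>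
   ('b ^ ('i \<times> 'i)) set" where
  "minus_relations r s q V wt p =
     (let dp = (\<lambda>i j. axis (i, j) 1);
          pdp = fam_prod (*s) p dp
      in {act123 (S_map r q V) pdp i j k l - qpow q (w_const r s) *\<^sub>C pdp i j k l | i j k l. True} \<union>
         {E'12 r q wt dp})"

definition is_Omega_plus ::
  "nat \<Rightarrow> nat \<Rightarrow> real \<Rightarrow> 'i::finite uq_rep \<Rightarrow> ('i \<Rightarrow> weight) \<Rightarrow> ('i, 'b::complex_algebra_1) fam2 \<Rightarrow>
   ('b, 'o::complex_space) bimod \<Rightarrow> ('b \<Rightarrow> 'o) \<Rightarrow> bool" where
  "is_Omega_plus r s q V wt p M del \<longleftrightarrow>
     bimodule M \<and> derivation M del \<and>
     presented_left_module M (\<lambda>(i, j). del (p i j)) (plus_relations r s q V wt p) \<and>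
     (let dp = (\<lambda>i j. del (p i j)) in
       \<forall>i j k l. fam_prod (ract M) dp p i j k l
         = qpow q (a_const r s) *\<^sub>C T_act r q V (fam_prod (lact M) p dp) i j k l)"

definition is_Omega_minus ::
  "nat \<Rightarrow> nat \<Rightarrow> real \<Rightarrow> 'i::finite uq_rep \<Rightarrow> ('i \<Rightarrow> weight) \<Rightarrow> ('i, 'b::complex_algebra_1) fam2 \<Rightarrow>
   ('b, 'o::complex_space) bimod \<Rightarrow> ('b \<Rightarrow> 'o) \<Rightarrow> bool" where
  "is_Omega_minus r s q V wt p M delbar \<longleftrightarrow>
     bimodule M \<and> derivation M delbar \<and>
     presented_left_module M (\<lambda>(i, j). delbar (p i j)) (minus_relations r s q V wt p) \<and>
     (let dp = (\<lambda>i j. delbar (p i j)) in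
       \<forall>i j k l. fam_prod (ract M) dp p i j k l
         = qpow q (- a_const r s) *\<^sub>C T_act r q V (fam_prod (lact M) p dp) i j k l)"

text \<open>The defining ideal of the universal calculus is generated in tensor degree two, so its
  degree-two part is the sub-bimodule generated by the same elements.\<close>

definition is_universal_two_forms ::
  "('b::complex_algebra_1, 'o::complex_space) bimod \<Rightarrow> ('b \<Rightarrow> 'o) \<Rightarrow>
   ('b, 't::complex_space) bimod \<Rightarrow> ('o \<Rightarrow> 'o \<Rightarrow> 't) \<Rightarrow>
   ('b, 'w::complex_space) bimod \<Rightarrow> ('t \<Rightarrow> 'w) \<Rightarrow> bool" where
  "is_universal_two_forms M d T2 tens W wedge \<longleftrightarrow>
     bimodule W \<and> bimodule_hom T2 W wedge \<and> surj wedge \<and>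
     (\<forall>x. wedge x = 0 \<longleftrightarrow> x \<in> sub_bimodule_generated T2
        {\<Sum>(a, b)\<leftarrow>xs. tens (d a) (d b) | xs. (\<Sum>(a, b)\<leftarrow>xs. lact M a (d b)) = 0})"

text \<open>Here \<open>\<Omega> = \<Omega>\<^sub>+ \<oplus> \<Omega>\<^sub>-\<close> is a product type, and \<open>\<partial>p\<close>, \<open>\<partial>\<close>-bar \<open>p\<close> are embedded in it.\<close>

definition is_generalized_braiding ::
  "nat \<Rightarrow> nat \<Rightarrow> real \<Rightarrow> 'i::finite uq_rep \<Rightarrow> ('i \<Rightarrow> weight) \<Rightarrow> ('i, 'b::complex_algebra_1) fam2 \<Rightarrow>
   ('b \<Rightarrow> 'op::complex_space) \<Rightarrow> ('b \<Rightarrow> 'om::complex_space) \<Rightarrow>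
   ('b, 't::complex_space) bimod \<Rightarrow> ('op \<times> 'om \<Rightarrow> 'op \<times> 'om \<Rightarrow> 't) \<Rightarrow> ('t \<Rightarrow> 't) \<Rightarrow> bool" where
  "is_generalized_braiding r s q V wt p del delbar T2 tens \<sigma> \<longleftrightarrow>
     bimodule_hom T2 T2 \<sigma> \<and>
     (let a = a_const r s; w = w_const r s; m = m_const r s;
          S = S_map r q V; St = St_map r q V;
          dp = (\<lambda>i j. (del (p i j), 0)); dbp = (\<lambda>i j. (0, delbar (p i j)));
          g_pm = E'12 r q wt (E23 (fam_prod tens dp dbp));
          g_mp = E'12 r q wt (E23 (fam_prod tens dbp dp));
          pgp = (\<lambda>g. fam_prod (\<lambda>x y. ract T2 (lact T2 x g) y) p p)
      in \<forall>i j k l.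
        \<sigma> (fam_prod tens dp dp i j k l)
          = qpow q a *\<^sub>C act123 S (act234 St (fam_prod tens dp dp)) i j k l \<and>
        \<sigma> (fam_prod tens dbp dbp i j k l)
          = qpow q (- a) *\<^sub>C act123 S (act234 St (fam_prod tens dbp dbp)) i j k l \<and>
        \<sigma> (fam_prod tens dp dbp i j k l)
          = qpow q (2 * a - 2 * w) *\<^sub>C
              act123 S (act234 (matrix_inv St) (fam_prod tens dbp dp)) i j k l
            + ((1 - qpow q a) * qpow q a * qpow q (- m)) *\<^sub>C pgp g_mp i j k l \<and>
        \<sigma> (fam_prod tens dbp dp i j k l)
          = qpow q (2 * w - 2 * a) *\<^sub>C
              act123 (matrix_inv S) (act234 St (fam_prod tens dp dbp)) i j k l
            + ((1 - qpow q (- a)) * qpow q (- m)) *\<^sub>C pgp g_pm i j k l)"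

end

theory Submission
  imports Defs "HOL-Library.Function_Algebras"
begin

text \<open>
  The map \<open>\<sigma>\<close> satisfies the braid equation \<open>\<sigma>\<^sub>1 \<sigma>\<^sub>2 \<sigma>\<^sub>1 = \<sigma>\<^sub>2 \<sigma>\<^sub>1 \<sigma>\<^sub>2\<close> on
  \<open>\<Omega> \<otimes> \<Omega> \<otimes> \<Omega>\<close>, and the theorem is the image of this equation under \<open>\<and> \<otimes> id\<close>. The proof of
  the braid equation has four layers.

  \<^emph>\<open>The braidings are explicit.\<close> The module \<open>V(\<omega>\<^sub>s)\<close> with \<open>s \<in> {1, r}\<close> is a chain
  \<open>v\<^sub>0 \<rightarrow> v\<^sub>1 \<rightarrow> \<dots> \<rightarrow> v\<^sub>r\<close> under the lowering operators (\<open>quantum_chain\<close>), in which the braiding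
  of \<open>V\<close> with itself is the standard Hecke-type R-matrix \<open>Rmat\<close>. A quarter
  turn (\<open>rot\<close>) gives the inverse of the braiding of \<open>V\<close> and \<open>V\<^sup>*\<close>, a half turn the
  braiding of \<open>V\<^sup>*\<close> with itself (\<open>quantum_braidings\<close>).

  \<^emph>\<open>The leg maps form two commuting Hecke algebras.\<close> Put \<open>a = q\<^sup>-\<^sup>w S\<close> and \<open>b = q\<^sup>w S\<close>-tilde. On
  \<open>V \<otimes> V\<^sup>* \<otimes> V \<otimes> V\<^sup>* \<otimes> V \<otimes> V\<^sup>*\<close>, moving all \<open>V\<^sup>*\<close> legs to the right turns the two copies of
  \<open>a\<close> into R-matrices between adjacent \<open>V\<close> legs and the two copies of \<open>b\<close> into inverse
  R-matrices between adjacent \<open>V\<^sup>*\<close> legs. Hence the copies of \<open>a\<close> satisfy the braid and Hecke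
  relations, so do those of \<open>b\<close>, and the two kinds commute (locale \<open>hecke_pair\<close>). The
  contractions \<open>E\<close> and \<open>E'\<close> interact with \<open>a\<close> and \<open>b\<close> in a few simple ways
  (\<open>contr_commute\<close>).

  \<^emph>\<open>The metric slides.\<close> Write \<open>d\<close> and \<open>e\<close> for the families \<open>\<partial>p\<close> and \<open>\<partial>\<close>-bar \<open>p\<close>. The relations of
  the calculus say which products are fixed by \<open>a\<close> or \<open>b\<close>. From them one gets that the two metric
  components are central and are exchanged by \<open>\<sigma>\<close> (\<open>central_mp\<close>, \<open>central_pm\<close>, \<open>sg_g\<close>), that
  \<open>\<sigma>\<close> is an involution on mixed products (\<open>sg_sg\<close>), and that a metric component moves
  through a one-form by the action of \<open>\<sigma>\<^sub>1\<close> and \<open>\<sigma>\<^sub>2\<close> (\<open>slide1\<close> to \<open>slide4\<close>).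

  \<^emph>\<open>Sectors.\<close> On triple products of generators the braid equation splits by the number of
  factors \<open>d\<close> and \<open>e\<close>. For \<open>d d d\<close> and \<open>e e e\<close> it is the braid relation of \<open>a\<close> and of \<open>b\<close>. With
  two \<open>d\<close> and one \<open>e\<close>, both sides expand into a leading term, equal by the Hecke algebra relations,
  and metric terms, which match by the slide identities and quadratic relations of \<open>\<sigma>\<close> (locale
  \<open>sector\<close>). Exchanging \<open>d\<close> with \<open>e\<close>, \<open>a\<close> with \<open>b\<close> and \<open>t = q\<^sup>2\<close> with its inverse gives the other
  mixed sector. Since both sides of the braid equation are bimodule maps and generators can be
  moved into place by the balancing of the tensor products, equality on
  these triples suffices (\<open>braid_everywhere\<close>).
\<close>

section \<open>Families and maps of their legs\<close>

instantiation "fun" :: (type, complex_space) complex_space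
begin
definition scaleC_fun :: "complex \<Rightarrow> ('a \<Rightarrow> 'b) \<Rightarrow> 'a \<Rightarrow> 'b"
  where "scaleC_fun c f = (\<lambda>x. c *\<^sub>C f x)"
instance
  by standard
    (auto simp: scaleC_fun_def fun_eq_iff scaleC_add_right scaleC_add_left scaleC_scaleC scaleC_one)
end

lemma scaleC_apply [simp]: "(c *\<^sub>C f) x = c *\<^sub>C f x"
  by (simp add: scaleC_fun_def)

lemmas scaleC_sum = complex_space.scale_sum_right
lemmas scaleC_zero_right [simp] = complex_space.scale_zero_right
lemmas scaleC_zero_left [simp] = complex_space.scale_zero_left

declare scaleC_one [simp]

text \<open>A family carries infinitely many legs, of which only finitely many matter: its value at \<open>f\<close> is the
  component with index \<open>f n\<close> on leg \<open>n\<close>. Families with any number of legs thus share one type, and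
  contracting two legs renumbers the later ones by composition with \<open>ins2\<close>.\<close>

type_synonym ('i, 'x) fam = "(nat \<Rightarrow> 'i) \<Rightarrow> 'x"

definition leg2 ::
  "complex ^ ('i \<times> 'i) ^ ('i \<times> 'i) \<Rightarrow> nat \<Rightarrow> ('i::finite, 'x::complex_space) fam \<Rightarrow> ('i, 'x) fam"
where
  "leg2 M n x = (\<lambda>f. \<Sum>u\<in>UNIV. M $ (f n, f (Suc n)) $ u *\<^sub>C x (f(n := fst u, Suc n := snd u)))"

definition leg3 ::
  "complex ^ ('i \<times> 'i \<times> 'i) ^ ('i \<times> 'i \<times> 'i) \<Rightarrow> nat \<Rightarrow> ('i::finite, 'x::complex_space) fam \<Rightarrow> ('i, 'x) fam"
where
  "leg3 M n x = (\<lambda>f. \<Sum>u\<in>UNIV. M $ (f n, f (Suc n), f (Suc (Suc n))) $ u *\<^sub>C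
     x (f(n := fst u, Suc n := fst (snd u), Suc (Suc n) := snd (snd u))))"

definition ins2 :: "nat \<Rightarrow> 'i \<Rightarrow> 'i \<Rightarrow> (nat \<Rightarrow> 'i) \<Rightarrow> nat \<Rightarrow> 'i" where
  "ins2 n a b f = (\<lambda>m. if m < n then f m else if m = n then a else if m = Suc n then b else f (m - 2))"

definition contr :: "('i \<Rightarrow> complex) \<Rightarrow> nat \<Rightarrow> ('i::finite, 'x::complex_space) fam \<Rightarrow> ('i, 'x) fam" where
  "contr \<tau> n x = (\<lambda>f. \<Sum>a\<in>UNIV. \<tau> a *\<^sub>C x (ins2 n a a f))"

abbreviation "ev \<equiv> contr (\<lambda>_. 1)"

lemma leg2_add: "leg2 M n (x + y) = leg2 M n x + leg2 M n y"
  by (auto simp: leg2_def fun_eq_iff scaleC_add_right sum.distrib)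
lemma leg3_add: "leg3 M n (x + y) = leg3 M n x + leg3 M n y"
  by (auto simp: leg3_def fun_eq_iff scaleC_add_right sum.distrib)
lemma contr_add: "contr \<tau> n (x + y) = contr \<tau> n x + contr \<tau> n y"
  by (auto simp: contr_def fun_eq_iff scaleC_add_right sum.distrib)
lemma leg2_scale: "leg2 M n (c *\<^sub>C x) = c *\<^sub>C leg2 M n x"
  by (auto simp: leg2_def fun_eq_iff scaleC_scaleC scaleC_sum mult.commute)
lemma leg3_scale: "leg3 M n (c *\<^sub>C x) = c *\<^sub>C leg3 M n x"
  by (auto simp: leg3_def fun_eq_iff scaleC_scaleC scaleC_sum mult.commute)
lemma contr_scale: "contr \<tau> n (c *\<^sub>C x) = c *\<^sub>C contr \<tau> n x"
  by (auto simp: contr_def fun_eq_iff scaleC_scaleC scaleC_sum mult.commute)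

lemma leg2_comp:
  fixes x :: "('i::finite, 'x::complex_space) fam"
  shows "leg2 M n (leg2 N n x) = leg2 (M ** N) n x"
proof (rule ext)
  fix f :: "nat \<Rightarrow> 'i"
  have "leg2 M n (leg2 N n x) f = (\<Sum>u\<in>UNIV. \<Sum>v\<in>UNIV.
      (M $ (f n, f (Suc n)) $ u * N $ u $ v) *\<^sub>C x (f(n := fst v, Suc n := snd v)))"
    by (simp add: leg2_def scaleC_sum scaleC_scaleC fun_upd_twist)
  also have "\<dots> = (\<Sum>v\<in>UNIV. \<Sum>u\<in>UNIV.
      (M $ (f n, f (Suc n)) $ u * N $ u $ v) *\<^sub>C x (f(n := fst v, Suc n := snd v)))"
    by (rule sum.swap)
  also have "\<dots> = leg2 (M ** N) n x f"
    by (simp add: leg2_def matrix_matrix_mult_def complex_space.scale_sum_left)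
  finally show "leg2 M n (leg2 N n x) f = leg2 (M ** N) n x f" .
qed

lemma leg3_comp:
  fixes x :: "('i::finite, 'x::complex_space) fam"
  shows "leg3 M n (leg3 N n x) = leg3 (M ** N) n x"
proof (rule ext)
  fix f :: "nat \<Rightarrow> 'i"
  have upd: "f(n := a, Suc n := b, Suc (Suc n) := c, n := a', Suc n := b', Suc (Suc n) := c') =
     f(n := a', Suc n := b', Suc (Suc n) := c')" for a b c a' b' c'
    by (auto simp: fun_eq_iff)
  have "leg3 M n (leg3 N n x) f = (\<Sum>u\<in>UNIV. \<Sum>v\<in>UNIV.
      (M $ (f n, f (Suc n), f (Suc (Suc n))) $ u * N $ u $ v) *\<^sub>C
        x (f(n := fst v, Suc n := fst (snd v), Suc (Suc n) := snd (snd v))))"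
    by (simp add: leg3_def scaleC_sum scaleC_scaleC upd)
  also have "\<dots> = (\<Sum>v\<in>UNIV. \<Sum>u\<in>UNIV.
      (M $ (f n, f (Suc n), f (Suc (Suc n))) $ u * N $ u $ v) *\<^sub>C
        x (f(n := fst v, Suc n := fst (snd v), Suc (Suc n) := snd (snd v))))"
    by (rule sum.swap)
  also have "\<dots> = leg3 (M ** N) n x f"
    by (simp add: leg3_def matrix_matrix_mult_def complex_space.scale_sum_left)
  finally show "leg3 M n (leg3 N n x) f = leg3 (M ** N) n x f" .
qed

lemma sum_delta_scale:
  fixes x :: "'k::finite \<Rightarrow> 'x::complex_space"
  shows "(\<Sum>u\<in>UNIV. (if u = v then c u else 0) *\<^sub>C x u) = c v *\<^sub>C x v"
    and "(\<Sum>u\<in>UNIV. (if v = u then c u else 0) *\<^sub>C x u) = c v *\<^sub>C x v"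
  by (simp_all add: if_distrib[where f = "\<lambda>c. c *\<^sub>C _"] cong: if_cong)

lemma leg2_one: "leg2 (mat 1) n x = x"
  by (simp add: leg2_def mat_def sum_delta_scale fun_eq_iff)

lemma leg3_one: "leg3 (mat 1) n x = x"
  by (simp add: leg3_def mat_def sum_delta_scale fun_eq_iff)

text \<open>The leg maps on three legs are sums over triples of indices. When the matrix acts on two of
  the legs only, the sum is supported on an injective image of the pairs.\<close>

lemma sum_support_image:
  fixes g :: "'k::finite \<Rightarrow> 'x::ab_group_add" and h :: "'j::finite \<Rightarrow> 'k"
  assumes "inj h" "\<And>u. u \<notin> range h \<Longrightarrow> g u = 0"
  shows "(\<Sum>u\<in>UNIV. g u) = (\<Sum>v\<in>UNIV. g (h v))"
proof -
  have "(\<Sum>u\<in>UNIV. g u) = (\<Sum>u\<in>range h. g u)"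
    by (rule sum.mono_neutral_right) (use assms(2) in auto)
  also have "\<dots> = (\<Sum>v\<in>UNIV. g (h v))"
    by (simp add: sum.reindex[OF assms(1)])
  finally show ?thesis .
qed

lemma leg3_lift12:
  fixes x :: "('i::finite, 'x::complex_space) fam"
  shows "leg3 (lift12 A) n x = leg2 A n x"
proof (rule ext)
  fix f :: "nat \<Rightarrow> 'i"
  show "leg3 (lift12 A) n x f = leg2 A n x f"
    unfolding leg3_def leg2_def
    by (subst sum_support_image[where h = "\<lambda>u. (fst u, snd u, f (Suc (Suc n)))"])
       (force simp: inj_on_def lift12_def fun_upd_idem image_iff split: prod.splits)+
qed

lemma leg3_lift23:
  fixes x :: "('i::finite, 'x::complex_space) fam"
  shows "leg3 (lift23 A) n x = leg2 A (Suc n) x"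
proof (rule ext)
  fix f :: "nat \<Rightarrow> 'i"
  show "leg3 (lift23 A) n x f = leg2 A (Suc n) x f"
    unfolding leg3_def leg2_def
    by (subst sum_support_image[where h = "\<lambda>u. (f n, u)"])
       (force simp: inj_on_def lift23_def fun_upd_idem image_iff split: prod.splits)+
qed

lemma leg2_far:
  fixes x :: "('i::finite, 'x::complex_space) fam"
  assumes "Suc (Suc n) \<le> m"
  shows "leg2 M n (leg2 N m x) = leg2 N m (leg2 M n x)"
proof (rule ext)
  fix f :: "nat \<Rightarrow> 'i"
  have upd: "f(n := a, Suc n := b, m := c, Suc m := d) = f(m := c, Suc m := d, n := a, Suc n := b)" for a b c d
    using assms by (auto simp: fun_eq_iff)
  show "leg2 M n (leg2 N m x) f = leg2 N m (leg2 M n x) f"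
    using assms unfolding leg2_def
    by (simp add: scaleC_sum scaleC_scaleC upd) (subst sum.swap, simp add: mult.commute)
qed

lemma ins2_upd:
  assumes "n \<le> m"
  shows "(ins2 n a b f)(Suc (Suc m) := c) = ins2 n a b (f(m := c))"
  using assms by (auto simp: ins2_def fun_eq_iff)

lemma ins2_upd':
  assumes "m < n"
  shows "(ins2 n a b f)(m := c) = ins2 n a b (f(m := c))"
  using assms by (auto simp: ins2_def fun_eq_iff)

text \<open>A contraction removes two legs, so a map on later legs changes its position by two.\<close>

lemma contr_leg2_right:
  assumes "n \<le> m"
  shows "contr \<tau> n (leg2 M (Suc (Suc m)) x) = leg2 M m (contr \<tau> n x)"
proof -
  have 1: "ins2 n a b f (Suc (Suc m)) = f m" "ins2 n a b f (Suc (Suc (Suc m))) = f (Suc m)" for a b f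
    using assms by (auto simp: ins2_def)
  show ?thesis
    using assms unfolding leg2_def contr_def
    by (simp add: scaleC_sum scaleC_scaleC ins2_upd 1 fun_eq_iff) (subst sum.swap, simp add: mult.commute)
qed

lemma contr_leg2_left:
  assumes "Suc (Suc m) \<le> n"
  shows "contr \<tau> n (leg2 M m x) = leg2 M m (contr \<tau> n x)"
proof -
  have 1: "ins2 n a b f m = f m" "ins2 n a b f (Suc m) = f (Suc m)" for a b f
    using assms by (auto simp: ins2_def)
  show ?thesis
    using assms unfolding leg2_def contr_def
    by (simp add: scaleC_sum scaleC_scaleC ins2_upd' 1 fun_eq_iff) (subst sum.swap, simp add: mult.commute)
qed

text \<open>The rotation \<open>rot M\<close> moves one input leg of \<open>M\<close> to the output and one output leg to the input, by means
  of a cup and a cap. It is the partial transpose that occurs in the passage to dual modules.\<close>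

definition rot :: "complex ^ ('i \<times> 'j::finite) ^ ('j \<times> 'i::finite) \<Rightarrow> complex ^ ('j \<times> 'i) ^ ('i \<times> 'j)" where
  "rot M = (\<chi> u v. M $ (fst v, fst u) $ (snd v, snd u))"

text \<open>Sliding \<open>M\<close> through the cap given by the evaluation rotates it. This is the only way in
  which braidings of different leg types get related.\<close>

lemma ev_leg2:
  fixes x :: "('i::finite, 'x::complex_space) fam"
  shows "ev n (leg2 M (Suc n) x) = ev (Suc n) (leg2 (rot M) n x)"
proof (rule ext)
  fix f :: "nat \<Rightarrow> 'i"
  have 1: "ins2 n a a f (Suc n) = a" "ins2 n a a f (Suc (Suc n)) = f n"
    "ins2 (Suc n) a a f n = f n" "ins2 (Suc n) a a f (Suc n) = a" for a
    by (auto simp: ins2_def)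
  have 2: "(ins2 n i i f)(Suc n := j, Suc (Suc n) := k) = (ins2 (Suc n) k k f)(n := i, Suc n := j)" for i j k
    by (auto simp: ins2_def fun_eq_iff)
  have "ev n (leg2 M (Suc n) x) f = (\<Sum>i\<in>UNIV. \<Sum>j\<in>UNIV. \<Sum>k\<in>UNIV.
     M $ (i, f n) $ (j, k) *\<^sub>C x ((ins2 (Suc n) k k f)(n := i, Suc n := j)))"
    by (simp add: contr_def leg2_def 1 2 flip: UNIV_Times_UNIV)
       (simp add: sum.cartesian_product split_def)
  also have "\<dots> = (\<Sum>k\<in>UNIV. \<Sum>i\<in>UNIV. \<Sum>j\<in>UNIV.
     M $ (i, f n) $ (j, k) *\<^sub>C x ((ins2 (Suc n) k k f)(n := i, Suc n := j)))"
    by (subst (3) sum.swap, subst sum.swap) (rule refl)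
  also have "\<dots> = ev (Suc n) (leg2 (rot M) n x) f"
    by (simp add: contr_def leg2_def rot_def 1 flip: UNIV_Times_UNIV)
       (simp add: sum.cartesian_product split_def)
  finally show "ev n (leg2 M (Suc n) x) f = ev (Suc n) (leg2 (rot M) n x) f" .
qed

text \<open>Tensoring with one basis vector on a new leg. Evaluating that leg against its left neighbour
  reads off components, so the evaluation is nondegenerate (\<open>ev_cancel\<close>): identities may be
  proved after attaching a cap.\<close>

definition open_leg :: "nat \<Rightarrow> 'i \<Rightarrow> ('i, 'x::complex_space) fam \<Rightarrow> ('i, 'x) fam" where
  "open_leg l b x = (\<lambda>f. if f l = b then x (\<lambda>m. if m < l then f m else f (Suc m)) else 0)"

lemma leg2_open_leg:
  assumes "Suc k < l"
  shows "leg2 M k (open_leg l b x) = open_leg l b (leg2 M k x)"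
proof -
  have "(\<lambda>m. if m < l then (f(k := c, Suc k := d)) m else (f(k := c, Suc k := d)) (Suc m)) =
        (\<lambda>m. if m < l then f m else f (Suc m))(k := c, Suc k := d)" for f :: "nat \<Rightarrow> 'a" and c d
    using assms by (auto simp: fun_eq_iff)
  then show ?thesis
    using assms unfolding leg2_def open_leg_def by (intro ext) (simp del: fun_upd_apply, simp)
qed

lemma ev_open_leg: "ev l (open_leg (Suc l) b x) f = x (\<lambda>m. if m < l then f m else if m = l then b else f (m - 1))"
proof -
  have "ev l (open_leg (Suc l) b x) f =
    (\<Sum>a\<in>UNIV. if a = b then x (\<lambda>m. if m < l then f m else if m = l then a else f (m - 1)) else 0)"
    unfolding contr_def open_leg_def
    by (rule sum.cong) (auto simp: ins2_def fun_eq_iff intro!: arg_cong[of _ _ x])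
  then show ?thesis by simp
qed

lemma ev_cancel:
  fixes x y :: "('i::finite, 'x::complex_space) fam"
  assumes "\<And>b. ev l (open_leg (Suc l) b x) = ev l (open_leg (Suc l) b y)"
  shows "x = y"
proof (rule ext)
  fix g :: "nat \<Rightarrow> 'i"
  have "(\<lambda>m. if m < l then (\<lambda>m. if m < l then g m else g (Suc m)) m else if m = l then g l
      else (\<lambda>m. if m < l then g m else g (Suc m)) (m - 1)) = g"
    by (auto simp: fun_eq_iff)
  then show "x g = y g"
    using fun_cong[OF assms[of "g l"], of "\<lambda>m. if m < l then g m else g (Suc m)"]
    by (simp add: ev_open_leg)
qed

text \<open>The braiding of the vector representation, up to the scalar \<open>z\<close>: the flip, with \<open>q\<close> on the
  diagonal, plus \<open>q - 1/q\<close> times the projection onto pairs in decreasing order. The ordering of the basis is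
  encoded by the injective function \<open>l\<close>; reversing it gives the matrix for the dual module.\<close>

definition Rmat :: "complex \<Rightarrow> complex \<Rightarrow> ('i \<Rightarrow> int) \<Rightarrow> complex ^ ('i::finite \<times> 'i) ^ ('i \<times> 'i)" where
  "Rmat z q l = (\<chi> u v.
     (if v = (snd u, fst u) then z * (if fst u = snd u then q else 1) else 0) +
     (if v = u then z * (if l (snd u) < l (fst u) then q - 1 / q else 0) else 0))"

lemma rot_rot_Rmat: "rot (rot (Rmat z q l)) = Rmat z q (\<lambda>i. - l i)"
  by (auto simp: rot_def Rmat_def vec_eq_iff)

lemma leg2_Rmat:
  "leg2 (Rmat z q l) n x f =
     (z * (if f n = f (Suc n) then q else 1)) *\<^sub>C x (f(n := f (Suc n), Suc n := f n)) +
     (z * (if l (f (Suc n)) < l (f n) then q - 1 / q else 0)) *\<^sub>C x f"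
  by (simp add: leg2_def Rmat_def scaleC_add_left sum.distrib sum_delta_scale)

lemma scaleC_collect: "a *\<^sub>C x + b *\<^sub>C x = (a + b) *\<^sub>C (x::'x::complex_space)"
  "a *\<^sub>C x + (b *\<^sub>C x + y) = (a + b) *\<^sub>C x + y"
  by (simp_all add: scaleC_add_left)

text \<open>The quadratic relation of the R-matrix, whose eigenvalues are \<open>z q\<close> and \<open>- z / q\<close>.\<close>

lemma Rmat_hecke:
  fixes x :: "('i::finite, 'x::complex_space) fam"
  assumes "inj l" "q \<noteq> 0"
  shows "leg2 (Rmat z q l) n (leg2 (Rmat z q l) n x) =
    (z * (q - 1 / q)) *\<^sub>C leg2 (Rmat z q l) n x + z\<^sup>2 *\<^sub>C x"
proof (rule ext)
  fix f :: "nat \<Rightarrow> 'i"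
  have u: "f(n := f (Suc n), Suc n := f n, n := f n, Suc n := f (Suc n)) = f"
    by (auto simp: fun_eq_iff)
  have u': "f(n := f (Suc n)) = f" if "f (Suc n) = f n" 
    using that by (auto simp: fun_eq_iff)
  consider "f n = f (Suc n)" | "l (f n) < l (f (Suc n))" | "l (f (Suc n)) < l (f n)"
    using assms(1) by (metis injD linorder_less_linear)
  then show "leg2 (Rmat z q l) n (leg2 (Rmat z q l) n x) f =
    ((z * (q - 1 / q)) *\<^sub>C leg2 (Rmat z q l) n x + z\<^sup>2 *\<^sub>C x) f"
  proof cases
    case 1
    then show ?thesis using assms(2)
      by (simp add: leg2_Rmat u u' scaleC_add_right scaleC_scaleC scaleC_collect)
         (simp add: algebra_simps power2_eq_square)
  next
    case 2
    then have "f n \<noteq> f (Suc n)" by auto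
    with 2 show ?thesis using assms(2)
      by (simp add: leg2_Rmat u scaleC_add_right scaleC_scaleC scaleC_collect)
         (simp add: algebra_simps power2_eq_square)
  next
    case 3
    then have "f n \<noteq> f (Suc n)" by auto
    with 3 show ?thesis using assms(2)
      by (simp add: leg2_Rmat u scaleC_add_right scaleC_scaleC scaleC_collect)
         (simp add: algebra_simps power2_eq_square)
  qed
qed

text \<open>The Yang-Baxter equation is a finite check on the relative order of three basis indices, since
  \<open>Rmat\<close> only permutes the indices it acts on.\<close>

lemma Rmat_braid:
  fixes l :: "'i::finite \<Rightarrow> int" and x :: "('i, 'x::complex_space) fam"
  assumes "inj l" "q \<noteq> 0"
  shows "leg2 (Rmat z q l) n (leg2 (Rmat z q l) (Suc n) (leg2 (Rmat z q l) n x)) =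
    leg2 (Rmat z q l) (Suc n) (leg2 (Rmat z q l) n (leg2 (Rmat z q l) (Suc n) x))"
proof (rule ext)
  fix f :: "nat \<Rightarrow> 'i"
  define U where "U a b c = f(n := a, Suc n := b, Suc (Suc n) := c)" for a b c
  define h where "h = q - 1 / q"
  have U: "U a b c n = a" "U a b c (Suc n) = b" "U a b c (Suc (Suc n)) = c"
     "(U a b c)(n := b, Suc n := a) = U b a c" "(U a b c)(Suc n := c, Suc (Suc n) := b) = U a c b" for a b c
    by (auto simp: U_def fun_eq_iff)
  have qq: "q * q = 1 + h * q" "q * (q * y) = y + h * (q * y)" for y
    using assms(2) by (simp_all add: h_def field_simps)
  have s1: "leg2 (Rmat z q l) n y (U a b c) = (z * (if a = b then q else 1)) *\<^sub>C y (U b a c) +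
     (z * (if l b < l a then h else 0)) *\<^sub>C y (U a b c)" for y :: "('i, 'x) fam" and a b c
    by (simp add: leg2_Rmat U h_def)
  have s2: "leg2 (Rmat z q l) (Suc n) y (U a b c) = (z * (if b = c then q else 1)) *\<^sub>C y (U a c b) +
     (z * (if l c < l b then h else 0)) *\<^sub>C y (U a b c)" for y :: "('i, 'x) fam" and a b c
    by (simp add: leg2_Rmat U h_def)
  have lin: "a = b \<and> \<not> l a < l b \<and> \<not> l b < l a \<or> a \<noteq> b \<and> b \<noteq> a \<and> l a < l b \<and> \<not> l b < l a \<or>
      a \<noteq> b \<and> b \<noteq> a \<and> \<not> l a < l b \<and> l b < l a" for a b
    using injD[OF assms(1), of a b] by fastforce
  have key: "leg2 (Rmat z q l) n (leg2 (Rmat z q l) (Suc n) (leg2 (Rmat z q l) n x)) (U a b c) =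
    leg2 (Rmat z q l) (Suc n) (leg2 (Rmat z q l) n (leg2 (Rmat z q l) (Suc n) x)) (U a b c)" for a b c
    using lin[of a b] lin[of b c] lin[of a c]
    by (elim disjE; elim conjE; simp add: s1 s2 scaleC_add_right scaleC_scaleC)
       (auto simp: scaleC_add_left qq algebra_simps)
  have "f = U (f n) (f (Suc n)) (f (Suc (Suc n)))" by (auto simp: U_def)
  then show "leg2 (Rmat z q l) n (leg2 (Rmat z q l) (Suc n) (leg2 (Rmat z q l) n x)) f =
    leg2 (Rmat z q l) (Suc n) (leg2 (Rmat z q l) n (leg2 (Rmat z q l) (Suc n) x)) f"
    using key by metis
qed

lemma leg2_far_low_in:
  "leg2 M n (leg2 N (Suc (Suc n)) x) = leg2 N (Suc (Suc n)) (leg2 M n x)"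
  "leg2 M n (leg2 N (Suc (Suc (Suc n))) x) = leg2 N (Suc (Suc (Suc n))) (leg2 M n x)"
  "leg2 M n (leg2 N (Suc (Suc (Suc (Suc n)))) x) = leg2 N (Suc (Suc (Suc (Suc n)))) (leg2 M n x)"
  by (rule leg2_far; simp)+

lemmas leg2_far_low_out = leg2_far_low_in[symmetric]

text \<open>A strand of the dual type may be pulled over a crossing. After capping off with \<open>ev_cancel\<close> the
  rotated maps become \<open>R\<close> itself, and the claim is the Yang-Baxter equation.\<close>

lemma R_rot_slide:
  fixes x :: "('i::finite, 'x::complex_space) fam"
  assumes YB: "\<And>n x. leg2 R n (leg2 R (Suc n) (leg2 R n (x :: ('i, 'x) fam))) =
    leg2 R (Suc n) (leg2 R n (leg2 R (Suc n) x))"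
  shows "leg2 R n (leg2 (rot R) (Suc n) (leg2 (rot R) n x)) =
    leg2 (rot R) (Suc n) (leg2 (rot R) n (leg2 R (Suc n) x))"
proof -
  \<comment> \<open>capping off leg \<open>n + 2\<close> rotates both dual crossings back into \<open>R\<close>\<close>
  have A: "ev (Suc (Suc n)) (leg2 R n (leg2 (rot R) (Suc n) (leg2 (rot R) n y))) =
      ev (Suc (Suc n)) (leg2 (rot R) (Suc n) (leg2 (rot R) n (leg2 R (Suc n) y)))" for y :: "('i, 'x) fam"
    by (simp add: contr_leg2_left contr_leg2_right leg2_far_low_out YB flip: ev_leg2)
  show ?thesis
    by (rule ev_cancel[where l = "Suc (Suc n)"]) (simp add: A flip: leg2_open_leg)
qed

text \<open>The same pulling principle for a crossing of two dual strands, which is \<open>R\<close> rotated twice.\<close>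

lemma rot_rot_slide:
  fixes x :: "('i::finite, 'x::complex_space) fam"
  assumes YB: "\<And>n x. leg2 R n (leg2 R (Suc n) (leg2 R n (x :: ('i, 'x) fam))) =
    leg2 R (Suc n) (leg2 R n (leg2 R (Suc n) x))"
  shows "leg2 (rot (rot R)) (Suc n) (leg2 (rot R) n (leg2 (rot R) (Suc n) x)) =
    leg2 (rot R) n (leg2 (rot R) (Suc n) (leg2 (rot (rot R)) n x))"
proof -
  have A: "ev (Suc (Suc n)) (leg2 (rot (rot R)) (Suc n) (leg2 (rot R) n (leg2 (rot R) (Suc n) y))) =
      ev (Suc (Suc n)) (leg2 (rot R) n (leg2 (rot R) (Suc n) (leg2 (rot (rot R)) n y)))" for y :: "('i, 'x) fam"
  proof -
    have "ev (Suc (Suc n)) (leg2 (rot (rot R)) (Suc n) (leg2 (rot R) n (leg2 (rot R) (Suc n) y))) =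
      ev n (leg2 (rot R) (Suc (Suc n)) (leg2 (rot R) (Suc n) (leg2 R (Suc (Suc n)) y)))"
      by (simp add: leg2_far_low_out R_rot_slide[OF YB] flip: ev_leg2)
    also have "\<dots> = leg2 (rot R) n (ev (Suc n) (leg2 (rot (rot R)) n (leg2 R (Suc (Suc n)) y)))"
      by (simp add: contr_leg2_right ev_leg2)
    also have "\<dots> = leg2 (rot R) n (ev (Suc n) (leg2 R (Suc (Suc n)) (leg2 (rot (rot R)) n y)))"
      by (simp add: leg2_far_low_in)
    also have "\<dots> = ev (Suc (Suc n)) (leg2 (rot R) n (leg2 (rot R) (Suc n) (leg2 (rot (rot R)) n y)))"
      by (simp add: contr_leg2_left ev_leg2)
    finally show ?thesis .
  qed
  show ?thesis
    by (rule ev_cancel[where l = "Suc (Suc n)"]) (simp add: A flip: leg2_open_leg)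
qed

lemma leg2_inv_move:
  assumes "\<And>x. P (leg2 M n x) = leg2 M m (P x)" "N ** M = mat 1" "M ** N = mat 1"
  shows "P (leg2 N n x) = leg2 N m (P x)"
proof -
  have "P (leg2 N n x) = leg2 N m (leg2 M m (P (leg2 N n x)))"
    by (simp add: leg2_comp assms leg2_one)
  also have "\<dots> = leg2 N m (P x)"
    by (simp add: assms(1)[symmetric] leg2_comp assms leg2_one)
  finally show ?thesis .
qed

section \<open>The two commuting Hecke algebras on legs\<close>

text \<open>Here \<open>C\<close> is the braiding of \<open>V\<close> with \<open>V\<^sup>*\<close> and \<open>Ri\<close> the inverse of the braiding of \<open>V\<^sup>*\<close> with itself. The weights \<open>\<tau>\<close>
  are those of \<open>E'\<close>, and \<open>trC\<close> says that closing the crossing of \<open>V\<^sup>*\<close> and \<open>V\<close> with \<open>E'\<close> gives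
  a multiple of \<open>E\<close>.\<close>

locale leg_calculus =
  fixes q z :: complex and l :: "'i::finite \<Rightarrow> int"
    and C Ri :: "complex ^ ('i \<times> 'i) ^ ('i \<times> 'i)" and \<tau> :: "'i \<Rightarrow> complex" and \<kappa> :: complex
  assumes q0: "q \<noteq> 0" and z0: "z \<noteq> 0" and k0: "\<kappa> \<noteq> 0" and injl: "inj l"
    and C: "C ** rot (Rmat z q l) = mat 1" "rot (Rmat z q l) ** C = mat 1"
    and Ri: "Ri ** Rmat z q (\<lambda>i. - l i) = mat 1" "Rmat z q (\<lambda>i. - l i) ** Ri = mat 1"
    and trC: "(\<Sum>b\<in>UNIV. \<tau> b * rot (Rmat z q l) $ (b, b) $ (i, j)) = (if i = j then \<kappa> else 0)"
begin

abbreviation "Ro \<equiv> leg2 (Rmat z q l)"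
abbreviation "Co \<equiv> leg2 C"
abbreviation "Ci \<equiv> leg2 (rot (Rmat z q l))"
abbreviation "Rv \<equiv> leg2 (Rmat z q (\<lambda>i. - l i))"
abbreviation "Rvi \<equiv> leg2 Ri"

lemma cancel: "Co n (Ci n x) = x" "Ci n (Co n x) = x" "Rvi n (Rv n x) = x" "Rv n (Rvi n x) = x"
  by (simp_all add: leg2_comp C Ri leg2_one)

lemma slide_Ci: "Ro n (Ci (Suc n) (Ci n x)) = Ci (Suc n) (Ci n (Ro (Suc n) x))"
  by (rule R_rot_slide) (rule Rmat_braid[OF injl q0])

lemma slide_Rv: "Rv (Suc n) (Ci n (Ci (Suc n) x)) = Ci n (Ci (Suc n) (Rv n x))"
  using rot_rot_slide[of "Rmat z q l"] by (simp add: rot_rot_Rmat Rmat_braid[OF injl q0])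

lemma slide_Rvi: "Rvi (Suc n) (Ci n (Ci (Suc n) x)) = Ci n (Ci (Suc n) (Rvi n x))"
  using leg2_inv_move[of "\<lambda>x. Ci n (Ci (Suc n) x)", OF _ Ri] slide_Rv by metis

definition S :: "complex ^ ('i \<times> 'i \<times> 'i) ^ ('i \<times> 'i \<times> 'i)" where
  "S = lift23 C ** lift12 (Rmat z q l) ** lift23 (rot (Rmat z q l))"
definition St :: "complex ^ ('i \<times> 'i \<times> 'i) ^ ('i \<times> 'i \<times> 'i)" where
  "St = lift12 C ** lift23 Ri ** lift12 (rot (Rmat z q l))"

lemma S_op: "leg3 S n x = Co (Suc n) (Ro n (Ci (Suc n) x))"
  by (simp add: S_def leg3_lift12 leg3_lift23 flip: leg3_comp)
lemma St_op: "leg3 St n x = Co n (Rvi (Suc n) (Ci n x))"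
  by (simp add: St_def leg3_lift12 leg3_lift23 flip: leg3_comp)

text \<open>By the slide identities, \<open>S\<close> may equally be conjugated by the braiding on its first two legs. In
  this form it meets \<open>E'\<close> of the first two legs, and the other form suits \<open>E\<close> of the last two.\<close>

lemma S_op': "leg3 S n x = Ci n (Ro (Suc n) (Co n x))"
  using arg_cong[OF slide_Ci[of n "Co n x"], of "Co (Suc n)"] by (simp add: S_op cancel)
lemma St_op': "leg3 St n x = Ci (Suc n) (Rvi n (Co (Suc n) x))"
  using arg_cong[OF slide_Rvi[of n "Co (Suc n) x"], of "Co n"] by (simp add: St_op cancel)

text \<open>Sorting six alternating legs of types \<open>V\<close> and \<open>V\<^sup>*\<close>: all legs of type \<open>V\<close> are moved to the left.
  In the sorted order \<open>S\<close> acts on adjacent \<open>V\<close> legs and \<open>St\<close> on adjacent \<open>V\<^sup>*\<close> legs by a single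
  R-matrix, which is how the Hecke, braid and commutation relations below arise.\<close>

definition srt where "srt n x = Ci (Suc (Suc n)) (Ci (Suc (Suc (Suc n))) (Ci (Suc n) x))"
definition usrt where "usrt n x = Co (Suc n) (Co (Suc (Suc (Suc n))) (Co (Suc (Suc n)) x))"

lemma srt_inv: "srt n (usrt n x) = x" "usrt n (srt n x) = x"
  by (simp_all add: srt_def usrt_def cancel leg2_far_low_in)

lemma S_srt: "leg3 S n x = usrt n (Ro n (srt n x))"
  by (simp add: srt_def usrt_def S_op leg2_far_low_in cancel)

lemma S2_srt: "leg3 S (Suc (Suc n)) x = usrt n (Ro (Suc n) (srt n x))"
proof -
  have "usrt n (Ro (Suc n) (srt n x)) =
     Co (Suc n) (Co (Suc (Suc (Suc n))) (leg3 S (Suc n) (Ci (Suc (Suc (Suc n))) (Ci (Suc n) x))))"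
    by (simp add: srt_def usrt_def S_op)
  also have "\<dots> = Co (Suc (Suc (Suc n))) (Ro (Suc (Suc n)) (Ci (Suc (Suc (Suc n))) x))"
    by (simp add: S_op' leg2_far_low_out cancel)
  finally show ?thesis by (simp add: S_op)
qed

lemma St_srt: "leg3 St (Suc n) x = usrt n (Rvi (Suc (Suc (Suc n))) (srt n x))"
proof -
  have "usrt n (Rvi (Suc (Suc (Suc n))) (srt n x)) =
     Co (Suc n) (Co (Suc (Suc (Suc n))) (leg3 St (Suc (Suc n)) (Ci (Suc (Suc (Suc n))) (Ci (Suc n) x))))"
    by (simp add: srt_def usrt_def St_op)
  also have "\<dots> = leg3 St (Suc n) x"
    by (simp add: St_op' cancel) (simp add: St_op flip: St_op')
  finally show ?thesis by simp
qed

lemma St2_srt: "leg3 St (Suc (Suc (Suc n))) x = usrt n (Rvi (Suc (Suc (Suc (Suc n)))) (srt n x))"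
  by (simp add: srt_def usrt_def St_op leg2_far_low_out cancel)

lemma Rvi_eq: "Rvi n x = (1 / z\<^sup>2) *\<^sub>C Rv n x + (- (q - 1 / q) / z) *\<^sub>C x"
proof -
  have "Rv n x = Rvi n (Rv n (Rv n x))" by (simp add: cancel)
  also have "Rv n (Rv n x) = (z * (q - 1 / q)) *\<^sub>C Rv n x + z\<^sup>2 *\<^sub>C x"
    using Rmat_hecke[of "\<lambda>i. - l i" q z n x] injl q0 by (simp add: inj_on_def)
  also have "Rvi n \<dots> = (z * (q - 1 / q)) *\<^sub>C x + z\<^sup>2 *\<^sub>C Rvi n x"
    by (simp only: leg2_add leg2_scale cancel)
  finally show ?thesis using z0
    by (simp add: scaleC_scaleC scaleC_add_right scaleC_collect)
       (simp add: field_simps power2_eq_square)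
qed

text \<open>The normalisation makes the eigenvalues of \<open>a\<close> equal to \<open>1\<close> and \<open>- 1 / t\<close>, those of \<open>b\<close> equal to \<open>1\<close> and \<open>- t\<close>,
  so that the relations of the calculus read \<open>a x = x\<close> and \<open>b x = x\<close>. The scalar \<open>\<mu>\<close> will be the quantum
  trace \<open>q\<^sup>m\<close> of \<open>p\<close>.\<close>

definition t where "t = q\<^sup>2"
definition a where "a n x = (1 / (z * q)) *\<^sub>C leg3 S n x"
definition b where "b n x = (z * q) *\<^sub>C leg3 St n x"
definition \<mu> where "\<mu> = \<kappa> / (z * q)"

lemma usrt_lin: "usrt n (x + y) = usrt n x + usrt n y" "usrt n (c *\<^sub>C x) = c *\<^sub>C usrt n x"
  by (simp_all add: usrt_def leg2_add leg2_scale)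
lemma srt_lin: "srt n (x + y) = srt n x + srt n y" "srt n (c *\<^sub>C x) = c *\<^sub>C srt n x"
  by (simp_all add: srt_def leg2_add leg2_scale)

lemma a_srt: "a n x = usrt n ((1 / (z * q)) *\<^sub>C Ro n (srt n x))"
  by (simp add: a_def S_srt usrt_lin)
lemma a2_srt: "a (Suc (Suc n)) x = usrt n ((1 / (z * q)) *\<^sub>C Ro (Suc n) (srt n x))"
  by (simp add: a_def S2_srt usrt_lin)
lemma b_srt: "b (Suc n) x = usrt n ((z * q) *\<^sub>C Rvi (Suc (Suc (Suc n))) (srt n x))"
  by (simp add: b_def St_srt usrt_lin)
lemma b2_srt: "b (Suc (Suc (Suc n))) x = usrt n ((z * q) *\<^sub>C Rvi (Suc (Suc (Suc (Suc n)))) (srt n x))"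
  by (simp add: b_def St2_srt usrt_lin)

lemma t0: "t \<noteq> 0" and mu0: "\<mu> \<noteq> 0" using q0 k0 z0 by (auto simp: t_def \<mu>_def)

lemma a_hecke: "a n (a n x) = (1 - 1 / t) *\<^sub>C a n x + (1 / t) *\<^sub>C x"
proof -
  have "a n (a n x) = usrt n ((1 / (z * q))\<^sup>2 *\<^sub>C Ro n (Ro n (srt n x)))"
    by (simp add: a_srt srt_inv leg2_scale scaleC_scaleC power2_eq_square)
  also have "\<dots> = (1 - 1 / t) *\<^sub>C a n x + (1 / t) *\<^sub>C x"
    using q0 z0 unfolding Rmat_hecke[OF injl q0] a_srt t_def
    by (simp add: usrt_lin srt_inv scaleC_add_right scaleC_scaleC)
       (simp add: field_simps power2_eq_square)
  finally show ?thesis .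
qed

lemma b_hecke: "b n (b n x) = (1 - t) *\<^sub>C b n x + t *\<^sub>C x"
proof -
  have h: "Rvi m (Rvi m y) = (1 / z\<^sup>2) *\<^sub>C y + (- (q - 1 / q) / z) *\<^sub>C Rvi m y" for m y
    by (subst (2) Rvi_eq) (simp only: leg2_add leg2_scale cancel)
  have "b n (b n x) = (z * q)\<^sup>2 *\<^sub>C Co n (Rvi (Suc n) (Rvi (Suc n) (Ci n x)))"
    by (simp add: b_def St_op leg2_scale leg3_scale scaleC_scaleC power2_eq_square cancel)
  also have "\<dots> = (1 - t) *\<^sub>C b n x + t *\<^sub>C x"
    using q0 z0 unfolding h b_def St_op t_def
    by (simp add: leg2_add leg2_scale cancel scaleC_add_right scaleC_scaleC)
       (simp add: scaleC_collect field_simps power2_eq_square)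
  finally show ?thesis .
qed

lemma a_braid: "a n (a (Suc (Suc n)) (a n x)) = a (Suc (Suc n)) (a n (a (Suc (Suc n)) x))"
  by (simp only: a_srt[of n] a2_srt srt_inv leg2_scale Rmat_braid[OF injl q0])

lemma Rvi_braid: "Rvi n (Rvi (Suc n) (Rvi n x)) = Rvi (Suc n) (Rvi n (Rvi (Suc n) x))"
proof -
  define y where "y = Rvi n (Rvi (Suc n) (Rvi n x))"
  have i: "inj (\<lambda>i. - l i)" using injl by (simp add: inj_on_def)
  have "x = Rv n (Rv (Suc n) (Rv n y))" by (simp add: y_def cancel)
  also have "\<dots> = Rv (Suc n) (Rv n (Rv (Suc n) y))" by (rule Rmat_braid[OF i q0])
  finally show ?thesis unfolding y_def[symmetric] by (simp add: cancel)
qed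

lemma b_braid: "b (Suc n) (b (Suc (Suc (Suc n))) (b (Suc n) x)) =
   b (Suc (Suc (Suc n))) (b (Suc n) (b (Suc (Suc (Suc n))) x))"
  by (simp only: b_srt[of n] b2_srt srt_inv leg2_scale Rvi_braid)

lemma ab_comm: "b (Suc n) (a n x) = a n (b (Suc n) x)"
  "b (Suc n) (a (Suc (Suc n)) x) = a (Suc (Suc n)) (b (Suc n) x)"
  "b (Suc (Suc (Suc n))) (a n x) = a n (b (Suc (Suc (Suc n))) x)"
  "b (Suc (Suc (Suc n))) (a (Suc (Suc n)) x) = a (Suc (Suc n)) (b (Suc (Suc (Suc n))) x)"
  by (simp_all only: a_srt[of n] a2_srt b_srt[of n] b2_srt srt_inv leg2_scale srt_lin usrt_lin leg2_far_low_out
      scaleC_scaleC mult.commute)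

text \<open>An evaluation can be moved two legs to the left past a strand of type \<open>V \<otimes> V\<^sup>*\<close>, at the price of one \<open>a\<close> and
  one \<open>b\<close>. All crossings cancel in pairs after sliding them through the cap.\<close>

lemma ev_ba: "ev (Suc (Suc (Suc n))) x = ev (Suc n) (a (Suc (Suc n)) (b (Suc n) x))"
proof -
  have "ev (Suc n) (a (Suc (Suc n)) (b (Suc n) x)) = ev (Suc n) (leg3 S (Suc (Suc n)) (leg3 St (Suc n) x))"
    using q0 z0 by (simp add: a_def b_def leg3_scale scaleC_scaleC)
  also have "\<dots> = Co (Suc n) (ev (Suc n) (Ro (Suc (Suc n)) (Ci (Suc (Suc (Suc n))) (leg3 St (Suc n) x))))"
    by (simp add: S_op contr_leg2_right)
  also have "\<dots> = Co (Suc n) (ev (Suc (Suc n)) (Ci (Suc n) (Ci (Suc (Suc (Suc n))) (leg3 St (Suc n) x))))"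
    by (simp add: ev_leg2)
  also have "\<dots> = Co (Suc n) (ev (Suc (Suc n)) (Ci (Suc (Suc (Suc n))) (Rvi (Suc (Suc n)) (Ci (Suc n) x))))"
    by (simp add: leg2_far_low_in St_op cancel)
  also have "\<dots> = Co (Suc n) (ev (Suc (Suc (Suc n))) (Rv (Suc (Suc n)) (Rvi (Suc (Suc n)) (Ci (Suc n) x))))"
    by (simp add: ev_leg2 rot_rot_Rmat)
  also have "\<dots> = ev (Suc (Suc (Suc n))) x"
    by (simp add: cancel contr_leg2_left)
  finally show ?thesis by simp
qed

abbreviation "tr \<equiv> contr \<tau>"

lemma tr_Ci: "tr n (Ci n x) = \<kappa> *\<^sub>C ev n x"
proof (rule ext)
  fix f :: "nat \<Rightarrow> 'i"
  have 1: "(ins2 n c c f)(n := i, Suc n := j) = ins2 n i j f" for c i j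
    by (auto simp: ins2_def fun_eq_iff)
  have 2: "ins2 n c c f n = c" "ins2 n c c f (Suc n) = c" for c by (simp_all add: ins2_def)
  have "tr n (Ci n x) f = (\<Sum>u\<in>UNIV. (\<Sum>c\<in>UNIV. \<tau> c * rot (Rmat z q l) $ (c, c) $ u) *\<^sub>C x (ins2 n (fst u) (snd u) f))"
    by (simp add: contr_def leg2_def 1 2 scaleC_sum scaleC_scaleC complex_space.scale_sum_left)
       (rule sum.swap)
  also have "\<dots> = (\<Sum>u\<in>UNIV. (if fst u = snd u then \<kappa> else 0) *\<^sub>C x (ins2 n (fst u) (snd u) f))"
    using trC by (intro sum.cong refl) (auto split: prod.splits)
  also have "\<dots> = (\<Sum>i\<in>UNIV. \<kappa> *\<^sub>C x (ins2 n i i f))"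
    by (subst sum_support_image[where h = "\<lambda>i. (i, i)"]) (auto simp: inj_on_def image_iff)
  finally show "tr n (Ci n x) f = (\<kappa> *\<^sub>C ev n x) f"
    by (simp add: contr_def scaleC_sum)
qed

text \<open>Closing the twisted crossing \<open>a\<close> with the quantum trace opens it into an evaluation.\<close>

lemma tr_a: "tr n (a n x) = \<mu> *\<^sub>C ev (Suc n) x"
proof -
  have "tr n (leg3 S n x) = \<kappa> *\<^sub>C ev (Suc n) x"
    by (simp add: S_op' tr_Ci ev_leg2 cancel)
  then show ?thesis by (simp add: a_def contr_scale scaleC_scaleC \<mu>_def)
qed

text \<open>The mirror image of \<open>tr_a\<close>: closing \<open>b\<close> with the evaluation leaves a quantum trace.\<close>

lemma ev_b: "ev n (b n x) = (1 / \<mu>) *\<^sub>C tr (Suc n) x"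
proof -
  have "tr (Suc n) x = \<kappa> *\<^sub>C ev n (leg3 St n x)"
  proof -
    define v where "v = leg3 St n x"
    have x: "x = Ci (Suc n) (Rv n (Co (Suc n) v))" by (simp add: v_def St_op' cancel)
    have "tr (Suc n) x = \<kappa> *\<^sub>C ev (Suc n) (Rv n (Co (Suc n) v))"
      by (subst x) (rule tr_Ci)
    also have "\<dots> = \<kappa> *\<^sub>C ev n v"
      by (simp add: ev_leg2[of n "rot (Rmat z q l)", unfolded rot_rot_Rmat, symmetric] cancel)
    finally show ?thesis by (simp add: v_def)
  qed
  then show ?thesis using k0
    by (simp add: b_def contr_scale scaleC_scaleC \<mu>_def)
qed

end

section \<open>The algebra of a mixed sector\<close>

definition lin :: "('x::complex_space \<Rightarrow> 'y::complex_space) \<Rightarrow> bool" where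
  "lin h \<longleftrightarrow> (\<forall>x y. h (x + y) = h x + h y) \<and> (\<forall>c x. h (c *\<^sub>C x) = c *\<^sub>C h x)"

lemma linD: "lin h \<Longrightarrow> h (x + y) = h x + h y" "lin h \<Longrightarrow> h (c *\<^sub>C x) = c *\<^sub>C h x"
  by (auto simp: lin_def)

text \<open>If \<open>A\<close> satisfies the Hecke relation with eigenvalues \<open>1\<close> and \<open>- 1 / t\<close>, this polynomial in \<open>A\<close> is its inverse.
  The parameter is \<open>1 / t\<close> for an operator with eigenvalues \<open>1\<close> and \<open>- t\<close>.\<close>

definition hinv :: "complex \<Rightarrow> ('x::complex_space \<Rightarrow> 'x) \<Rightarrow> 'x \<Rightarrow> 'x" where
  "hinv t A x = t *\<^sub>C A x + (1 - t) *\<^sub>C x"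

locale hecke_pair =
  fixes t :: complex and a1 a2 b1 b2 :: "'f::complex_space \<Rightarrow> 'f"
  assumes t0: "t \<noteq> 0"
    and lin_a1: "lin a1" and lin_a2: "lin a2" and lin_b1: "lin b1" and lin_b2: "lin b2"
    and hecke_a1: "a1 (a1 x) = (1 - 1 / t) *\<^sub>C a1 x + (1 / t) *\<^sub>C x"
    and hecke_a2: "a2 (a2 x) = (1 - 1 / t) *\<^sub>C a2 x + (1 / t) *\<^sub>C x"
    and hecke_b1: "b1 (b1 x) = (1 - t) *\<^sub>C b1 x + t *\<^sub>C x"
    and hecke_b2: "b2 (b2 x) = (1 - t) *\<^sub>C b2 x + t *\<^sub>C x"
    and braid_a: "a1 (a2 (a1 x)) = a2 (a1 (a2 x))"
    and braid_b: "b1 (b2 (b1 x)) = b2 (b1 (b2 x))"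
    and comm: "b1 (a1 x) = a1 (b1 x)" "b1 (a2 x) = a2 (b1 x)" "b2 (a1 x) = a1 (b2 x)" "b2 (a2 x) = a2 (b2 x)"
begin

abbreviation "a1i \<equiv> hinv t a1"
abbreviation "a2i \<equiv> hinv t a2"
abbreviation "b1i \<equiv> hinv (1 / t) b1"
abbreviation "b2i \<equiv> hinv (1 / t) b2"

lemmas lins = linD[OF lin_a1] linD[OF lin_a2] linD[OF lin_b1] linD[OF lin_b2]

lemma ab_lins [simp]:
  "a1 (x + y) = a1 x + a1 y" "a1 (c *\<^sub>C x) = c *\<^sub>C a1 x"
  "a2 (x + y) = a2 x + a2 y" "a2 (c *\<^sub>C x) = c *\<^sub>C a2 x"
  "b1 (x + y) = b1 x + b1 y" "b1 (c *\<^sub>C x) = c *\<^sub>C b1 x"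
  "b2 (x + y) = b2 x + b2 y" "b2 (c *\<^sub>C x) = c *\<^sub>C b2 x"
  by (simp_all only: lins)

lemma inv_cancel [simp]:
  "a1 (a1i x) = x" "a1i (a1 x) = x" "a2 (a2i x) = x" "a2i (a2 x) = x"
  "b1 (b1i x) = x" "b1i (b1 x) = x" "b2 (b2i x) = x" "b2i (b2 x) = x"
  using t0 by (simp_all add: hinv_def hecke_a1 hecke_a2 hecke_b1 hecke_b2 scaleC_add_right scaleC_scaleC scaleC_collect)
    (simp_all add: field_simps)

lemma ab_commute:
  "b1 (a1 x) = a1 (b1 x)" "b1 (a2 x) = a2 (b1 x)" "b2 (a1 x) = a1 (b2 x)" "b2 (a2 x) = a2 (b2 x)"
  "b1i (a1 x) = a1 (b1i x)" "b1i (a2 x) = a2 (b1i x)" "b2i (a1 x) = a1 (b2i x)" "b2i (a2 x) = a2 (b2i x)"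
  "b1 (a1i x) = a1i (b1 x)" "b1 (a2i x) = a2i (b1 x)" "b2 (a1i x) = a1i (b2 x)" "b2 (a2i x) = a2i (b2 x)"
  "b1i (a1i x) = a1i (b1i x)" "b1i (a2i x) = a2i (b1i x)" "b2i (a1i x) = a1i (b2i x)" "b2i (a2i x) = a2i (b2i x)"
  by (simp_all add: hinv_def comm scaleC_add_right scaleC_scaleC mult.commute add_ac)

lemma inv_lins [simp]:
  "a1i (x + y) = a1i x + a1i y" "a1i (c *\<^sub>C x) = c *\<^sub>C a1i x"
  "a2i (x + y) = a2i x + a2i y" "a2i (c *\<^sub>C x) = c *\<^sub>C a2i x"
  "b1i (x + y) = b1i x + b1i y" "b1i (c *\<^sub>C x) = c *\<^sub>C b1i x"
  "b2i (x + y) = b2i x + b2i y" "b2i (c *\<^sub>C x) = c *\<^sub>C b2i x"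
  by (simp_all add: hinv_def scaleC_add_right scaleC_scaleC mult.commute add_ac)

text \<open>Variants of the two braid relations with some of the generators inverted.\<close>

lemma braids:
  "a1i (a2 (a1 x)) = a2 (a1 (a2i x))" "a1 (a2 (a1i x)) = a2i (a1 (a2 x))"
  "a1i (a2i (a1 x)) = a2 (a1i (a2i x))"
  "b1i (b2 (b1 x)) = b2 (b1 (b2i x))" "b1 (b2 (b1i x)) = b2i (b1 (b2 x))"
  "b1i (b2i (b1 x)) = b2 (b1i (b2i x))" "b1 (b2i (b1i x)) = b2i (b1i (b2 x))"
proof -
  have i: "a1i u = v \<longleftrightarrow> u = a1 v" "a2i u = v \<longleftrightarrow> u = a2 v" "b1i u = v \<longleftrightarrow> u = b1 v" "b2i u = v \<longleftrightarrow> u = b2 v" for u v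
    using inv_cancel by metis+
  show "a1i (a2 (a1 x)) = a2 (a1 (a2i x))"
    unfolding i by (simp add: braid_a)
  show "a1 (a2 (a1i x)) = a2i (a1 (a2 x))"
    using braid_a[of "a1i x"] by (metis inv_cancel)
  show "a1i (a2i (a1 x)) = a2 (a1i (a2i x))"
    unfolding i using braid_a[of "a1i (a2i x)"] by simp
  show "b1i (b2 (b1 x)) = b2 (b1 (b2i x))"
    unfolding i by (simp add: braid_b)
  show "b1 (b2 (b1i x)) = b2i (b1 (b2 x))"
    using braid_b[of "b1i x"] by (metis inv_cancel)
  show "b1i (b2i (b1 x)) = b2 (b1i (b2i x))"
    unfolding i using braid_b[of "b1i (b2i x)"] by simp
  show "b1 (b2i (b1i x)) = b2i (b1i (b2 x))"
    using braid_b[of "b2i (b1i x)"] braid_b[of "b1i (b2i (b1i x))"] by (metis inv_cancel)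
qed

end

text \<open>The abstract form of the sector with two factors of one type and one of the other, with \<open>Z0\<close>,
  \<open>Z1\<close>, \<open>Z2\<close> the three positions of the odd factor and \<open>G1\<close>, \<open>G2\<close>, \<open>H1\<close>, \<open>H2\<close> the metric terms.
  The formulas for \<open>s1\<close> and \<open>s2\<close> are those of \<open>\<sigma>\<^sub>1\<close> and \<open>\<sigma>\<^sub>2\<close>; the two slide equations
  are \<open>slideG\<close> and \<open>slideH\<close>. Stating the computation abstractly allows it to be used twice, with the roles of \<open>a\<close> and
  \<open>b\<close> exchanged the second time.\<close>

locale sector = hecke_pair t a1 a2 b1 b2
  for t :: complex and a1 a2 b1 b2 :: "'f::complex_space \<Rightarrow> 'f" +
  fixes c c' :: complex and s1 s2 :: "'f \<Rightarrow> 'f" and Z0 Z1 Z2 G1 G2 H1 H2 :: 'f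
  assumes lin_s1: "lin s1" and lin_s2: "lin s2"
    and cc: "c = - (t\<^sup>2 * c')"
    and s_a: "s1 (a1 x) = a1 (s1 x)" "s1 (a2 x) = a2 (s1 x)" "s2 (a1 x) = a1 (s2 x)" "s2 (a2 x) = a2 (s2 x)"
    and s_b: "s1 (b1 x) = b1 (s1 x)" "s1 (b2 x) = b2 (s1 x)" "s2 (b1 x) = b1 (s2 x)" "s2 (b2 x) = b2 (s2 x)"
    and s1Z0: "s1 Z0 = t *\<^sub>C a1 (b1 Z0)"
    and s2Z0: "s2 Z0 = t\<^sup>2 *\<^sub>C a2 (b2i Z1) + (c * t\<^sup>2) *\<^sub>C a1 (a2 G2)"
    and s1Z1: "s1 Z1 = t\<^sup>2 *\<^sub>C a1 (b1i Z2) + c *\<^sub>C G1"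
    and s2Z1: "s2 Z1 = (1 / t\<^sup>2) *\<^sub>C a2i (b2 Z0) + (c' * t\<^sup>2) *\<^sub>C a1 (a2 H2)"
    and s1Z2: "s1 Z2 = (1 / t\<^sup>2) *\<^sub>C a1i (b1 Z1) + c' *\<^sub>C H1"
    and s2Z2: "s2 Z2 = t *\<^sub>C a2 (b2 Z2)"
    and G1: "a1 G1 = G1" "b1 G1 = G1" "b2 G1 = G1"
    and G2: "a1 G2 = G2" "b1 G2 = G2" "b2 G2 = G2"
    and H1: "a1 H1 = H1" "b1 H1 = H1" "b2 H1 = H1"
    and H2: "a1 H2 = H2" "b1 H2 = H2" "b2 H2 = H2"
    and slideG: "s1 G2 = s2 G1" and slideH: "s1 (s2 H1) = H2"
    and s1s1G2: "s1 (s1 G2) = G2" and s2s2H1: "s2 (s2 H1) = H1" and s2H2: "s2 H2 = G2"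
    and s2s2G1: "s2 (s2 G1) = (t - 1) *\<^sub>C s2 G1 + t *\<^sub>C G1"
    and s1s1H1: "s1 (s1 (s2 H1)) = (t - 1) *\<^sub>C s1 (s2 H1) + t *\<^sub>C s2 H1"
begin

lemma s_lins [simp]:
  "s1 (x + y) = s1 x + s1 y" "s1 (k *\<^sub>C x) = k *\<^sub>C s1 x"
  "s2 (x + y) = s2 x + s2 y" "s2 (k *\<^sub>C x) = k *\<^sub>C s2 x"
  by (simp_all only: linD[OF lin_s1] linD[OF lin_s2])

lemma s_inv:
  "s1 (a1i x) = a1i (s1 x)" "s1 (a2i x) = a2i (s1 x)" "s2 (a1i x) = a1i (s2 x)" "s2 (a2i x) = a2i (s2 x)"
  "s1 (b1i x) = b1i (s1 x)" "s1 (b2i x) = b2i (s1 x)" "s2 (b1i x) = b1i (s2 x)" "s2 (b2i x) = b2i (s2 x)"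
  by (simp_all add: hinv_def s_a s_b)

lemmas s_comm = s_a s_b s_inv

lemma fixed: "a1 x = x \<Longrightarrow> a1i x = x" "b1 x = x \<Longrightarrow> b1i x = x" "b2 x = x \<Longrightarrow> b2i x = x"
  by (metis inv_cancel)+

text \<open>The metric terms are fixed by most leg maps and hence by their inverses, and so are
  their images under \<open>s1\<close> and \<open>s2\<close>, which commute with the leg maps.\<close>

lemma fixG: "b2i G1 = G1" "b1 (s2 G1) = s2 G1" "b2 (s2 G1) = s2 G1" "a1 (s2 G1) = s2 G1" "b1i G1 = G1"
  "a1i G2 = G2" "b1i G2 = G2" "b2i G2 = G2"
  using G1 G2 by (auto simp: fixed simp flip: s_comm)
lemma fixH: "b2 H1 = H1" "b1 (s2 H1) = s2 H1" "b2 (s2 H1) = s2 H1" "a1 (s2 H1) = s2 H1"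
  "b1i H1 = H1" "b2i H1 = H1" "b1i H2 = H2" "b2i H2 = H2"
  using H1 H2 by (auto simp: fixed simp flip: s_comm)

text \<open>The leading terms agree by the braid relations. The metric terms then match because of the
  Hecke relation of \<open>a1\<close> on one side and the quadratic relation of \<open>s2\<close> on \<open>G1\<close> on the other.\<close>

lemma braid_Z0: "s1 (s2 (s1 Z0)) = s2 (s1 (s2 Z0))"
proof -
  have "s1 (s2 (s1 Z0)) = t ^ 5 *\<^sub>C a1 (a2 (a1 (b1 (b2i (b1i Z2))))) + (c * t ^ 3) *\<^sub>C a1 (a2 G1)
     + (c * t ^ 3) *\<^sub>C a1 (a1 (a2 (s2 G1)))"
    by (simp add: s1Z0 s2Z0 s1Z1 slideG s_comm ab_commute G1 G2 fixG scaleC_add_right scaleC_scaleC)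
       (simp add: power_numeral_reduce mult_ac add_ac)
  moreover have "s2 (s1 (s2 Z0)) = t ^ 5 *\<^sub>C a2 (a1 (a2 (b2i (b1i (b2 Z2))))) + (c * t\<^sup>2) *\<^sub>C a2 (s2 G1)
     + (c * t\<^sup>2) *\<^sub>C a1 (a2 (s2 (s2 G1)))"
    by (simp add: s2Z2 s2Z0 s1Z1 slideG s_comm ab_commute G1 G2 fixG scaleC_add_right scaleC_scaleC)
       (simp add: power_numeral_reduce mult_ac add_ac)
  ultimately show ?thesis using t0
    by (simp add: braid_a braids hecke_a1 s2s2G1 scaleC_add_right scaleC_scaleC)
       (simp add: field_simps power_numeral_reduce scaleC_collect)
qed

lemma braid_Z2: "s1 (s2 (s1 Z2)) = s2 (s1 (s2 Z2))"
proof -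
  have "s1 (s2 (s1 Z2)) = (1 / t ^ 3) *\<^sub>C a1i (a2i (a1 (b1 (b2 (b1 Z0))))) + c' *\<^sub>C a2 (s1 H2)
     + c' *\<^sub>C H2"
    using t0 by (simp add: s1Z0 s2Z1 s1Z2 slideH s_comm ab_commute H1 H2 fixH scaleC_add_right scaleC_scaleC)
       (simp add: power_numeral_reduce mult_ac add_ac)
  moreover have "s2 (s1 (s2 Z2)) = (1 / t ^ 3) *\<^sub>C a2 (a1i (a2i (b2 (b1 (b2 Z0))))) + (c' * t) *\<^sub>C a2 (a2 H2)
     + (c' * t) *\<^sub>C a2 (s2 H1)"
    using t0 by (simp add: s1Z0 s2Z1 s1Z2 s2Z2 slideH s_comm ab_commute H1 H2 fixH scaleC_add_right scaleC_scaleC)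
       (simp add: power_numeral_reduce mult_ac add_ac)
  moreover have "s1 H2 = (t - 1) *\<^sub>C H2 + t *\<^sub>C s2 H1"
    using s1s1H1 by (simp add: slideH)
  ultimately show ?thesis using t0
    by (simp add: braid_b braids hecke_a2 scaleC_add_right scaleC_scaleC)
       (simp add: field_simps power_numeral_reduce scaleC_collect)
qed

lemma braid_Z1: "s1 (s2 (s1 Z1)) = s2 (s1 (s2 Z1))"
proof -
  have "s1 (s2 (s1 Z1)) = t *\<^sub>C a1 (a2 (a1i (b1i (b2 (b1 Z1))))) + (c' * t ^ 3) *\<^sub>C a1 (a2 H1) + c *\<^sub>C G2"
    using t0 by (simp add: s1Z0 s2Z1 s1Z1 s1Z2 s2Z2 slideH slideG[symmetric] s1s1G2 s_comm ab_commute H1 H2 fixH scaleC_add_right scaleC_scaleC)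
       (simp add: power_numeral_reduce mult_ac add_ac)
  moreover have "s2 (s1 (s2 Z1)) = t *\<^sub>C a2i (a1 (a2 (b2 (b1 (b2i Z1))))) + (c * t) *\<^sub>C a2i (a1 (a1 (a2 G2)))
     + (c' * t\<^sup>2) *\<^sub>C a1 (a2 (s2 (s1 H2)))"
    using t0 by (simp add: s1Z0 s2Z0 s2Z1 s1Z2 s2Z2 slideH s_comm ab_commute H1 H2 G2 fixG fixH scaleC_add_right scaleC_scaleC)
  moreover have "s2 (s1 H2) = (t - 1) *\<^sub>C G2 + t *\<^sub>C H1"
    using s1s1H1 by (simp add: slideH s2H2 s2s2H1)
  moreover have "a2i (a1 (a1 (a2 G2))) = (1 - 1 / t) *\<^sub>C a1 (a2 G2) + (1 / t) *\<^sub>C G2"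
    by (simp add: hecke_a1 braids(2)[symmetric] fixG)
  ultimately show ?thesis using t0
    by (simp add: braids scaleC_add_right scaleC_scaleC cc)
       (simp add: field_simps power_numeral_reduce scaleC_collect)
qed

end

section \<open>Products of families\<close>

definition bilin :: "('x::complex_space \<Rightarrow> 'y::complex_space \<Rightarrow> 'z::complex_space) \<Rightarrow> bool" where
  "bilin m \<longleftrightarrow> (\<forall>x. lin (m x)) \<and> (\<forall>y. lin (\<lambda>x. m x y))"

lemma lin_sum: "lin h \<Longrightarrow> h (\<Sum>i\<in>I. x i) = (\<Sum>i\<in>I. h (x i))"
proof (induction I rule: infinite_finite_induct)
  have "h 0 = 0" if "lin h" using linD(1)[OF that, of 0 0] by simp
  then show "lin h \<Longrightarrow> infinite A \<Longrightarrow> h (\<Sum>i\<in>A. x i) = (\<Sum>i\<in>A. h (x i))"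
    "lin h \<Longrightarrow> h (\<Sum>i\<in>{}. x i) = (\<Sum>i\<in>{}. h (x i))" for A
    by simp_all
qed (simp add: linD)

lemma lin_zero: "lin h \<Longrightarrow> h 0 = 0"
  using linD(1)[of h 0 0] by simp

lemma lin_leg3: "lin (leg3 M n)" and lin_contr: "lin (contr \<tau> n)"
  by (auto simp: lin_def leg3_add leg3_scale contr_add contr_scale)

lemma leg3_lin: "lin h \<Longrightarrow> leg3 M n (\<lambda>f. h (x f)) = (\<lambda>f. h (leg3 M n x f))"
  by (simp add: leg3_def lin_sum linD)

lemma contr_lin: "lin h \<Longrightarrow> contr \<tau> n (\<lambda>f. h (x f)) = (\<lambda>f. h (contr \<tau> n x f))"
  by (simp add: contr_def lin_sum linD)

text \<open>The product of families, with \<open>k\<close> the number of legs of the left factor.\<close>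

definition prd :: "('x \<Rightarrow> 'y \<Rightarrow> 'z) \<Rightarrow> nat \<Rightarrow> ('i, 'x) fam \<Rightarrow> ('i, 'y) fam \<Rightarrow> ('i, 'z) fam" where
  "prd m k x y = (\<lambda>f. m (x f) (y (\<lambda>n. f (n + k))))"

lemma bilinD:
  assumes "bilin m"
  shows "m (x + x') y = m x y + m x' y" "m x (y + y') = m x y + m x y'"
    "m (c *\<^sub>C x) y = c *\<^sub>C m x y" "m x (c *\<^sub>C y) = c *\<^sub>C m x y"
    "m 0 y = 0" "m x 0 = 0"
proof -
  have l: "lin (m x)" and r: "lin (\<lambda>x. m x y)" for x y using assms by (auto simp: bilin_def)
  show "m (x + x') y = m x y + m x' y" "m x (y + y') = m x y + m x y'"
    "m (c *\<^sub>C x) y = c *\<^sub>C m x y" "m x (c *\<^sub>C y) = c *\<^sub>C m x y" "m 0 y = 0" "m x 0 = 0"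
    by (rule linD[OF r[of y]] linD[OF l[of x]] lin_zero[OF r[of y]] lin_zero[OF l[of x]])+
qed

lemma prd_lins:
  assumes "bilin m"
  shows "prd m k (x + x') y = prd m k x y + prd m k x' y" "prd m k x (y + y') = prd m k x y + prd m k x y'"
    "prd m k (c *\<^sub>C x) y = c *\<^sub>C prd m k x y" "prd m k x (c *\<^sub>C y) = c *\<^sub>C prd m k x y"
    "prd m k 0 y = 0" "prd m k x 0 = 0"
  by (simp_all add: prd_def fun_eq_iff bilinD[OF assms])

lemma bilin_sum:
  assumes "bilin m"
  shows "m x (\<Sum>i\<in>I. g i) = (\<Sum>i\<in>I. m x (g i))" "m (\<Sum>i\<in>I. h i) y = (\<Sum>i\<in>I. m (h i) y)"
  using assms lin_sum[of "m x" g I] lin_sum[of "\<lambda>x. m x y" h I] by (auto simp: bilin_def)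

text \<open>A family has its legs among the first \<open>k\<close>. For such a left factor, maps of
  the legs from \<open>k\<close> on act on the right factor alone.\<close>

definition dep :: "nat \<Rightarrow> ('i, 'x) fam \<Rightarrow> bool" where
  "dep k x \<longleftrightarrow> (\<forall>f g. (\<forall>j<k. f j = g j) \<longrightarrow> x f = x g)"

lemma prd_leg3_right:
  fixes x :: "('i::finite, 'x::complex_space) fam"
  assumes "bilin m" "dep k x" "k \<le> n"
  shows "leg3 M n (prd m k x y) = prd m k x (leg3 M (n - k) y)"
proof (rule ext)
  fix f :: "nat \<Rightarrow> 'i"
  obtain n' where n: "n = n' + k" using assms(3) by (metis le_add_diff_inverse2)
  have 1: "x (f(n := u, Suc n := v, Suc (Suc n) := w)) = x f" for u v w
    using assms(2,3) unfolding dep_def by (metis fun_upd_other leD le_Suc_eq less_Suc_eq)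
  have 2: "(\<lambda>j. (f(n := u, Suc n := v, Suc (Suc n) := w)) (j + k)) =
      (\<lambda>j. f (j + k))(n' := u, Suc n' := v, Suc (Suc n') := w)" for u v w
    by (auto simp: n fun_eq_iff)
  show "leg3 M n (prd m k x y) f = prd m k x (leg3 M (n - k) y) f"
    unfolding leg3_def prd_def 1 2 by (simp add: bilin_sum(1)[OF assms(1)] bilinD(4)[OF assms(1)] n)
qed

lemma prd_contr_right:
  fixes x :: "('i::finite, 'x::complex_space) fam"
  assumes "bilin m" "dep k x" "k \<le> n"
  shows "contr \<tau> n (prd m k x y) = prd m k x (contr \<tau> (n - k) y)"
proof (rule ext)
  fix f :: "nat \<Rightarrow> 'i"
  obtain n' where n: "n = n' + k" using assms(3) by (metis le_add_diff_inverse2)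
  have 1: "x (ins2 n u v f) = x f" for u v
    using assms(2,3) unfolding dep_def by (auto simp: ins2_def)
  have 2: "(\<lambda>j. ins2 n u v f (j + k)) = ins2 n' u v (\<lambda>j. f (j + k))" for u v
    by (auto simp: n fun_eq_iff ins2_def intro!: arg_cong[of _ _ f])
  show "contr \<tau> n (prd m k x y) f = prd m k x (contr \<tau> (n - k) y) f"
    unfolding contr_def prd_def 1 2 by (simp add: bilin_sum(1)[OF assms(1)] bilinD(4)[OF assms(1)] n)
qed

lemma prd_leg3_left:
  fixes x :: "('i::finite, 'x::complex_space) fam"
  assumes "bilin m" "n + 3 \<le> k"
  shows "leg3 M n (prd m k x y) = prd m k (leg3 M n x) y"
proof (rule ext)
  fix f :: "nat \<Rightarrow> 'i"
  have 1: "(\<lambda>j. (f(n := u, Suc n := v, Suc (Suc n) := w)) (j + k)) = (\<lambda>j. f (j + k))" for u v w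
    using assms(2) by (auto simp: fun_eq_iff)
  show "leg3 M n (prd m k x y) f = prd m k (leg3 M n x) y f"
    unfolding leg3_def prd_def 1 by (simp add: bilin_sum(2)[OF assms(1)] bilinD(3)[OF assms(1)])
qed

lemma prd_contr_left:
  fixes x :: "('i::finite, 'x::complex_space) fam"
  assumes "bilin m" "n + 2 \<le> k"
  shows "contr \<tau> n (prd m k x y) = prd m (k - 2) (contr \<tau> n x) y"
proof (rule ext)
  fix f :: "nat \<Rightarrow> 'i"
  have 1: "(\<lambda>j. ins2 n u v f (j + k)) = (\<lambda>j. f (j + (k - 2)))" for u v
    using assms(2) by (auto simp: fun_eq_iff ins2_def intro!: arg_cong[of _ _ f])
  show "contr \<tau> n (prd m k x y) f = prd m (k - 2) (contr \<tau> n x) y f"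
    by (simp add: contr_def prd_def 1 bilin_sum(2)[OF assms(1)] bilinD(3)[OF assms(1)])
qed

definition legs01 :: "('i \<Rightarrow> 'i \<Rightarrow> 'x) \<Rightarrow> ('i, 'x) fam" where
  "legs01 x = (\<lambda>f. x (f 0) (f 1))"

abbreviation konst :: "'x \<Rightarrow> ('i, 'x) fam" where "konst g \<equiv> (\<lambda>_. g)"

lemma dep_simps [simp]: "dep 2 (legs01 x)" "dep k (konst g)"
  by (auto simp: dep_def legs01_def)

lemma contr_contr:
  fixes x :: "('i::finite, 'x::complex_space) fam"
  shows "contr \<tau> 0 (contr \<tau>' 2 x) = contr \<tau>' 0 (contr \<tau> 0 x)"
proof (rule ext)
  fix f :: "nat \<Rightarrow> 'i"
  have "ins2 2 b b (ins2 0 a a f) = ins2 0 a a (ins2 0 b b f)" for a b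
    by (auto simp: ins2_def fun_eq_iff)
  then show "contr \<tau> 0 (contr \<tau>' 2 x) f = contr \<tau>' 0 (contr \<tau> 0 x) f"
    unfolding contr_def scaleC_sum scaleC_scaleC
    by (subst sum.swap) (simp add: mult.commute)
qed

lemma bimodule_bilin:
  assumes "bimodule M"
  shows "bilin (lact M)" "bilin (ract M)"
    "lact M a (lact M b x) = lact M (a * b) x" "ract M (ract M x a) b = ract M x (a * b)"
    "ract M (lact M a x) b = lact M a (ract M x b)" "lact M (c *\<^sub>C 1) x = c *\<^sub>C x" "ract M x (c *\<^sub>C 1) = c *\<^sub>C x"
proof -
  note b = assms[unfolded bimodule_def]
  show "lact M a (lact M b x) = lact M (a * b) x" "ract M (ract M x a) b = ract M x (a * b)"
    "ract M (lact M a x) b = lact M a (ract M x b)" "lact M (c *\<^sub>C 1) x = c *\<^sub>C x" "ract M x (c *\<^sub>C 1) = c *\<^sub>C x"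
    for a b x c using b by auto
  have 1: "c *\<^sub>C x = lact M (c *\<^sub>C 1) x" "c *\<^sub>C x = ract M x (c *\<^sub>C 1)" for c x using b by auto
  have 2: "c *\<^sub>C a = (c *\<^sub>C 1) * a" "c *\<^sub>C a = a * (c *\<^sub>C 1)" for c and a :: 'a
    by (simp_all add: scaleC_mult_left scaleC_mult_right)
  have "lact M (c *\<^sub>C a) x = c *\<^sub>C lact M a x" "ract M x (c *\<^sub>C a) = c *\<^sub>C ract M x a" for a x c
    by (subst 2(1), subst 1(1), use b in metis) (subst 2(2), subst 1(2), use b in metis)
  moreover have "lact M a (c *\<^sub>C x) = c *\<^sub>C lact M a x" for a x c
  proof -
    have "lact M a (c *\<^sub>C x) = lact M (a * (c *\<^sub>C 1)) x" using b 1 by metis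
    also have "\<dots> = lact M ((c *\<^sub>C 1) * a) x" by (simp add: 2[symmetric])
    finally show ?thesis using b 1 by metis
  qed
  moreover have "ract M (c *\<^sub>C x) a = c *\<^sub>C ract M x a" for a x c
  proof -
    have "ract M (c *\<^sub>C x) a = ract M x ((c *\<^sub>C 1) * a)" using b 1 by metis
    also have "\<dots> = ract M x (a * (c *\<^sub>C 1))" by (simp add: 2[symmetric])
    finally show ?thesis using b 1 by metis
  qed
  ultimately show "bilin (lact M)" "bilin (ract M)"
    using b by (auto simp: bilin_def lin_def)
qed

context leg_calculus begin

lemma leg_numerals:
  shows a_prd_left: "bilin m \<Longrightarrow> n + 3 \<le> k \<Longrightarrow> a n (prd m k x y) = prd m k (a n x) y"
    and b_prd_left: "bilin m \<Longrightarrow> n + 3 \<le> k \<Longrightarrow> b n (prd m k x y) = prd m k (b n x) y"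
    and a_prd_right: "bilin m \<Longrightarrow> dep k x \<Longrightarrow> k \<le> n \<Longrightarrow> a n (prd m k x y) = prd m k x (a (n - k) y)"
    and b_prd_right: "bilin m \<Longrightarrow> dep k x \<Longrightarrow> k \<le> n \<Longrightarrow> b n (prd m k x y) = prd m k x (b (n - k) y)"
  by (simp_all add: a_def b_def prd_leg3_left prd_leg3_right prd_lins)

lemma lin_a: "lin (a n)" and lin_b: "lin (b n)"
  by (auto simp: lin_def a_def b_def leg3_add leg3_scale scaleC_add_right scaleC_scaleC mult.commute)

lemma a_lin: "lin h \<Longrightarrow> a n (\<lambda>f. h (x f)) = (\<lambda>f. h (a n x f))"
  and b_lin: "lin h \<Longrightarrow> b n (\<lambda>f. h (x f)) = (\<lambda>f. h (b n x f))"
  by (simp_all add: a_def b_def scaleC_fun_def leg3_lin linD)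

sublocale hp: hecke_pair t "a 0 :: ('i, 'x::complex_space) fam \<Rightarrow> _" "a 2" "b 1" "b 3"
  using a_braid[of 0] b_braid[of 0] ab_comm[of 0]
  by unfold_locales (simp_all add: t0 lin_a lin_b a_hecke b_hecke eval_nat_numeral)

text \<open>The rules for contractions in the six-leg notation that all computations below use.\<close>

lemma contr_commute:
  "ev 3 (a 0 x) = a 0 (ev 3 x)" "ev 1 (b 3 x) = b 1 (ev 1 x)"
  "tr 0 (a 0 x) = \<mu> *\<^sub>C ev 1 x" "ev 1 (b 1 x) = (1 / \<mu>) *\<^sub>C tr 2 x"
  "ev 3 x = ev 1 (a 2 (b 1 x))"
proof -
  show "ev 3 (a 0 x) = a 0 (ev 3 x)"
    by (simp add: a_def contr_scale S_op contr_leg2_left)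
  show "ev 1 (b 3 x) = b 1 (ev 1 x)"
    by (simp add: b_def contr_scale St_op contr_leg2_right eval_nat_numeral)
  show "tr 0 (a 0 x) = \<mu> *\<^sub>C ev 1 x" "ev 1 (b 1 x) = (1 / \<mu>) *\<^sub>C tr 2 x" "ev 3 x = ev 1 (a 2 (b 1 x))"
    using tr_a[of 0] ev_b[of 1] ev_ba[of 0] by (simp_all add: eval_nat_numeral)
qed

end

lemma prd_assoc:
  assumes "\<And>u v w. m u (m' v w) = m'' (m''' u v) w"
  shows "prd m k x (prd m' j y z) = prd m'' (k + j) (prd m''' k x y) z"
  using assms by (simp add: prd_def add_ac)

section \<open>Differential forms and the metric\<close>

text \<open>The Heckenberger-Kolb calculus in terms of \<open>a\<close> and \<open>b\<close>. The forms \<open>dp\<close> and \<open>dbp\<close> are the two halves of the differential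
  of \<open>p\<close>, and \<open>t21\<close> and \<open>t12\<close> are the two bracketings of the threefold tensor product. In the relations
  \<open>pp\<close>, \<open>pd\<close>, \<open>pe\<close> the powers of \<open>q\<close> are absorbed into \<open>a\<close> and \<open>b\<close>.\<close>

locale hk_calculus = leg_calculus q z l C Ri \<tau> \<kappa>
  for q z :: complex and l :: "'i::finite \<Rightarrow> int" and C Ri and \<tau> :: "'i \<Rightarrow> complex" and \<kappa> +
  fixes p :: "'i \<Rightarrow> 'i \<Rightarrow> 'b::complex_algebra_1" and dp dbp :: "'i \<Rightarrow> 'i \<Rightarrow> 'o::complex_space"
    and Om :: "('b, 'o) bimod" and T2 :: "('b, 't2::complex_space) bimod" and T3 :: "('b, 't3::complex_space) bimod"
    and ten :: "'o \<Rightarrow> 'o \<Rightarrow> 't2" and t21 :: "'t2 \<Rightarrow> 'o \<Rightarrow> 't3" and t12 :: "'o \<Rightarrow> 't2 \<Rightarrow> 't3"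
    and sg :: "'t2 \<Rightarrow> 't2" and s1 s2 :: "'t3 \<Rightarrow> 't3" and gmp gpm :: 't2
  assumes Om: "bimodule Om" and T2: "bimodule T2" and T3: "bimodule T3"
    and bil: "bilin ten" "bilin t21" "bilin t12"
    and ten: "lact T2 v (ten x y) = ten (lact Om v x) y" "ract T2 (ten x y) v = ten x (ract Om y v)"
       "ten (ract Om x v) y = ten x (lact Om v y)"
    and t21: "lact T3 v (t21 x2 y) = t21 (lact T2 v x2) y" "ract T3 (t21 x2 y) v = t21 x2 (ract Om y v)"
       "t21 (ract T2 x2 v) y = t21 x2 (lact Om v y)"
    and t12: "lact T3 v (t12 x y2) = t12 (lact Om v x) y2" "ract T3 (t12 x y2) v = t12 x (ract T2 y2 v)"
       "t12 (ract Om x v) y2 = t12 x (lact T2 v y2)"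
    and tassoc: "t21 (ten x y) x' = t12 x (ten y x')"
    and sg: "lin sg" "sg (lact T2 v x2) = lact T2 v (sg x2)" "sg (ract T2 x2 v) = ract T2 (sg x2) v"
    and s1: "lin s1" "s1 (lact T3 v x3) = lact T3 v (s1 x3)" "s1 (ract T3 x3 v) = ract T3 (s1 x3) v"
      "s1 (t21 x2 y) = t21 (sg x2) y"
    and s2: "lin s2" "s2 (lact T3 v x3) = lact T3 v (s2 x3)" "s2 (ract T3 x3 v) = ract T3 (s2 x3) v"
      "s2 (t12 x y2) = t12 x (sg y2)"
    and pp: "a 0 (prd (*) 2 (legs01 p) (legs01 p)) = prd (*) 2 (legs01 p) (legs01 p)"
      "b 1 (prd (*) 2 (legs01 p) (legs01 p)) = prd (*) 2 (legs01 p) (legs01 p)"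
      "tr 0 (legs01 p) = konst (\<mu> *\<^sub>C 1)"
    and pd: "b 1 (prd (lact Om) 2 (legs01 p) (legs01 dp)) = prd (lact Om) 2 (legs01 p) (legs01 dp)"
      "tr 0 (legs01 dp) = 0"
    and pe: "a 0 (prd (lact Om) 2 (legs01 p) (legs01 dbp)) = prd (lact Om) 2 (legs01 p) (legs01 dbp)"
      "tr 0 (legs01 dbp) = 0"
    and dP: "prd (ract Om) 2 (legs01 dp) (legs01 p) = t *\<^sub>C a 0 (b 1 (prd (lact Om) 2 (legs01 p) (legs01 dp)))"
    and eP: "prd (ract Om) 2 (legs01 dbp) (legs01 p) = (1 / t) *\<^sub>C a 0 (b 1 (prd (lact Om) 2 (legs01 p) (legs01 dbp)))"
    and gmp: "tr 0 (ev 1 (prd ten 2 (legs01 dbp) (legs01 dp))) = konst gmp"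
    and gpm: "tr 0 (ev 1 (prd ten 2 (legs01 dp) (legs01 dbp))) = konst gpm"
    and sgdd: "sg \<circ> prd ten 2 (legs01 dp) (legs01 dp) = t *\<^sub>C a 0 (b 1 (prd ten 2 (legs01 dp) (legs01 dp)))"
    and sgee: "sg \<circ> prd ten 2 (legs01 dbp) (legs01 dbp) = (1 / t) *\<^sub>C a 0 (b 1 (prd ten 2 (legs01 dbp) (legs01 dbp)))"
    and sgde: "sg \<circ> prd ten 2 (legs01 dp) (legs01 dbp) =
        t\<^sup>2 *\<^sub>C a 0 (hinv (1 / t) (b 1) (prd ten 2 (legs01 dbp) (legs01 dp))) +
        ((1 - t) * t / \<mu>) *\<^sub>C (\<lambda>f. ract T2 (lact T2 (p (f 0) (f 1)) gmp) (p (f 2) (f 3)))"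
    and sged: "sg \<circ> prd ten 2 (legs01 dbp) (legs01 dp) =
        (1 / t\<^sup>2) *\<^sub>C hinv t (a 0) (b 1 (prd ten 2 (legs01 dp) (legs01 dbp))) +
        ((1 - 1 / t) / \<mu>) *\<^sub>C (\<lambda>f. ract T2 (lact T2 (p (f 0) (f 1)) gpm) (p (f 2) (f 3)))"
begin

declare One_nat_def [simp del] One_nat_def [symmetric, simp]

abbreviation "P \<equiv> legs01 p"
abbreviation "d \<equiv> legs01 dp"
abbreviation "e \<equiv> legs01 dbp"
abbreviation "pl T \<equiv> prd (lact T) 2 P"
abbreviation "A1i \<equiv> hinv t (a 0)"
abbreviation "A2i \<equiv> hinv t (a 2)"
abbreviation "B1i \<equiv> hinv (1 / t) (b 1)"
abbreviation "B2i \<equiv> hinv (1 / t) (b 3)"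

lemma bil_lact: "bilin (lact Om)" "bilin (lact T2)" "bilin (lact T3)"
    "bilin (ract Om)" "bilin (ract T2)" "bilin (ract T3)" "bilin ((*) :: 'b \<Rightarrow> _)"
  using bimodule_bilin[OF Om] bimodule_bilin[OF T2] bimodule_bilin[OF T3]
  by (auto simp: bilin_def lin_def scaleC_mult_left scaleC_mult_right distrib_left distrib_right)

lemmas bils = bil bil_lact

text \<open>Associativity and balancing of all products that occur, as rules that move a factor \<open>p\<close> to the
  left or out of a bracket.\<close>

lemma pl_ten: "pl T2 (prd ten k x y) = prd ten (k + 2) (pl Om x) y"
  by (subst prd_assoc[where m'' = ten and m''' = "lact Om"]) (simp_all add: ten add.commute)
lemma pl_t21: "pl T3 (prd t21 k x y) = prd t21 (k + 2) (pl T2 x) y"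
  by (subst prd_assoc[where m'' = t21 and m''' = "lact T2"]) (simp_all add: t21 add.commute)
lemma pl_t12: "pl T3 (prd t12 k x y) = prd t12 (k + 2) (pl Om x) y"
  by (subst prd_assoc[where m'' = t12 and m''' = "lact Om"]) (simp_all add: t12 add.commute)
lemma ten_pr: "prd ten k x (prd (ract Om) j y P) = prd (ract T2) (k + j) (prd ten k x y) P"
  by (rule prd_assoc) (simp add: ten)
lemma t21_pr: "prd t21 k x (prd (ract Om) j y P) = prd (ract T3) (k + j) (prd t21 k x y) P"
  by (rule prd_assoc) (simp add: t21)
lemma t12_pr: "prd t12 k x (prd (ract T2) j y P) = prd (ract T3) (k + j) (prd t12 k x y) P"
  by (rule prd_assoc) (simp add: t12)
lemma ten_mid: "prd ten k x (pl Om y) = prd ten (k + 2) (prd (ract Om) k x P) y"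
  by (rule prd_assoc) (simp add: ten)
lemma t21_mid: "prd t21 k x (pl Om y) = prd t21 (k + 2) (prd (ract T2) k x P) y"
  by (rule prd_assoc) (simp add: t21)
lemma t12_mid: "prd t12 k x (pl T2 y) = prd t12 (k + 2) (prd (ract Om) k x P) y"
  by (rule prd_assoc) (simp add: t12)
lemma t12_ten: "prd t12 k x (prd ten j y w) = prd t21 (k + j) (prd ten k x y) w"
  by (rule prd_assoc) (simp add: tassoc)
lemma pl_pr: "pl T (prd (ract T) k x P) = prd (ract T) (k + 2) (pl T x) P" if "bimodule T"
  by (subst prd_assoc[where m'' = "ract T" and m''' = "lact T"])
     (simp_all add: add.commute bimodule_bilin[OF that])
lemma pl_pl: "pl T (pl T x) = prd (lact T) 4 (prd (*) 2 P P) x" if "bimodule T"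
  by (subst prd_assoc[where m'' = "lact T" and m''' = "(*)"]) (simp_all add: bimodule_bilin[OF that])

lemma prd0: "prd m 0 x y = (\<lambda>f. m (x f) (y f))"
  by (simp add: prd_def)

text \<open>Multiplication by the family \<open>p\<close> can be undone, because its quantum trace is the nonzero scalar
  \<open>\<mu>\<close>.\<close>

lemma tr_pl: "tr 0 (pl T x) = \<mu> *\<^sub>C x" if "bimodule T"
proof -
  have "\<mu> *\<^sub>C y = lact T (\<mu> *\<^sub>C 1) y" for y by (simp add: bimodule_bilin[OF that])
  then show ?thesis
    by (simp add: prd_contr_left bimodule_bilin(1)[OF that] pp prd0 scaleC_fun_def del: scaleC_apply)
qed

lemma pl_cancel: "pl T x = pl T y \<Longrightarrow> x = y" if "bimodule T"
proof -
  assume "pl T x = pl T y"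
  then have "\<mu> *\<^sub>C x = \<mu> *\<^sub>C y" using tr_pl[OF that] by metis
  then show "x = y" using mu0 by (metis complex_space.scale_left_imp_eq)
qed

lemma pr_cancel: "prd (ract T) 2 x P = prd (ract T) 2 y P \<Longrightarrow> dep 2 x \<Longrightarrow> dep 2 y \<Longrightarrow> x = y" if "bimodule T"
proof -
  assume h: "prd (ract T) 2 x P = prd (ract T) 2 y P" "dep 2 x" "dep 2 y"
  have "tr 2 (prd (ract T) 2 w P) = \<mu> *\<^sub>C w" if "dep 2 w" for w
    using that by (simp add: prd_contr_right bimodule_bilin(2)[OF \<open>bimodule T\<close>] pp)
      (simp add: prd_def scaleC_fun_def bimodule_bilin[OF \<open>bimodule T\<close>])
  then have "\<mu> *\<^sub>C x = \<mu> *\<^sub>C y" using h by metis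
  then show "x = y" using mu0 by (metis complex_space.scale_left_imp_eq)
qed

lemma legs_pl:
  assumes "bilin (lact T)"
  shows "a 2 (pl T x) = pl T (a 0 x)" "b 3 (pl T x) = pl T (b 1 x)" "ev 3 (pl T x) = pl T (ev 1 x)"
    "tr 2 (pl T x) = pl T (tr 0 x)"
    "A2i (pl T x) = pl T (A1i x)" "B2i (pl T x) = pl T (B1i x)"
  using assms by (simp_all add: a_prd_right b_prd_right prd_contr_right hinv_def prd_lins)

lemmas pl_legs = legs_pl[OF bils(4)] legs_pl[OF bils(5)] legs_pl[OF bils(6)]

lemmas contr_lins = contr_add contr_scale linD[OF lin_contr]

text \<open>The family \<open>p\<close> is a projection: contracting \<open>p p\<close> gives \<open>p\<close>. Up to the factor \<open>\<mu>\<close>, the quantum trace of the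
  first two legs is the evaluation of the middle legs, because \<open>a\<close> fixes \<open>p p\<close>.\<close>

lemma ev_pp: "ev 1 (prd (*) 2 P P) = P"
proof -
  have "\<mu> *\<^sub>C ev 1 (prd (*) 2 P P) = tr 0 (prd (*) 2 P P)"
    by (metis contr_commute(3) pp(1))
  also have "\<dots> = \<mu> *\<^sub>C P"
    by (simp add: prd_contr_left bils pp) (simp add: prd0 scaleC_fun_def scaleC_mult_left)
  finally show ?thesis using mu0 by (metis complex_space.scale_left_imp_eq)
qed

lemma ev_pd: "ev 1 (pl Om d) = 0"
proof -
  have "ev 1 (pl Om d) = (1 / \<mu>) *\<^sub>C tr 2 (pl Om d)" by (metis contr_commute(4) pd(1))
  then show ?thesis by (simp add: pl_legs pd prd_lins bils)
qed

lemma ev_pe: "ev 1 (pl Om e) = e"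
proof -
  have "\<mu> *\<^sub>C ev 1 (pl Om e) = \<mu> *\<^sub>C e" by (metis contr_commute(3) pe(1) tr_pl Om)
  then show ?thesis using mu0 by (metis complex_space.scale_left_imp_eq)
qed

lemma dP': "prd (ract Om) 2 d P = t *\<^sub>C a 0 (pl Om d)" by (simp add: dP pd)
lemma eP': "prd (ract Om) 2 e P = (1 / t) *\<^sub>C b 1 (pl Om e)" by (simp add: eP pe flip: hp.comm)

lemma ev_dP: "ev 1 (prd (ract Om) 2 d P) = d"
proof -
  have "\<mu> *\<^sub>C ev 1 (a 0 (pl Om d)) = tr 0 (a 0 (a 0 (pl Om d)))" by (simp add: contr_commute)
  also have "\<dots> = ((1 / t) * \<mu>) *\<^sub>C d"
    by (simp add: a_hecke contr_lins contr_commute ev_pd tr_pl Om scaleC_scaleC)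
  finally have "\<mu> *\<^sub>C ev 1 (prd (ract Om) 2 d P) = \<mu> *\<^sub>C d"
    using t0 by (simp add: dP' contr_lins scaleC_scaleC mult.commute)
       (metis (no_types, lifting) nonzero_eq_divide_eq scaleC_scaleC times_divide_eq_right mult.commute scaleC_one)
  then show ?thesis using mu0 by (metis complex_space.scale_left_imp_eq)
qed

lemma ev_eP: "ev 1 (prd (ract Om) 2 e P) = 0"
  by (simp add: eP' contr_lins contr_commute pl_legs pe prd_lins bils)

abbreviation "dd \<equiv> prd ten 2 d d"
abbreviation "de \<equiv> prd ten 2 d e"
abbreviation "ed \<equiv> prd ten 2 e d"
abbreviation "ee \<equiv> prd ten 2 e e"

text \<open>The product \<open>d d\<close> is a contraction of \<open>d p d\<close>, in which \<open>b\<close> fixes \<open>p d\<close>.\<close>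

lemma b_dd: "b 1 dd = dd"
proof -
  \<comment> \<open>the product \<open>d p d\<close>, whose contraction is \<open>d d\<close>\<close>
  define X where "X = prd ten 2 d (pl Om d)"
  have 1: "b 3 X = X" by (simp add: X_def b_prd_right bils pd)
  have 2: "ev 1 X = dd" by (simp add: X_def ten_mid prd_contr_left bils ev_dP)
  show ?thesis by (metis 1 2 contr_commute(2))
qed

lemma a_ee: "a 0 ee = ee"
proof -
  define X where "X = prd ten 2 e (pl Om e)"
  have "X = (1 / t) *\<^sub>C b 1 (prd ten 4 (pl Om e) e)"
    by (simp add: X_def ten_mid eP' prd_lins bils b_prd_left)
  then have 1: "a 0 X = X" by (simp add: linD[OF lin_a] pe a_prd_left bils flip: hp.comm)
  have 2: "ev 3 X = ee" by (simp add: X_def prd_contr_right bils ev_pe)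
  show ?thesis by (metis 1 2 contr_commute(1))
qed

text \<open>Contracting the middle legs of \<open>e d\<close>, and of \<open>d e\<close> after a twist, gives multiples of \<open>p\<close> times
  the metric components (\<open>k_eq\<close>, \<open>k'_eq\<close>).\<close>

definition k where "k = ev 1 ed"
definition k' where "k' = ev 1 (A1i (b 1 de))"

lemma pl_ed: "prd ten 2 e (pl Om d) = (1 / t) *\<^sub>C b 1 (pl T2 ed)" "b 3 (b 1 (pl T2 ed)) = b 1 (pl T2 ed)"
  "a 0 (pl T2 ed) = pl T2 ed"
proof -
  show 1: "prd ten 2 e (pl Om d) = (1 / t) *\<^sub>C b 1 (pl T2 ed)"
    by (simp add: ten_mid eP' prd_lins bils b_prd_left pl_ten)
  have "b 3 (prd ten 2 e (pl Om d)) = prd ten 2 e (pl Om d)"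
    by (simp add: b_prd_right bils pd)
  then show "b 3 (b 1 (pl T2 ed)) = b 1 (pl T2 ed)"
    using t0 unfolding 1 by (simp add: linD[OF lin_b])
  show "a 0 (pl T2 ed) = pl T2 ed"
    by (simp add: pl_ten a_prd_left bils pe)
qed

text \<open>After multiplication by \<open>p\<close>, the contraction inherits invariance under \<open>a\<close> and \<open>b\<close> from
  \<open>p e d\<close> and \<open>e p d\<close>.\<close>

lemma pk: "a 0 (pl T2 k) = pl T2 k" "b 1 (pl T2 k) = pl T2 k" "pl T2 k = ev 3 (pl T2 ed)"
proof -
  show 1: "pl T2 k = ev 3 (pl T2 ed)" by (simp add: k_def pl_legs)
  show "a 0 (pl T2 k) = pl T2 k" by (simp add: 1 pl_ed flip: contr_commute(1))
  have "b 1 (pl T2 k) = ev 1 (b 3 (a 2 (b 1 (pl T2 ed))))"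
    by (simp add: 1 contr_commute(5) flip: contr_commute(2))
  also have "\<dots> = pl T2 k"
    by (simp add: hp.comm pl_ed 1 contr_commute(5))
  finally show "b 1 (pl T2 k) = pl T2 k" .
qed

text \<open>If \<open>p x\<close> is invariant under both leg maps, like \<open>p p\<close>, then \<open>x\<close> is a multiple of \<open>p\<close>, the coefficient being its
  quantum trace: contracting once and tracing once recovers \<open>x\<close> and leaves its trace on the right.\<close>

lemma sandwich:
  assumes "a 0 (pl T2 x) = pl T2 x" "b 1 (pl T2 x) = pl T2 x" "tr 0 x = konst g"
  shows "x = (1 / \<mu>) *\<^sub>C pl T2 (konst g)"
proof -
  have "\<mu> *\<^sub>C ev 1 (pl T2 x) = \<mu> *\<^sub>C x" by (metis contr_commute(3) assms(1) tr_pl T2)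
  then have "ev 1 (pl T2 x) = x" using mu0 by (metis complex_space.scale_left_imp_eq)
  then have "x = (1 / \<mu>) *\<^sub>C tr 2 (pl T2 x)" by (metis contr_commute(4) assms(2))
  then show ?thesis by (simp add: pl_legs assms(3))
qed

lemma k_eq: "k = (1 / \<mu>) *\<^sub>C pl T2 (konst gmp)"
  by (rule sandwich[OF pk(1,2)]) (simp add: k_def gmp)

text \<open>Centrality of a metric component need only be checked after multiplication by \<open>p\<close>, where the
  component becomes a contraction of one-forms.\<close>

lemma central_aux:
  assumes "x = c *\<^sub>C pl T2 (konst g)" "c \<noteq> 0" "prd (ract T2) 2 x P = pl T2 x"
  shows "prd (ract T2) 0 (konst g) P = pl T2 (konst g)"
proof -
  have "c *\<^sub>C pl T2 (prd (ract T2) 0 (konst g) P) = c *\<^sub>C pl T2 (pl T2 (konst g))"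
    using assms(3) unfolding assms(1) by (simp add: prd_lins bils pl_pr[OF T2])
  then have "pl T2 (prd (ract T2) 0 (konst g) P) = pl T2 (pl T2 (konst g))"
    using assms(2) by (metis complex_space.scale_left_imp_eq)
  then show ?thesis by (rule pl_cancel[OF T2])
qed

text \<open>Moving \<open>p\<close> from the right of \<open>e d\<close> to its left produces leg maps that the contraction turns into a
  shift of the evaluation, by \<open>ev_ba\<close>.\<close>

lemma central_mp: "prd (ract T2) 0 (konst gmp) P = pl T2 (konst gmp)"
proof (rule central_aux[OF k_eq])
  have "prd (ract T2) 2 k P = ev 1 (prd (ract T2) 4 ed P)"
    by (simp add: k_def prd_contr_left bils)
  also have "prd (ract T2) 4 ed P = t *\<^sub>C a 2 (prd ten 2 e (pl Om d))"
    using ten_pr[of 2 e 2 d] by (simp add: dP' prd_lins bils a_prd_right)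
  also have "\<dots> = a 2 (b 1 (pl T2 ed))"
    using t0 by (simp add: pl_ed linD[OF lin_a] scaleC_scaleC)
  also have "ev 1 \<dots> = pl T2 k" by (simp add: pk(3) contr_commute(5))
  finally show "prd (ract T2) 2 k P = pl T2 k" .
qed (use mu0 in simp)

lemma pl_de: "prd ten 2 d (pl Om e) = t *\<^sub>C a 0 (pl T2 de)" "a 2 (a 0 (pl T2 de)) = a 0 (pl T2 de)"
  "b 1 (pl T2 de) = pl T2 de"
proof -
  show 1: "prd ten 2 d (pl Om e) = t *\<^sub>C a 0 (pl T2 de)"
    by (simp add: ten_mid dP' prd_lins bils a_prd_left pl_ten)
  have "a 2 (prd ten 2 d (pl Om e)) = prd ten 2 d (pl Om e)"
    by (simp add: a_prd_right bils pe)
  then show "a 2 (a 0 (pl T2 de)) = a 0 (pl T2 de)"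
    using t0 unfolding 1 by (simp add: linD[OF lin_a])
  show "b 1 (pl T2 de) = pl T2 de"
    by (simp add: pl_ten b_prd_left bils pd)
qed

lemma pk'_eq: "pl T2 k' = ev 3 (A2i (b 3 (pl T2 de)))" "pl T2 k' = ev 1 (b 1 (b 3 (pl T2 de)))"
proof -
  show 1: "pl T2 k' = ev 3 (A2i (b 3 (pl T2 de)))" by (simp add: k'_def pl_legs)
  show "pl T2 k' = ev 1 (b 1 (b 3 (pl T2 de)))"
    unfolding 1 by (simp add: contr_commute(5) hp.ab_commute)
qed

lemma pk': "a 0 (pl T2 k') = pl T2 k'" "b 1 (pl T2 k') = pl T2 k'"
proof -
  have "a 0 (A2i (pl T2 de)) = A2i (pl T2 de)"
    by (metis hp.braids(1) hp.inv_cancel pl_de(2))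
  then show "a 0 (pl T2 k') = pl T2 k'"
    by (simp add: pk'_eq(1) flip: contr_commute(1) hp.ab_commute)
  have "b 1 (pl T2 k') = ev 1 (b 1 (b 3 (b 1 (pl T2 de))))"
    by (simp add: pk'_eq(2) hp.braid_b flip: contr_commute(2))
  then show "b 1 (pl T2 k') = pl T2 k'"
    by (simp add: pk'_eq(2) pl_de)
qed

lemma tr_k': "tr 0 k' = konst (t *\<^sub>C gpm)"
proof -
  have "\<mu> *\<^sub>C k' = tr 0 (b 1 de)"
    by (simp add: k'_def flip: contr_commute(3))
  then have "\<mu> *\<^sub>C tr 0 k' = tr 0 (tr 0 (b 1 de))" by (metis contr_scale)
  also have "\<dots> = tr 0 (tr 2 (b 1 de))" by (simp add: contr_contr)
  also have "tr 2 (b 1 de) = \<mu> *\<^sub>C ev 1 (b 1 (b 1 de))"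
    using mu0 by (simp add: contr_commute scaleC_scaleC)
  also have "\<dots> = (t * \<mu>) *\<^sub>C ev 1 de"
    by (simp add: b_hecke contr_lins contr_commute scaleC_scaleC scaleC_add_right prd_contr_right bils pe prd_lins mult.commute)
  also have "tr 0 \<dots> = \<mu> *\<^sub>C konst (t *\<^sub>C gpm)"
    by (simp only: contr_scale gpm) (simp add: fun_eq_iff scaleC_scaleC mult.commute)
  finally have "\<mu> *\<^sub>C tr 0 k' = \<mu> *\<^sub>C konst (t *\<^sub>C gpm)" .
  then show ?thesis using mu0 by (metis complex_space.scale_left_imp_eq)
qed

lemma k'_eq: "k' = (t / \<mu>) *\<^sub>C pl T2 (konst gpm)"
proof -
  have 1: "pl T2 (konst (t *\<^sub>C gpm)) = t *\<^sub>C pl T2 (konst gpm)"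
    by (simp add: prd_def fun_eq_iff bilinD(4)[OF bils(5)])
  show ?thesis
    using sandwich[OF pk' tr_k'] unfolding 1 by (simp add: scaleC_scaleC)
qed

lemma central_pm: "prd (ract T2) 0 (konst gpm) P = pl T2 (konst gpm)"
proof (rule central_aux[OF k'_eq])
  have "prd (ract T2) 2 k' P = ev 1 (prd (ract T2) 4 (A1i (b 1 de)) P)"
    by (simp add: k'_def prd_contr_left bils)
  also have "prd (ract T2) 4 (A1i (b 1 de)) P = A1i (b 1 (prd (ract T2) 4 de P))"
    by (simp add: hinv_def prd_lins bils a_prd_left b_prd_left)
  also have "prd (ract T2) 4 de P = (1 / t) *\<^sub>C b 3 (prd ten 2 d (pl Om e))"
    using ten_pr[of 2 d 2 e] by (simp add: eP' prd_lins bils b_prd_right)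
  also have "\<dots> = b 3 (a 0 (pl T2 de))"
    using t0 by (simp add: pl_de linD[OF lin_b] scaleC_scaleC)
  also have "ev 1 (A1i (b 1 \<dots>)) = pl T2 k'"
    by (simp add: pk'_eq(2) hp.ab_commute)
  finally show "prd (ract T2) 2 k' P = pl T2 k'" .
qed (use mu0 t0 in simp)

lemma o_legs:
  fixes x y :: "('i, 'x::complex_space) fam" and h :: "'x \<Rightarrow> 'z::complex_space"
  assumes "lin h"
  shows "h \<circ> a n x = a n (h \<circ> x)" "h \<circ> b n x = b n (h \<circ> x)" "h \<circ> contr \<tau>' n x = contr \<tau>' n (h \<circ> x)"
    "h \<circ> (x + y) = (h \<circ> x) + (h \<circ> y)" "h \<circ> (c *\<^sub>C x) = c *\<^sub>C (h \<circ> x)" "h \<circ> hinv c (a n) x = hinv c (a n) (h \<circ> x)"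
    "h \<circ> hinv c (b n) x = hinv c (b n) (h \<circ> x)"
proof -
  show 1: "h \<circ> a n x = a n (h \<circ> x)" "h \<circ> b n x = b n (h \<circ> x)" "h \<circ> contr \<tau>' n x = contr \<tau>' n (h \<circ> x)"
    using a_lin[OF assms, of n x] b_lin[OF assms, of n x] contr_lin[OF assms, of \<tau>' n x] by (auto simp: comp_def)
  show 2: "h \<circ> (x + y) = (h \<circ> x) + (h \<circ> y)" "h \<circ> (c *\<^sub>C x) = c *\<^sub>C (h \<circ> x)" for x y :: "('i, 'x) fam" and c
    by (simp_all add: fun_eq_iff linD[OF assms])
  show "h \<circ> hinv c (a n) x = hinv c (a n) (h \<circ> x)" "h \<circ> hinv c (b n) x = hinv c (b n) (h \<circ> x)"
    by (simp_all add: hinv_def 1 2)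
qed

lemmas sg_legs = o_legs[OF sg(1)] and s1_legs = o_legs[OF s1(1)] and s2_legs = o_legs[OF s2(1)]

lemma o_prd:
  "sg \<circ> pl T2 x = pl T2 (sg \<circ> x)" "s1 \<circ> pl T3 y = pl T3 (s1 \<circ> y)" "s2 \<circ> pl T3 y = pl T3 (s2 \<circ> y)"
  "s1 \<circ> prd (ract T3) n y P = prd (ract T3) n (s1 \<circ> y) P" "s2 \<circ> prd (ract T3) n y P = prd (ract T3) n (s2 \<circ> y) P"
  "s1 \<circ> prd t21 n x w = prd t21 n (sg \<circ> x) w" "s2 \<circ> prd t12 n w x = prd t12 n w (sg \<circ> x)"
  by (simp_all add: prd_def comp_def sg s1 s2)

lemma pgp_mp: "(\<lambda>f. ract T2 (lact T2 (p (f 0) (f 1)) gmp) (p (f 2) (f 3))) = pl T2 (pl T2 (konst gmp))"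
  and pgp_pm: "(\<lambda>f. ract T2 (lact T2 (p (f 0) (f 1)) gpm) (p (f 2) (f 3))) = pl T2 (pl T2 (konst gpm))"
proof -
  have "(\<lambda>f. ract T2 (lact T2 (p (f 0) (f 1)) g) (p (f 2) (f 3))) = pl T2 (prd (ract T2) 0 (konst g) P)" for g
    by (simp add: prd_def legs01_def bimodule_bilin[OF T2] fun_eq_iff)
  then show "(\<lambda>f. ract T2 (lact T2 (p (f 0) (f 1)) gmp) (p (f 2) (f 3))) = pl T2 (pl T2 (konst gmp))"
   "(\<lambda>f. ract T2 (lact T2 (p (f 0) (f 1)) gpm) (p (f 2) (f 3))) = pl T2 (pl T2 (konst gpm))"
    by (simp_all only: central_mp central_pm)
qed

lemmas sgde' = sgde[unfolded pgp_mp] and sged' = sged[unfolded pgp_pm]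

lemma legs_plpl:
  assumes "bimodule T"
  shows "a 0 (pl T (pl T x)) = pl T (pl T x)" "b 1 (pl T (pl T x)) = pl T (pl T x)"
    "A1i (pl T (pl T x)) = pl T (pl T x)" "B1i (pl T (pl T x)) = pl T (pl T x)"
    "ev 1 (pl T (pl T x)) = pl T x"
proof -
  show 1: "a 0 (pl T (pl T x)) = pl T (pl T x)" "b 1 (pl T (pl T x)) = pl T (pl T x)"
    by (simp_all add: pl_pl[OF assms] a_prd_left b_prd_left bimodule_bilin[OF assms] pp)
  show "A1i (pl T (pl T x)) = pl T (pl T x)" "B1i (pl T (pl T x)) = pl T (pl T x)"
    using hp.inv_cancel(2)[of "pl T (pl T x)"] hp.inv_cancel(6)[of "pl T (pl T x)"] by (simp_all only: 1)
  show "ev 1 (pl T (pl T x)) = pl T x"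
    by (simp add: pl_pl[OF assms] prd_contr_left bimodule_bilin[OF assms] ev_pp)
qed

text \<open>Apply \<open>\<sigma>\<close> to the contraction \<open>k\<close> of \<open>e d\<close>: the leading term contributes \<open>k'\<close>, the metric term a multiple of \<open>p g\<close>, and the
  coefficients add up to the one in \<open>k_eq\<close>; cancelling \<open>p\<close> gives the claim. The other half is symmetric.\<close>

lemma sg_g: "sg gmp = gpm" "sg gpm = gmp"
proof -
  have "(1 / \<mu>) *\<^sub>C pl T2 (sg \<circ> konst gmp) = sg \<circ> k"
    by (simp add: k_eq sg_legs o_prd)
  also have "\<dots> = (1 / t\<^sup>2) *\<^sub>C k' + ((1 - 1 / t) / \<mu>) *\<^sub>C pl T2 (konst gpm)"
    by (simp add: k_def k'_def sg_legs sged' contr_lins legs_plpl[OF T2])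
  also have "\<dots> = (1 / \<mu>) *\<^sub>C pl T2 (konst gpm)"
    using t0 mu0 by (simp add: k'_eq scaleC_scaleC scaleC_collect) (simp add: field_simps power2_eq_square)
  finally have "pl T2 (sg \<circ> konst gmp) = pl T2 (konst gpm)"
    using mu0 by (metis complex_space.scale_left_imp_eq divide_eq_0_iff one_neq_zero)
  then show "sg gmp = gpm" using pl_cancel[OF T2] by (fastforce simp: fun_eq_iff)
  have "(t / \<mu>) *\<^sub>C pl T2 (sg \<circ> konst gpm) = sg \<circ> k'"
    by (simp add: k'_eq sg_legs o_prd)
  also have "\<dots> = t\<^sup>2 *\<^sub>C k + ((1 - t) * t / \<mu>) *\<^sub>C pl T2 (konst gmp)"
    by (simp add: k_def k'_def sg_legs sgde' contr_lins legs_plpl[OF T2] hp.ab_commute)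
  also have "\<dots> = (t / \<mu>) *\<^sub>C pl T2 (konst gmp)"
    using t0 mu0 by (simp add: k_eq scaleC_scaleC scaleC_collect) (simp add: field_simps power2_eq_square)
  finally have "pl T2 (sg \<circ> konst gpm) = pl T2 (konst gmp)"
    using mu0 t0 by (metis complex_space.scale_left_imp_eq divide_eq_0_iff)
  then show "sg gpm = gmp" using pl_cancel[OF T2] by (fastforce simp: fun_eq_iff)
qed

text \<open>On mixed products the leading terms of \<open>\<sigma>\<close> are inverse to each other and the metric terms cancel,
  by \<open>sg_g\<close> and since \<open>a\<close> and \<open>b\<close> fix \<open>p p g\<close>.\<close>

lemma sg_sg: "sg \<circ> (sg \<circ> ed) = ed" "sg \<circ> (sg \<circ> de) = de"
proof -
  show "sg \<circ> (sg \<circ> ed) = ed" "sg \<circ> (sg \<circ> de) = de"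
    using t0 mu0
    by (simp_all add: sged' sgde' sg_legs o_prd sg_g comp_def[of sg "konst _"] hp.ab_commute legs_plpl[OF T2]
          scaleC_add_right scaleC_scaleC add.assoc scaleC_collect)
       (simp_all add: field_simps power2_eq_square)
qed

end

context hk_calculus begin

section \<open>Sliding the metric through one-forms\<close>

definition c where "c = (1 - t) * t / \<mu>"
definition c' where "c' = (1 - 1 / t) / \<mu>"

lemma cc: "c = - (t\<^sup>2 * c')" and cc': "c' = - (c / t\<^sup>2)"
  using t0 mu0 by (simp_all add: c_def c'_def field_simps power2_eq_square)

text \<open>The triple products on which the braid equation is checked. The families \<open>gx\<close> and \<open>xg\<close> have a metric component
  on the left and on the right of a one-form.\<close>

definition Z :: "('i, 'o) fam \<Rightarrow> ('i, 'o) fam \<Rightarrow> ('i, 'o) fam \<Rightarrow> ('i, 't3) fam" where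
  "Z x y w = prd t12 2 x (prd ten 2 y w)"
definition gx :: "'t2 \<Rightarrow> ('i, 'o) fam \<Rightarrow> ('i, 't3) fam" where "gx g x = prd t21 0 (konst g) x"
definition xg :: "('i, 'o) fam \<Rightarrow> 't2 \<Rightarrow> ('i, 't3) fam" where "xg x g = prd t12 2 x (konst g)"

lemma Z_alt: "Z x y w = prd t21 4 (prd ten 2 x y) w"
  by (simp add: Z_def t12_ten)

lemma prd_ops:
  "prd t21 4 (a 0 x) w = a 0 (prd t21 4 x w)" "prd t21 4 (b 1 x) w = b 1 (prd t21 4 x w)"
  "prd t21 4 (A1i x) w = A1i (prd t21 4 x w)" "prd t21 4 (B1i x) w = B1i (prd t21 4 x w)"
  "prd t12 2 (legs01 u) (a 0 y) = a 2 (prd t12 2 (legs01 u) y)"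
  "prd t12 2 (legs01 u) (b 1 y) = b 3 (prd t12 2 (legs01 u) y)"
  "prd t12 2 (legs01 u) (A1i y) = A2i (prd t12 2 (legs01 u) y)"
  "prd t12 2 (legs01 u) (B1i y) = B2i (prd t12 2 (legs01 u) y)"
  by (simp_all add: hinv_def prd_lins bils a_prd_left b_prd_left a_prd_right b_prd_right)

abbreviation "pp3 x \<equiv> pl T3 (pl T3 x)"

lemma pp3_gx: "pp3 (gx g w) = prd t21 4 (pl T2 (pl T2 (konst g))) w"
  by (simp add: gx_def pl_t21)

lemma dpp: "prd t12 2 d (pl T2 y) = t *\<^sub>C a 0 (pl T3 (prd t12 2 d y))"
  by (simp add: t12_mid dP' prd_lins bils a_prd_left pl_t12)
lemma epp: "prd t12 2 e (pl T2 y) = (1 / t) *\<^sub>C b 1 (pl T3 (prd t12 2 e y))"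
  by (simp add: t12_mid eP' prd_lins bils b_prd_left pl_t12)

lemma lin_ab [simp]:
  "a n (x + y) = a n x + a n y" "a n (u *\<^sub>C x) = u *\<^sub>C a n x" "b n (x + y) = b n x + b n y" "b n (u *\<^sub>C x) = u *\<^sub>C b n x"
  by (simp_all add: linD[OF lin_a] linD[OF lin_b])

text \<open>In \<open>s2_Z\<close> the metric term carries its two factors \<open>p\<close> between the forms; they can be moved to the
  front at the cost of leg maps.\<close>

lemma dppg: "prd t12 2 d (pl T2 (pl T2 (konst g))) = t\<^sup>2 *\<^sub>C a 0 (a 2 (pp3 (xg d g)))"
  by (simp add: dpp prd_lins bils xg_def scaleC_scaleC power2_eq_square flip: pl_legs)
lemma eppg: "prd t12 2 e (pl T2 (pl T2 (konst g))) = (1 / t\<^sup>2) *\<^sub>C b 1 (b 3 (pp3 (xg e g)))"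
  by (simp add: epp prd_lins bils xg_def scaleC_scaleC power2_eq_square flip: pl_legs)

lemma s1_Z:
  "s1 \<circ> Z d d w = t *\<^sub>C a 0 (b 1 (Z d d w))"
  "s1 \<circ> Z e e w = (1 / t) *\<^sub>C a 0 (b 1 (Z e e w))"
  "s1 \<circ> Z d e w = t\<^sup>2 *\<^sub>C a 0 (B1i (Z e d w)) + c *\<^sub>C pp3 (gx gmp w)"
  "s1 \<circ> Z e d w = (1 / t\<^sup>2) *\<^sub>C A1i (b 1 (Z d e w)) + c' *\<^sub>C pp3 (gx gpm w)"
  by (simp_all add: Z_alt o_prd sgdd sgee sgde' sged' prd_lins bils prd_ops pp3_gx c_def c'_def)

lemma s2_Z:
  "s2 \<circ> Z (legs01 u) d d = t *\<^sub>C a 2 (b 3 (Z (legs01 u) d d))"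
  "s2 \<circ> Z (legs01 u) e e = (1 / t) *\<^sub>C a 2 (b 3 (Z (legs01 u) e e))"
  "s2 \<circ> Z (legs01 u) d e = t\<^sup>2 *\<^sub>C a 2 (B2i (Z (legs01 u) e d)) + c *\<^sub>C prd t12 2 (legs01 u) (pl T2 (pl T2 (konst gmp)))"
  "s2 \<circ> Z (legs01 u) e d = (1 / t\<^sup>2) *\<^sub>C A2i (b 3 (Z (legs01 u) d e)) + c' *\<^sub>C prd t12 2 (legs01 u) (pl T2 (pl T2 (konst gpm)))"
  by (simp_all add: Z_def o_prd sgdd sgee sgde' sged' prd_lins bils prd_ops c_def c'_def)

lemma Z_sym: "b 1 (Z d d w) = Z d d w" "a 0 (Z e e w) = Z e e w"
  "b 3 (Z (legs01 u) d d) = Z (legs01 u) d d" "a 2 (Z (legs01 u) e e) = Z (legs01 u) e e"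
proof -
  show "b 1 (Z d d w) = Z d d w" "a 0 (Z e e w) = Z e e w"
    by (simp_all add: Z_alt b_dd a_ee flip: prd_ops)
  show "b 3 (Z (legs01 u) d d) = Z (legs01 u) d d" "a 2 (Z (legs01 u) e e) = Z (legs01 u) e e"
    by (simp_all add: Z_def b_dd a_ee flip: prd_ops)
qed

lemma pl_gx:
  assumes "g = gmp \<or> g = gpm"
  shows "pl T3 (gx g x) = prd t21 0 (konst g) (pl Om x)"
  using assms by (auto simp: gx_def pl_t21 t21_mid central_mp central_pm)

lemma gx_pr:
  "prd (ract T3) 2 (gx g x) P = prd t21 0 (konst g) (prd (ract Om) 2 x P)"
  by (simp add: gx_def t21_pr)

lemma xg_pr:
  assumes "g = gmp \<or> g = gpm"
  shows "prd (ract T3) 2 (xg x g) P = prd t12 2 x (pl T2 (konst g))"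
  using assms t12_pr[of 2 x 0 "konst g"] by (auto simp: xg_def central_mp central_pm)

lemma gx_dP: "prd (ract T3) 2 (gx g d) P = t *\<^sub>C a 0 (pl T3 (gx g d))" if "g = gmp \<or> g = gpm"
  by (simp add: gx_pr pl_gx[OF that] dP' prd_lins bils a_prd_right)
lemma gx_eP: "prd (ract T3) 2 (gx g e) P = (1 / t) *\<^sub>C b 1 (pl T3 (gx g e))" if "g = gmp \<or> g = gpm"
  by (simp add: gx_pr pl_gx[OF that] eP' prd_lins bils b_prd_right)
lemma xg_dP: "prd (ract T3) 2 (xg d g) P = t *\<^sub>C a 0 (pl T3 (xg d g))" if "g = gmp \<or> g = gpm"
  by (subst xg_pr[OF that]) (simp add: dpp xg_def)
lemma xg_eP: "prd (ract T3) 2 (xg e g) P = (1 / t) *\<^sub>C b 1 (pl T3 (xg e g))" if "g = gmp \<or> g = gpm"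
  by (subst xg_pr[OF that]) (simp add: epp xg_def)

text \<open>A metric component with one factor \<open>p\<close> is a contraction of a triple product. This brings the slide identities
  within the reach of the formulas \<open>s1_Z\<close> and \<open>s2_Z\<close>.\<close>

lemma pl_gx_k: "pl T3 (gx gmp w) = \<mu> *\<^sub>C ev 1 (Z e d w)"
  "pl T3 (gx gpm w) = (\<mu> / t) *\<^sub>C ev 1 (A1i (b 1 (Z d e w)))"
proof -
  have 1: "pl T2 (konst gmp) = \<mu> *\<^sub>C k" "pl T2 (konst gpm) = (\<mu> / t) *\<^sub>C k'"
    using mu0 t0 by (simp_all add: k_eq k'_eq scaleC_scaleC)
  show "pl T3 (gx gmp w) = \<mu> *\<^sub>C ev 1 (Z e d w)"
    "pl T3 (gx gpm w) = (\<mu> / t) *\<^sub>C ev 1 (A1i (b 1 (Z d e w)))"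
    by (simp_all add: gx_def pl_t21 1 prd_lins bils Z_alt k_def k'_def prd_contr_left flip: prd_ops)
qed

lemma xg_k: "prd t12 2 (legs01 u) (pl T2 (konst gmp)) = \<mu> *\<^sub>C ev 3 (Z (legs01 u) e d)"
  "prd t12 2 (legs01 u) (pl T2 (konst gpm)) = (\<mu> / t) *\<^sub>C ev 3 (A2i (b 3 (Z (legs01 u) d e)))"
proof -
  have 1: "pl T2 (konst gmp) = \<mu> *\<^sub>C k" "pl T2 (konst gpm) = (\<mu> / t) *\<^sub>C k'"
    using mu0 t0 by (simp_all add: k_eq k'_eq scaleC_scaleC)
  show "prd t12 2 (legs01 u) (pl T2 (konst gmp)) = \<mu> *\<^sub>C ev 3 (Z (legs01 u) e d)"
    "prd t12 2 (legs01 u) (pl T2 (konst gpm)) = (\<mu> / t) *\<^sub>C ev 3 (A2i (b 3 (Z (legs01 u) d e)))"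
    by (simp_all add: 1 prd_lins bils Z_def k_def k'_def prd_contr_right flip: prd_ops)
qed

lemma ev_plgx: "ev 1 (pl T3 (gx g d)) = 0" "b 1 (pl T3 (gx g d)) = pl T3 (gx g d)"
    "a 0 (pl T3 (gx g e)) = pl T3 (gx g e)" "ev 1 (b 1 (pl T3 (gx g e))) = 0" if "g = gmp \<or> g = gpm"
  by (simp_all add: pl_gx[OF that] prd_contr_right b_prd_right a_prd_right bils ev_pd pd pe prd_lins contr_commute)

lemma ev_plxg: "ev 1 (pl T3 (xg d g)) = 0" "b 1 (pl T3 (xg d g)) = pl T3 (xg d g)"
    "a 0 (pl T3 (xg e g)) = pl T3 (xg e g)"
  by (simp_all add: xg_def pl_t12 prd_contr_left b_prd_left a_prd_left bils ev_pd pd pe prd_lins)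

lemma dep2: "dep 2 (gx g (legs01 u))" "dep 2 (xg (legs01 u) g)" "dep 2 x \<Longrightarrow> dep 2 (h \<circ> x)"
proof -
  show "dep 2 (gx g (legs01 u))" "dep 2 (xg (legs01 u) g)"
    by (auto simp: dep_def gx_def xg_def prd_def legs01_def)
  show "dep 2 x \<Longrightarrow> dep 2 (h \<circ> x)"
    unfolding dep_def comp_def by metis
qed

lemma inv_fixed: "a 0 x = x \<Longrightarrow> A1i x = x" "a 2 x = x \<Longrightarrow> A2i x = x" "b 1 x = x \<Longrightarrow> B1i x = x" "b 3 x = x \<Longrightarrow> B2i x = x"
  by (metis hp.inv_cancel)+

lemma ev_A1i_plgx: "ev 1 (A1i (b 1 (pl T3 (gx g e)))) = 0" if "g = gmp \<or> g = gpm"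
proof -
  have "A1i (b 1 (pl T3 (gx g e))) = b 1 (A1i (pl T3 (gx g e)))" by (simp add: hp.ab_commute)
  then show ?thesis by (simp add: inv_fixed ev_plgx[OF that])
qed

text \<open>The idea for all four slide identities: multiply by \<open>p\<close>, write the metric as a contraction of a triple
  product, and compute with \<open>\<sigma>\<^sub>1\<close> and \<open>\<sigma>\<^sub>2\<close> there. The metric terms that arise vanish, because the
  contraction meets \<open>p d\<close> or \<open>e p\<close>; finally the factor \<open>p\<close> is cancelled.\<close>

lemma slide1: "s1 \<circ> xg d gmp = s2 \<circ> gx gmp d"
proof (rule pr_cancel[OF T3])
  have "prd (ract T3) 2 (s1 \<circ> xg d gmp) P = s1 \<circ> prd t12 2 d (pl T2 (konst gmp))"
    by (simp add: xg_pr flip: o_prd)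
  also have "\<dots> = \<mu> *\<^sub>C ev 3 (s1 \<circ> Z d e d)"
    by (simp add: xg_k s1_legs)
  also have "\<dots> = (\<mu> * t\<^sup>2) *\<^sub>C a 0 (ev 1 (a 2 (Z e d d)))"
    by (simp add: s1_Z contr_lins pl_legs ev_plgx prd_lins bils scaleC_scaleC contr_commute(1) )
       (simp add: contr_commute(5))
  also have "\<dots> = (\<mu> * t) *\<^sub>C a 0 (ev 1 (s2 \<circ> Z e d d))"
    by (simp add: s2_Z Z_sym contr_lins scaleC_scaleC power2_eq_square mult.commute)
  also have "\<dots> = s2 \<circ> (t *\<^sub>C a 0 (pl T3 (gx gmp d)))"
    by (simp add: pl_gx_k s2_legs scaleC_scaleC mult.commute)
  also have "\<dots> = prd (ract T3) 2 (s2 \<circ> gx gmp d) P"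
    by (simp add: gx_dP flip: o_prd)
  finally show "prd (ract T3) 2 (s1 \<circ> xg d gmp) P = prd (ract T3) 2 (s2 \<circ> gx gmp d) P" .
qed (simp_all add: dep2)

lemma slide4: "s1 \<circ> xg e gpm = s2 \<circ> gx gpm e"
proof (rule pr_cancel[OF T3])
  have "prd (ract T3) 2 (s1 \<circ> xg e gpm) P = s1 \<circ> prd t12 2 e (pl T2 (konst gpm))"
    by (simp add: xg_pr flip: o_prd)
  also have "\<dots> = (\<mu> / t) *\<^sub>C ev 3 (A2i (b 3 (s1 \<circ> Z e d e)))"
    by (simp add: xg_k s1_legs)
  also have "\<dots> = (\<mu> / t ^ 3) *\<^sub>C ev 3 (A2i (b 3 (A1i (b 1 (Z d e e)))))"
    by (simp add: s1_Z contr_lins pl_legs ev_plgx ev_A1i_plgx prd_lins bils scaleC_scaleC power2_eq_square power3_eq_cube)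
  also have "\<dots> = (\<mu> / t ^ 3) *\<^sub>C b 1 (ev 1 (A1i (b 1 (b 3 (Z d e e)))))"
    by (simp add: contr_commute(5) hp.ab_commute hp.braid_b flip: contr_commute(2))
  also have "\<dots> = (\<mu> / t\<^sup>2) *\<^sub>C b 1 (ev 1 (A1i (b 1 (s2 \<circ> Z d e e))))"
    by (simp add: s2_Z Z_sym contr_lins scaleC_scaleC power2_eq_square power3_eq_cube flip: hp.comm)
  also have "\<dots> = s2 \<circ> ((1 / t) *\<^sub>C b 1 (pl T3 (gx gpm e)))"
    by (simp add: pl_gx_k s2_legs scaleC_scaleC mult.commute power2_eq_square)
  also have "\<dots> = prd (ract T3) 2 (s2 \<circ> gx gpm e) P"
    by (simp add: gx_eP flip: o_prd)
  finally show "prd (ract T3) 2 (s1 \<circ> xg e gpm) P = prd (ract T3) 2 (s2 \<circ> gx gpm e) P" .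
qed (simp_all add: dep2)

lemma slide2: "s1 \<circ> (s2 \<circ> gx gmp e) = xg e gmp"
proof (rule pl_cancel[OF T3])
  have e0: "ev 1 (prd t12 2 e (pl T2 y)) = 0" for y
    by (simp add: t12_mid prd_contr_left bils ev_eP prd_lins)
  have "pl T3 (s2 \<circ> gx gmp e) = \<mu> *\<^sub>C ev 1 (s2 \<circ> Z e d e)"
    by (simp add: pl_gx_k s2_legs flip: o_prd)
  also have "\<dots> = (\<mu> * t\<^sup>2) *\<^sub>C ev 1 (a 2 (B2i (Z e e d)))"
    by (simp add: s2_Z contr_lins e0 scaleC_scaleC)
  finally have "pl T3 (s1 \<circ> (s2 \<circ> gx gmp e)) = (\<mu> * t\<^sup>2) *\<^sub>C ev 1 (a 2 (B2i (s1 \<circ> Z e e d)))"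
    by (simp add: s1_legs flip: o_prd)
  also have "\<dots> = (\<mu> * t) *\<^sub>C ev 1 (a 2 (B2i (b 1 (Z e e d))))"
    using t0 by (simp add: s1_Z Z_sym contr_lins scaleC_scaleC power2_eq_square flip: hp.comm)
  also have "\<dots> = (\<mu> * t) *\<^sub>C B1i (ev 1 (a 2 (b 1 (Z e e d))))"
    by (simp add: hinv_def contr_lins contr_commute(2) flip: hp.comm)
  also have "\<dots> = t *\<^sub>C B1i (prd (ract T3) 2 (xg e gmp) P)"
    by (simp add: xg_pr xg_k contr_commute(5) scaleC_scaleC mult.commute)
  also have "\<dots> = pl T3 (xg e gmp)"
    using t0 by (simp add: xg_eP scaleC_scaleC)
  finally show "pl T3 (s1 \<circ> (s2 \<circ> gx gmp e)) = pl T3 (xg e gmp)" .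
qed

lemma slide3: "s1 \<circ> (s2 \<circ> gx gpm d) = xg d gpm"
proof (rule pl_cancel[OF T3])
  have e0: "ev 1 (A1i (b 1 (prd t12 2 d (pl T2 (pl T2 (konst gpm)))))) = 0"
    by (simp add: dppg hp.ab_commute contr_lins flip: contr_commute(5))
       (simp add: pl_legs ev_plxg prd_lins bils)
  have "pl T3 (s2 \<circ> gx gpm d) = (\<mu> / t) *\<^sub>C ev 1 (A1i (b 1 (s2 \<circ> Z d e d)))"
    by (simp add: pl_gx_k s2_legs flip: o_prd)
  also have "\<dots> = (\<mu> / t ^ 3) *\<^sub>C ev 1 (A1i (b 1 (A2i (b 3 (Z d d e)))))"
    by (simp add: s2_Z contr_lins e0 scaleC_scaleC power2_eq_square power3_eq_cube)
  finally have "pl T3 (s1 \<circ> (s2 \<circ> gx gpm d)) = (\<mu> / t ^ 3) *\<^sub>C ev 1 (A1i (b 1 (A2i (b 3 (s1 \<circ> Z d d e)))))"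
    by (simp add: s1_legs flip: o_prd)
  also have "\<dots> = (\<mu> / t\<^sup>2) *\<^sub>C ev 1 (b 1 (b 3 (A1i (A2i (a 0 (Z d d e))))))"
    using t0 by (simp add: s1_Z Z_sym contr_lins scaleC_scaleC power2_eq_square power3_eq_cube hp.ab_commute)
  also have "\<dots> = (\<mu> / t\<^sup>2) *\<^sub>C ev 1 (a 2 (b 1 (A1i (A2i (b 3 (Z d d e))))))"
    by (simp add: hp.braids hp.ab_commute)
  also have "\<dots> = (\<mu> / t\<^sup>2) *\<^sub>C A1i (ev 3 (A2i (b 3 (Z d d e))))"
    by (simp add: hinv_def contr_lins contr_commute(1) flip: contr_commute(5))
  also have "\<dots> = (1 / t) *\<^sub>C A1i (prd (ract T3) 2 (xg d gpm) P)"
    by (simp add: xg_pr xg_k scaleC_scaleC power2_eq_square)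
  also have "\<dots> = pl T3 (xg d gpm)"
    using t0 by (simp add: xg_dP scaleC_scaleC)
  finally show "pl T3 (s1 \<circ> (s2 \<circ> gx gpm d)) = pl T3 (xg d gpm)" .
qed

section \<open>The braid equation on triples of generators\<close>

text \<open>On products of two equal forms \<open>\<sigma>\<close> is a multiple of \<open>a\<close> or of \<open>b\<close> and inherits its Hecke relation.\<close>

lemma sg_sg_dd: "sg \<circ> (sg \<circ> dd) = (t - 1) *\<^sub>C (sg \<circ> dd) + t *\<^sub>C dd"
  using t0 by (simp add: sgdd sg_legs b_dd a_hecke scaleC_add_right scaleC_scaleC) (simp add: field_simps)
lemma sg_sg_ee: "sg \<circ> (sg \<circ> ee) = (1 / t - 1) *\<^sub>C (sg \<circ> ee) + (1 / t) *\<^sub>C ee"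
  using t0 by (simp add: sgee sg_legs a_ee b_hecke scaleC_add_right scaleC_scaleC flip: hp.comm) (simp add: field_simps)

text \<open>The metric families are full contractions of triple products, so quadratic relations of \<open>\<sigma>\<^sub>1\<close>
  and \<open>\<sigma>\<^sub>2\<close> pass from triple products to them.\<close>

lemma gx_tr: "gx gmp w = tr 0 (ev 1 (Z e d w))" "gx gpm w = tr 0 (ev 1 (Z d e w))"
  by (simp_all add: gx_def Z_alt prd_contr_left bils gmp gpm)
lemma xg_tr: "xg (legs01 u) gmp = tr 2 (ev 3 (Z (legs01 u) e d))" "xg (legs01 u) gpm = tr 2 (ev 3 (Z (legs01 u) d e))"
  by (simp_all add: xg_def Z_def prd_contr_right bils gmp gpm)

lemma s1s1_Z: "s1 \<circ> (s1 \<circ> Z x y w) = prd t21 4 (sg \<circ> (sg \<circ> prd ten 2 x y)) w"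
  by (simp add: Z_alt o_prd)
lemma s2s2_Z: "s2 \<circ> (s2 \<circ> Z x y w) = prd t12 2 x (sg \<circ> (sg \<circ> prd ten 2 y w))"
  by (simp add: Z_def o_prd)

lemma ss_mixed:
  "s1 \<circ> (s1 \<circ> Z d e w) = Z d e w" "s1 \<circ> (s1 \<circ> Z e d w) = Z e d w"
  "s2 \<circ> (s2 \<circ> Z x d e) = Z x d e" "s2 \<circ> (s2 \<circ> Z x e d) = Z x e d"
proof -
  show "s1 \<circ> (s1 \<circ> Z d e w) = Z d e w" "s1 \<circ> (s1 \<circ> Z e d w) = Z e d w"
    by (simp_all only: s1s1_Z sg_sg) (simp_all add: Z_alt)
  show "s2 \<circ> (s2 \<circ> Z x d e) = Z x d e" "s2 \<circ> (s2 \<circ> Z x e d) = Z x e d"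
    by (simp_all only: s2s2_Z sg_sg) (simp_all add: Z_def)
qed

lemma ss_dd:
  "s1 \<circ> (s1 \<circ> Z d d w) = (t - 1) *\<^sub>C (s1 \<circ> Z d d w) + t *\<^sub>C Z d d w"
  "s2 \<circ> (s2 \<circ> Z x d d) = (t - 1) *\<^sub>C (s2 \<circ> Z x d d) + t *\<^sub>C Z x d d"
  "s1 \<circ> (s1 \<circ> Z e e w) = (1 / t - 1) *\<^sub>C (s1 \<circ> Z e e w) + (1 / t) *\<^sub>C Z e e w"
  "s2 \<circ> (s2 \<circ> Z x e e) = (1 / t - 1) *\<^sub>C (s2 \<circ> Z x e e) + (1 / t) *\<^sub>C Z x e e"
proof -
  show "s1 \<circ> (s1 \<circ> Z d d w) = (t - 1) *\<^sub>C (s1 \<circ> Z d d w) + t *\<^sub>C Z d d w"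
    "s1 \<circ> (s1 \<circ> Z e e w) = (1 / t - 1) *\<^sub>C (s1 \<circ> Z e e w) + (1 / t) *\<^sub>C Z e e w"
    by (simp_all only: s1s1_Z sg_sg_dd sg_sg_ee prd_lins bils) (simp_all add: Z_alt o_prd)
  show "s2 \<circ> (s2 \<circ> Z x d d) = (t - 1) *\<^sub>C (s2 \<circ> Z x d d) + t *\<^sub>C Z x d d"
    "s2 \<circ> (s2 \<circ> Z x e e) = (1 / t - 1) *\<^sub>C (s2 \<circ> Z x e e) + (1 / t) *\<^sub>C Z x e e"
    by (simp_all only: s2s2_Z sg_sg_dd sg_sg_ee prd_lins bils) (simp_all add: Z_def o_prd)
qed

lemma ss_g:
  "s1 \<circ> (s1 \<circ> xg d gmp) = xg d gmp" "s2 \<circ> (s2 \<circ> gx gpm d) = gx gpm d" "s2 \<circ> xg d gpm = xg d gmp"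
  "s1 \<circ> (s1 \<circ> xg e gpm) = xg e gpm" "s2 \<circ> (s2 \<circ> gx gmp e) = gx gmp e" "s2 \<circ> xg e gmp = xg e gpm"
  "s2 \<circ> (s2 \<circ> gx gmp d) = (t - 1) *\<^sub>C (s2 \<circ> gx gmp d) + t *\<^sub>C gx gmp d"
  "s2 \<circ> (s2 \<circ> gx gpm e) = (1 / t - 1) *\<^sub>C (s2 \<circ> gx gpm e) + (1 / t) *\<^sub>C gx gpm e"
proof -
  show "s2 \<circ> xg d gpm = xg d gmp" "s2 \<circ> xg e gmp = xg e gpm"
    by (simp_all add: xg_def o_prd sg_g comp_def[of sg "konst _"])
  show "s1 \<circ> (s1 \<circ> xg d gmp) = xg d gmp" "s2 \<circ> (s2 \<circ> gx gpm d) = gx gpm d"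
    "s1 \<circ> (s1 \<circ> xg e gpm) = xg e gpm" "s2 \<circ> (s2 \<circ> gx gmp e) = gx gmp e"
    "s2 \<circ> (s2 \<circ> gx gmp d) = (t - 1) *\<^sub>C (s2 \<circ> gx gmp d) + t *\<^sub>C gx gmp d"
    "s2 \<circ> (s2 \<circ> gx gpm e) = (1 / t - 1) *\<^sub>C (s2 \<circ> gx gpm e) + (1 / t) *\<^sub>C gx gpm e"
    by (simp_all only: gx_tr xg_tr s1_legs s2_legs ss_mixed ss_dd contr_add contr_scale)
qed

lemma s1s1_xg:
  "s1 \<circ> (s1 \<circ> xg d gpm) = (t - 1) *\<^sub>C (s1 \<circ> xg d gpm) + t *\<^sub>C xg d gpm"
  "s1 \<circ> (s1 \<circ> xg e gmp) = (1 / t - 1) *\<^sub>C (s1 \<circ> xg e gmp) + (1 / t) *\<^sub>C xg e gmp"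
  by (simp_all only: xg_tr s1_legs ss_dd contr_add contr_scale)

text \<open>Vectors killed by a fixed quadratic polynomial in \<open>\<sigma>\<^sub>1\<close> are closed under everything that commutes
  with \<open>\<sigma>\<^sub>1\<close>. This transports the quadratic relation to \<open>\<sigma>\<^sub>2\<close> of a metric family, which is a sum of
  contracted triple products and \<open>p\<close>-multiples of metric families.\<close>

definition quad :: "complex \<Rightarrow> complex \<Rightarrow> ('i, 't3) fam \<Rightarrow> bool" where
  "quad u v x \<longleftrightarrow> s1 \<circ> (s1 \<circ> x) = u *\<^sub>C (s1 \<circ> x) + v *\<^sub>C x"

lemma quad_closed:
  "quad u v x \<Longrightarrow> quad u v y \<Longrightarrow> quad u v (x + y)" "quad u v x \<Longrightarrow> quad u v (w *\<^sub>C x)"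
  "quad u v x \<Longrightarrow> quad u v (a n x)" "quad u v x \<Longrightarrow> quad u v (b n x)" "quad u v x \<Longrightarrow> quad u v (pl T3 x)"
  "quad u v x \<Longrightarrow> quad u v (contr \<tau>' n x)"
  by (simp_all add: quad_def s1_legs o_prd contr_lins prd_lins bils)
     (simp_all add: scaleC_add_right scaleC_scaleC mult.commute add_ac)

lemma quad_hinv:
  "quad u v x \<Longrightarrow> quad u v (hinv w (a n) x)" "quad u v x \<Longrightarrow> quad u v (hinv w (b n) x)"
  by (simp_all add: hinv_def quad_closed)

lemma s1s1_s2_gx:
  "s1 \<circ> (s1 \<circ> (s2 \<circ> gx gpm d)) = (t - 1) *\<^sub>C (s1 \<circ> (s2 \<circ> gx gpm d)) + t *\<^sub>C (s2 \<circ> gx gpm d)"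
  "s1 \<circ> (s1 \<circ> (s2 \<circ> gx gmp e)) = (1 / t - 1) *\<^sub>C (s1 \<circ> (s2 \<circ> gx gmp e)) + (1 / t) *\<^sub>C (s2 \<circ> gx gmp e)"
proof -
  have 1: "s2 \<circ> gx gpm d = tr 0 (ev 1 (s2 \<circ> Z d e d))" "s2 \<circ> gx gmp e = tr 0 (ev 1 (s2 \<circ> Z e d e))"
    by (simp_all only: gx_tr s2_legs)
  have "quad (t - 1) t (s2 \<circ> gx gpm d)"
    unfolding 1 s2_Z dppg by (intro quad_closed quad_hinv) (simp_all add: quad_def ss_dd s1s1_xg)
  then show "s1 \<circ> (s1 \<circ> (s2 \<circ> gx gpm d)) = (t - 1) *\<^sub>C (s1 \<circ> (s2 \<circ> gx gpm d)) + t *\<^sub>C (s2 \<circ> gx gpm d)"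
    by (simp only: quad_def)
  have "quad (1 / t - 1) (1 / t) (s2 \<circ> gx gmp e)"
    unfolding 1 s2_Z eppg by (intro quad_closed quad_hinv) (simp_all add: quad_def ss_dd s1s1_xg)
  then show "s1 \<circ> (s1 \<circ> (s2 \<circ> gx gmp e)) = (1 / t - 1) *\<^sub>C (s1 \<circ> (s2 \<circ> gx gmp e)) + (1 / t) *\<^sub>C (s2 \<circ> gx gmp e)"
    by (simp only: quad_def)
qed

lemma pp3_fixed:
  "a 0 (pp3 x) = pp3 x" "b 1 (pp3 x) = pp3 x"
  "b 3 (pp3 (gx gmp d)) = pp3 (gx gmp d)" "b 3 (pp3 (gx gpm d)) = pp3 (gx gpm d)" "b 3 (pp3 (xg d g)) = pp3 (xg d g)"
  "a 2 (pp3 (gx gmp e)) = pp3 (gx gmp e)" "a 2 (pp3 (gx gpm e)) = pp3 (gx gpm e)" "a 2 (pp3 (xg e g)) = pp3 (xg e g)"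
  by (simp_all add: legs_plpl[OF T3] pl_legs ev_plgx ev_plxg)

lemma sector_d: "sector t (a 0) (a 2) (b 1) (b 3) c c' (\<lambda>x. s1 \<circ> x) (\<lambda>x. s2 \<circ> x) (Z d d e) (Z d e d) (Z e d d)
   (pp3 (gx gmp d)) (pp3 (xg d gmp)) (pp3 (gx gpm d)) (pp3 (xg d gpm))"
  by unfold_locales
     (simp_all add: lin_def s1_legs s2_legs cc s1_Z s2_Z dppg pp3_fixed o_prd slide1 slide3 ss_g ss_g[unfolded slide1] s1s1_s2_gx[unfolded slide3]
        prd_lins bils scaleC_scaleC mult.commute)

text \<open>The same sector with \<open>d\<close> and \<open>e\<close>, \<open>a\<close> and \<open>b\<close>, and \<open>t\<close> and \<open>1 / t\<close> exchanged.\<close>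

lemma sector_e: "sector (1 / t) (b 1) (b 3) (a 0) (a 2) c' c (\<lambda>x. s1 \<circ> x) (\<lambda>x. s2 \<circ> x) (Z e e d) (Z e d e) (Z d e e)
   (pp3 (gx gpm e)) (pp3 (xg e gpm)) (pp3 (gx gmp e)) (pp3 (xg e gmp))"
  by unfold_locales
     (simp_all add: t0 lin_a lin_b a_hecke b_hecke hp.braid_a hp.braid_b hp.comm
        lin_def s1_legs s2_legs cc' s1_Z s2_Z eppg pp3_fixed o_prd slide4 slide2 ss_g ss_g[unfolded slide4] s1s1_s2_gx[unfolded slide2]
        prd_lins bils scaleC_scaleC power_one_over hp.ab_commute mult.commute)

lemma braid_pure:
  "s1 \<circ> (s2 \<circ> (s1 \<circ> Z d d d)) = s2 \<circ> (s1 \<circ> (s2 \<circ> Z d d d))"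
  "s1 \<circ> (s2 \<circ> (s1 \<circ> Z e e e)) = s2 \<circ> (s1 \<circ> (s2 \<circ> Z e e e))"
  by (simp_all add: s1_Z s2_Z s1_legs s2_legs Z_sym hp.ab_commute hp.braid_a hp.braid_b)

lemma braid_Z:
  assumes "x = d \<or> x = e" "y = d \<or> y = e" "w = d \<or> w = e"
  shows "s1 \<circ> (s2 \<circ> (s1 \<circ> Z x y w)) = s2 \<circ> (s1 \<circ> (s2 \<circ> Z x y w))"
  using assms sector.braid_Z0[OF sector_d] sector.braid_Z1[OF sector_d] sector.braid_Z2[OF sector_d]
    sector.braid_Z0[OF sector_e] sector.braid_Z1[OF sector_e] sector.braid_Z2[OF sector_e] braid_pure
  by blast

end

section \<open>Weights\<close>

lemma wform_simple_root:
  assumes "i \<in> {1..r}"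
  shows "wform r (simple_root i) \<mu> = \<mu> i - \<mu> (i + 1)"
proof -
  have "wform r (simple_root i) \<mu> = (\<Sum>k = 1..r+1. (if k = i then \<mu> k else 0) - (if k = i + 1 then \<mu> k else 0))"
    unfolding wform_def simple_root_def by (rule sum.cong) auto
  also have "\<dots> = \<mu> i - \<mu> (i + 1)"
    using assms by (subst sum_subtractf) simp
  finally show ?thesis .
qed

lemma wform_simple_simple:
  assumes "i \<in> {1..r}" "j \<in> {1..r}"
  shows "wform r (simple_root i) (simple_root j) = (if i = j then 2 else if i = j + 1 \<or> j = i + 1 then - 1 else 0)"
  unfolding wform_simple_root[OF assms(1)] using assms by (auto simp: simple_root_def)

lemma wform_simple_fund:
  assumes "i \<in> {1..r}" "j \<in> {1..r}"
  shows "wform r (simple_root i) (fund_weight r j) = (if i = j then 1 else 0)"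
  using assms by (auto simp: wform_simple_root fund_weight_def)

lemma wform_sum_right:
  "wform r \<nu> (\<lambda>k. \<Sum>i\<in>I. g i * \<mu> i k) = (\<Sum>i\<in>I. g i * wform r \<nu> (\<mu> i))"
  unfolding wform_def sum_distrib_left by (subst sum.swap) (simp add: mult_ac)

text \<open>A weight is determined by its pairings with the simple roots, the fundamental weights being
  the dual basis.\<close>

lemma lattice_eqI:
  assumes "\<mu> \<in> weight_lattice r" "\<nu> \<in> weight_lattice r"
    and "\<And>i. i \<in> {1..r} \<Longrightarrow> wform r (simple_root i) \<mu> = wform r (simple_root i) \<nu>"
  shows "\<mu> = \<nu>"
proof -
  obtain c d where c: "\<mu> = (\<lambda>k. \<Sum>i = 1..r. real_of_int (c i) * fund_weight r i k)"
    and d: "\<nu> = (\<lambda>k. \<Sum>i = 1..r. real_of_int (d i) * fund_weight r i k)"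
    using assms(1,2) unfolding weight_lattice_def by auto
  have "wform r (simple_root i) (\<lambda>k. \<Sum>j = 1..r. real_of_int (c j) * fund_weight r j k) = c i"
    if "i \<in> {1..r}" for i and c :: "nat \<Rightarrow> int"
    using that by (simp add: wform_sum_right wform_simple_fund if_distrib cong: if_cong)
  then have "c i = d i" if "i \<in> {1..r}" for i
    using assms(3)[OF that] that unfolding c d by simp
  then show ?thesis unfolding c d by simp
qed

lemma fund_weight_lattice: "j \<in> {1..r} \<Longrightarrow> fund_weight r j \<in> weight_lattice r"
  unfolding weight_lattice_def
  by (intro CollectI exI[of _ "\<lambda>i. if i = j then 1 else 0"])
     (auto simp: fun_eq_iff if_distrib if_distribR cong: if_cong)

lemma two_rho_eq:
  assumes "k \<in> {1..r+1}"
  shows "two_rho r k = real r + 2 - 2 * real k"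
proof -
  have "(\<Sum>i = 1..r. fund_weight r i k) = (\<Sum>i = 1..r. (if k \<le> i then 1 else 0)) - (\<Sum>i = 1..r. real i) / (real r + 1)"
    using assms by (simp add: fund_weight_def sum_subtractf sum_divide_distrib)
  also have "(\<Sum>i = 1..r. if k \<le> i then 1 else 0) = real (card {k..r})"
  proof -
    have "{i \<in> {1..r}. k \<le> i} = {k..r}" using assms by auto
    then show ?thesis by (simp add: sum.If_cases Int_def)
  qed
  also have "(\<Sum>i = 1..r. real i) = (real r + 1) * (real r / 2)"
    by (induction r) (auto simp: field_simps)
  also have "(real r + 1) * (real r / 2) / (real r + 1) = real r / 2"
    by (rule nonzero_mult_div_cancel_left) linarith
  finally show ?thesis using assms by (simp add: two_rho_def of_nat_diff)
qed

lemma wform_two_rho: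
  "wform r \<mu> (two_rho r) = (\<Sum>i = 1..r. real i * (real r + 1 - real i) * wform r (simple_root i) \<mu>)"
proof -
  have "(\<Sum>k = 1..n+1. \<mu> k * (real r + 2 - 2 * real k)) =
    (\<Sum>i = 1..n. real i * (real r + 1 - real i) * (\<mu> i - \<mu> (i + 1))) +
    real (n + 1) * (real r - real n) * \<mu> (n + 1)" for n
    by (induction n) (simp_all add: algebra_simps)
  from this[of r] have "(\<Sum>k = 1..r+1. \<mu> k * (real r + 2 - 2 * real k)) =
    (\<Sum>i = 1..r. real i * (real r + 1 - real i) * (\<mu> i - \<mu> (i + 1)))" by simp
  moreover have "wform r \<mu> (two_rho r) = (\<Sum>k = 1..r+1. \<mu> k * (real r + 2 - 2 * real k))"
    unfolding wform_def by (rule sum.cong) (auto simp: two_rho_eq)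
  ultimately show ?thesis by (simp add: wform_simple_root)
qed

lemma sum_initial_if:
  fixes s n :: nat
  assumes "s \<le> n"
  shows "(\<Sum>k = 1..n. if k \<le> s then g k else (0::real)) = (\<Sum>k = 1..s. g k)"
  by (rule sum.mono_neutral_cong_right) (use assms in auto)

lemma sum_fund_weight: "s \<in> {1..r} \<Longrightarrow> (\<Sum>k = 1..r+1. fund_weight r s k) = 0"
proof -
  assume s: "s \<in> {1..r}"
  have "(\<Sum>k = 1..r+1. fund_weight r s k) = (\<Sum>k = 1..r+1. (if k \<le> s then 1 else 0) - real s / (real r + 1))"
    by (rule sum.cong) (auto simp: fund_weight_def)
  also have "\<dots> = (\<Sum>k = 1..r+1. (if k \<le> s then 1 else 0)) - (real r + 1) * (real s / (real r + 1))"
    by (simp only: sum_subtractf sum_constant) (simp add: add.commute)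
  also have "(real r + 1) * (real s / (real r + 1)) = real s" by simp
  also have "(\<Sum>k = 1..r+1. if k \<le> s then 1 else 0) = real (card {1..s})"
    using s sum_initial_if[of s "r + 1" "\<lambda>_. 1"] by simp
  finally show ?thesis by simp
qed

lemma wform_fund:
  assumes "s \<in> {1..r}" "s' \<in> {1..r}"
  shows "wform r (fund_weight r s) (fund_weight r s') = (\<Sum>k = 1..s'. fund_weight r s k)"
proof -
  have "wform r (fund_weight r s) (fund_weight r s') =
    (\<Sum>k = 1..r+1. (if k \<le> s' then fund_weight r s k else 0) - fund_weight r s k * (real s' / (real r + 1)))"
    unfolding wform_def by (rule sum.cong) (auto simp: fund_weight_def algebra_simps)
  also have "\<dots> = (\<Sum>k = 1..r+1. (if k \<le> s' then fund_weight r s k else 0))"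
    using sum_fund_weight[OF assms(1)] by (simp only: sum_subtractf flip: sum_distrib_right)
  also have "\<dots> = (\<Sum>k = 1..s'. fund_weight r s k)"
    using assms by (intro sum_initial_if) simp
  finally show ?thesis .
qed

lemma w0_fund:
  assumes "s \<in> {1..r}" "k \<in> {1..r+1}"
  shows "w0 r (fund_weight r s) k = - fund_weight r (r + 1 - s) k"
proof -
  have "r + 2 - k \<le> s \<longleftrightarrow> \<not> k \<le> r + 1 - s" using assms by auto
  moreover have "real (r + 1 - s) / (real r + 1) = 1 - real s / (real r + 1)"
    using assms by (simp add: of_nat_diff diff_divide_distrib)
  moreover have "r + 2 - k \<in> {1..r+1}" using assms by auto
  ultimately show ?thesis using assms by (simp add: w0_def fund_weight_def)
qed

lemma wform_w0_fund:
  assumes "s \<in> {1..r}"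
  shows "wform r \<nu> (w0 r (fund_weight r s)) = - wform r \<nu> (fund_weight r (r + 1 - s))"
  unfolding wform_def sum_negf[symmetric]
  by (rule sum.cong) (use assms in \<open>auto simp: w0_fund\<close>)

text \<open>Up to sign, the second form is the exponent of the braiding of \<open>V\<close> with itself, as \<open>w\<^sub>0\<close> sends the
  fundamental weight of index \<open>s\<close> to minus that of index \<open>r + 1 - s\<close>.\<close>

lemma minuscule_forms:
  assumes "1 \<le> r" "s \<in> {1, r}"
  shows "wform r (fund_weight r s) (fund_weight r s) = real r / (real r + 1)"
    "wform r (fund_weight r s) (fund_weight r (r + 1 - s)) = 1 / (real r + 1)"
proof -
  have 1: "(\<Sum>k = 1..1. fund_weight r t k) = fund_weight r t 1" for t by simp
  have 2: "(\<Sum>k = 1..r. fund_weight r t k) = - fund_weight r t (r + 1)" if "t \<in> {1..r}" for t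
    using sum_fund_weight[OF that] by simp
  have 3: "fund_weight r t 1 = 1 - real t / (real r + 1)" "fund_weight r t (r + 1) = - real t / (real r + 1)"
    if "t \<in> {1..r}" for t using that by (auto simp: fund_weight_def)
  consider "s = 1" | "s = r" using assms(2) by auto
  then have "wform r (fund_weight r s) (fund_weight r s) = real r / (real r + 1) \<and>
    wform r (fund_weight r s) (fund_weight r (r + 1 - s)) = 1 / (real r + 1)"
  proof cases
    case 1
    then show ?thesis using assms(1) 2[of 1] 3[of 1] by (simp add: wform_fund field_simps)
  next
    case 2
    then show ?thesis using assms(1) \<open>\<And>t. t \<in> {1..r} \<Longrightarrow> (\<Sum>k = 1..r. fund_weight r t k) = - fund_weight r t (r + 1)\<close>[of r] 3[of r]
      by (simp add: wform_fund field_simps)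
  qed
  then show "wform r (fund_weight r s) (fund_weight r s) = real r / (real r + 1)"
    "wform r (fund_weight r s) (fund_weight r (r + 1 - s)) = 1 / (real r + 1)" by auto
qed

lemma const_values:
  assumes "1 \<le> r" "s \<in> {1, r}"
  shows "a_const r s = 2" "w_const r s = real r / (real r + 1)" "m_const r s = real r"
proof -
  have s: "s \<in> {1..r}" using assms by auto
  show "a_const r s = 2" using s by (simp add: a_const_def wform_simple_simple)
  show "w_const r s = real r / (real r + 1)" by (simp add: w_const_def minuscule_forms[OF assms])
  have "m_const r s = (\<Sum>i = 1..r. real i * (real r + 1 - real i) * (if i = s then 1 else 0))"
    unfolding m_const_def wform_two_rho by (rule sum.cong) (use s in \<open>auto simp: wform_simple_fund\<close>)
  also have "\<dots> = real s * (real r + 1 - real s)"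
    using s by (simp add: if_distrib cong: if_cong)
  finally show "m_const r s = real r" using assms by auto
qed

section \<open>Chain modules\<close>

definition unitm :: "'i \<Rightarrow> 'j \<Rightarrow> complex \<Rightarrow> complex ^ 'j ^ 'i" where
  "unitm i j c = (\<chi> a b. if a = i \<and> b = j then c else 0)"

definition diagm :: "('i \<Rightarrow> complex) \<Rightarrow> complex ^ 'i ^ 'i" where
  "diagm f = (\<chi> a b. if a = b then f a else 0)"

lemma unitm_mult: "unitm i j c ** unitm j' k d = (if j = j' then unitm i k (c * d) else 0)"
  for j :: "'j::finite"
proof -
  have "(\<Sum>x\<in>UNIV. (if a = i \<and> x = j then c else 0) * (if x = j' \<and> b = k then d else 0)) =
     (if j = j' \<and> a = i \<and> b = k then c * d else 0)" for a b
  proof -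
    have "(\<Sum>x\<in>UNIV. (if a = i \<and> x = j then c else 0) * (if x = j' \<and> b = k then d else 0)) =
      (\<Sum>x\<in>UNIV. if x = j then (if j = j' \<and> a = i \<and> b = k then c * d else 0) else 0)"
      by (rule sum.cong) auto
    then show ?thesis by simp
  qed
  then show ?thesis by (auto simp: matrix_matrix_mult_def unitm_def vec_eq_iff)
qed

lemma diagm_unitm: "diagm f ** unitm i j c = unitm i j (f i * c)" "unitm i j c ** diagm g = unitm i j (c * g j)"
  for i :: "'i::finite" and j :: "'j::finite"
  by (auto simp: matrix_matrix_mult_def unitm_def diagm_def vec_eq_iff if_distrib[where f = "\<lambda>x. x * _"] cong: if_cong)

lemma diagm_mult: "diagm f ** diagm g = diagm (\<lambda>i. f i * g i)" for f :: "'i::finite \<Rightarrow> _"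
  by (auto simp: matrix_matrix_mult_def diagm_def vec_eq_iff if_distrib[where f = "\<lambda>x. x * _"] cong: if_cong)

text \<open>The index of the simple root that takes the \<open>k\<close>-th basis vector of the chain to the next. For the dual of the vector
  representation, \<open>s = r\<close>, the order of the simple roots is reversed.\<close>

definition gidx :: "nat \<Rightarrow> nat \<Rightarrow> nat \<Rightarrow> nat" where
  "gidx r s k = (if s = 1 then k + 1 else r - k)"

definition kchar :: "complex \<Rightarrow> nat \<Rightarrow> nat \<Rightarrow> complex" where
  "kchar q l k = (if k = l then q else if k = l + 1 then 1 / q else 1)"

text \<open>The basis vector at position \<open>l a\<close> of the chain is \<open>axis a 1\<close>. The weights of the two modules in question are
  distinct, so any weight basis is of this form, with scalars \<open>x\<close> that depend on its normalisation.\<close>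

definition chain :: "nat \<Rightarrow> complex \<Rightarrow> nat \<Rightarrow> 'i::finite uq_rep \<Rightarrow> ('i \<Rightarrow> nat) \<Rightarrow> (nat \<Rightarrow> complex) \<Rightarrow> bool" where
  "chain r q s M l x \<longleftrightarrow> bij_betw l UNIV {0..r} \<and> (\<forall>k<r. x k \<noteq> 0 \<and>
     Eop M (gidx r s k) = unitm (inv l k) (inv l (k + 1)) (x k) \<and>
     Fop M (gidx r s k) = unitm (inv l (k + 1)) (inv l k) (1 / x k) \<and>
     Kop M (gidx r s k) = diagm (\<lambda>a. kchar q k (l a)) \<and>
     Kiop M (gidx r s k) = diagm (\<lambda>a. 1 / kchar q k (l a)))"

lemma gidx_bij: "s \<in> {1, r} \<Longrightarrow> bij_betw (gidx r s) {..<r} {1..r}"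
  by (rule bij_betwI[where g = "\<lambda>i. if s = 1 then i - 1 else r - i"]) (auto simp: gidx_def)

lemma gidx_cases:
  assumes "s \<in> {1, r}" "i \<in> {1..r}"
  obtains k where "k < r" "i = gidx r s k"
proof -
  have "i \<in> gidx r s ` {..<r}"
    using bij_betw_imp_surj_on[OF gidx_bij[OF assms(1)]] assms(2) by blast
  then show ?thesis using that by auto
qed

lemma gidx_props:
  assumes "s \<in> {1, r}" "k < r" "l < r"
  shows "gidx r s k \<in> {1..r}" "gidx r s k = gidx r s l \<longleftrightarrow> k = l"
    "gidx r s k = gidx r s l + 1 \<or> gidx r s l = gidx r s k + 1 \<longleftrightarrow> k = l + 1 \<or> l = k + 1"
    "gidx r s k = s \<longleftrightarrow> k = 0" "gidx r s k = r + 1 - s \<longleftrightarrow> k + 1 = r"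
  using assms by (auto simp: gidx_def)

lemma bijl:
  fixes l :: "'i \<Rightarrow> nat"
  assumes "bij_betw l UNIV {0..r}"
  shows "k \<le> r \<Longrightarrow> l (inv l k) = k" "inv l (l a) = a" "l a \<le> r"
    "k \<le> r \<Longrightarrow> j \<le> r \<Longrightarrow> inv l k = inv l j \<longleftrightarrow> k = j"
    "k \<le> r \<Longrightarrow> a = inv l k \<longleftrightarrow> l a = k" "k \<le> r \<Longrightarrow> inv l k = a \<longleftrightarrow> l a = k"
proof -
  have rl: "range l = {0..r}" and inj: "inj l" using assms by (simp_all add: bij_betw_def)
  have 1: "l (inv l k) = k" if "k \<le> r" for k
    by (rule f_inv_into_f) (simp add: rl that)
  have 2: "inv l (l a) = a" for a by (rule inv_f_f[OF inj])
  show "k \<le> r \<Longrightarrow> l (inv l k) = k" by (rule 1)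
  show "inv l (l a) = a" by (rule 2)
  show "l a \<le> r" using rangeI[of l a] by (simp add: rl)
  show "inv l k = inv l j \<longleftrightarrow> k = j" if "k \<le> r" "j \<le> r"
    by (metis 1 that)
  show "a = inv l k \<longleftrightarrow> l a = k" "inv l k = a \<longleftrightarrow> l a = k" if "k \<le> r"
    by (metis 1 2 that)+
qed

lemma unitm_scale: "c *\<^sub>C unitm i j d = unitm i j (c * d)"
  by (auto simp: unitm_def vec_eq_iff scaleC_vec_def scaleC_complex_def)

lemma diagm_scale_diff: "c *\<^sub>C (diagm f - diagm g) = diagm (\<lambda>a. c * (f a - g a))"
  by (auto simp: diagm_def vec_eq_iff scaleC_vec_def scaleC_complex_def)

lemma unitm_diff: "unitm A A 1 - unitm B B 1 = diagm (\<lambda>a. (if a = A then 1 else 0) - (if a = B then 1 else 0))"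
  by (auto simp: diagm_def unitm_def vec_eq_iff)

lemma qpow_values:
  assumes "0 < q"
  shows "qpow q 1 = of_real q" "qpow q (- 1) = 1 / of_real q" "qpow q 2 = (of_real q)\<^sup>2" "qpow q (- 2) = 1 / (of_real q)\<^sup>2"
    "qpow q 0 = 1" "qpow q (x + y) = qpow q x * qpow q y" "qpow q (- x) = 1 / qpow q x" "qpow q x \<noteq> 0"
proof -
  show "qpow q 1 = of_real q" "qpow q 2 = (of_real q)\<^sup>2" "qpow q 0 = 1"
    using assms by (simp_all add: qpow_def powr_numeral)
  show m: "qpow q (- x) = 1 / qpow q x" for x by (simp add: qpow_def powr_minus_divide)
  show "qpow q (x + y) = qpow q x * qpow q y" "qpow q x \<noteq> 0"
    using assms by (simp_all add: qpow_def powr_add)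
  show "qpow q (- 1) = 1 / of_real q" "qpow q (- 2) = 1 / (of_real q)\<^sup>2"
    using assms by (simp_all only: m) (simp_all add: qpow_def powr_numeral)
qed

lemma unitm_vec: "unitm i j c *v x = (x $ j * c) *\<^sub>C axis i 1" for j :: "'j::finite" and i :: "'i::finite"
proof -
  have "(\<Sum>b\<in>UNIV. (if a = i \<and> b = j then c else 0) * x $ b) = (if a = i then c * x $ j else 0)" for a
  proof -
    have "(\<Sum>b\<in>UNIV. (if a = i \<and> b = j then c else 0) * x $ b) =
       (\<Sum>b\<in>UNIV. if b = j then (if a = i then c * x $ b else 0) else 0)"
      by (rule sum.cong) auto
    then show ?thesis by simp
  qed
  then show ?thesis
    by (simp add: vec_eq_iff unitm_def matrix_vector_mult_def scaleC_vec_def scaleC_complex_def axis_def)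
qed

lemma diagm_vec: "diagm f *v x = (\<chi> a. f a * x $ a)" for f :: "'i::finite \<Rightarrow> _"
  by (simp add: vec_eq_iff diagm_def matrix_vector_mult_def if_distrib[where f = "\<lambda>x. x * _"] cong: if_cong)

lemma vec_scaleC_nth [simp]: "(c *\<^sub>C x) $ a = c *\<^sub>C (x $ a)"
  by (simp add: scaleC_vec_def)

lemma vec_expand: "(x :: complex ^ 'i::finite) = (\<Sum>i\<in>UNIV. x $ i *\<^sub>C axis i 1)"
  by (simp add: vec_eq_iff scaleC_complex_def axis_def if_distrib cong: if_cong)

locale chain_rep =
  fixes r s :: nat and q :: real and M :: "'i::finite uq_rep" and l :: "'i \<Rightarrow> nat" and x :: "nat \<Rightarrow> complex"
  assumes r: "1 \<le> r" and s: "s \<in> {1, r}" and q: "0 < q" "q < 1"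
    and ch: "chain r (of_real q) s M l x"
begin

abbreviation "qc \<equiv> complex_of_real q"
abbreviation "v k \<equiv> axis (inv l k) (1::complex)"

lemma q0: "qc \<noteq> 0" and q2: "qc\<^sup>2 \<noteq> 1" "qc \<noteq> 1"
proof -
  show "qc \<noteq> 0" "qc \<noteq> 1" using q by auto
  have "q\<^sup>2 < 1" using q by (simp add: power_less_one_iff)
  then show "qc\<^sup>2 \<noteq> 1" by (metis of_real_eq_1_iff of_real_power less_irrefl)
qed

lemma l: "bij_betw l UNIV {0..r}" using ch by (simp add: chain_def)
lemmas bl = bijl[OF l]

lemma mats: assumes "k < r"
  shows "x k \<noteq> 0" "Eop M (gidx r s k) = unitm (inv l k) (inv l (k + 1)) (x k)"
    "Fop M (gidx r s k) = unitm (inv l (k + 1)) (inv l k) (1 / x k)"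
    "Kop M (gidx r s k) = diagm (\<lambda>a. kchar qc k (l a))"
    "Kiop M (gidx r s k) = diagm (\<lambda>a. 1 / kchar qc k (l a))"
  using ch assms by (auto simp: chain_def)

lemma kchar0: "kchar qc i j \<noteq> 0" using q0 by (auto simp: kchar_def)

lemma s_range: "s \<in> {1..r}" "r + 1 - s \<in> {1..r}" "r + 1 - s \<in> {1, r}" using r s by auto

lemma E_v: "k < r \<Longrightarrow> j \<le> r \<Longrightarrow> Eop M (gidx r s k) *v v j = (if j = k + 1 then x k *\<^sub>C v k else 0)"
  by (auto simp: mats unitm_vec bl axis_def)
lemma F_v: "k < r \<Longrightarrow> j \<le> r \<Longrightarrow> Fop M (gidx r s k) *v v j = (if j = k then (1 / x k) *\<^sub>C v (k + 1) else 0)"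
  by (auto simp: mats unitm_vec bl axis_def)
lemma K_v: "k < r \<Longrightarrow> j \<le> r \<Longrightarrow> Kop M (gidx r s k) *v v j = kchar qc k j *\<^sub>C v j"
  "k < r \<Longrightarrow> j \<le> r \<Longrightarrow> Kiop M (gidx r s k) *v v j = (1 / kchar qc k j) *\<^sub>C v j"
  by (auto simp: mats diagm_vec bl axis_def vec_eq_iff scaleC_complex_def)

lemma mats_comm:
  assumes k: "k < r" and m: "m < r"
  shows "Kop M (gidx r s k) ** Eop M (gidx r s m) ** Kiop M (gidx r s k) =
      qpow q (if k = m then 2 else if k = m + 1 \<or> m = k + 1 then - 1 else 0) *\<^sub>C Eop M (gidx r s m)"
    "Kop M (gidx r s k) ** Fop M (gidx r s m) ** Kiop M (gidx r s k) =
      qpow q (- (if k = m then 2 else if k = m + 1 \<or> m = k + 1 then - 1 else 0)) *\<^sub>C Fop M (gidx r s m)"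
proof -
  have e: "kchar qc k m * (1 / kchar qc k (m + 1)) = qpow q (if k = m then 2 else if k = m + 1 \<or> m = k + 1 then - 1 else 0)"
    "kchar qc k (m + 1) * (1 / kchar qc k m) = qpow q (- (if k = m then 2 else if k = m + 1 \<or> m = k + 1 then - 1 else 0))"
    using q0 qpow_values[OF q(1)] by (auto simp: kchar_def power2_eq_square)
  have m': "m \<le> r" "m + 1 \<le> r" using m by auto
  show "Kop M (gidx r s k) ** Eop M (gidx r s m) ** Kiop M (gidx r s k) =
      qpow q (if k = m then 2 else if k = m + 1 \<or> m = k + 1 then - 1 else 0) *\<^sub>C Eop M (gidx r s m)"
    unfolding mats[OF k] mats[OF m] diagm_unitm unitm_scale bl(1)[OF m'(1)] bl(1)[OF m'(2)] e(1)[symmetric] by (simp add: mult_ac)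
  show "Kop M (gidx r s k) ** Fop M (gidx r s m) ** Kiop M (gidx r s k) =
      qpow q (- (if k = m then 2 else if k = m + 1 \<or> m = k + 1 then - 1 else 0)) *\<^sub>C Fop M (gidx r s m)"
    unfolding mats[OF k] mats[OF m] diagm_unitm unitm_scale bl(1)[OF m'(1)] bl(1)[OF m'(2)] e(2)[symmetric] by (simp add: mult_ac)
qed

lemma mats_EF:
  assumes k: "k < r" and m: "m < r"
  shows "Eop M (gidx r s k) ** Fop M (gidx r s m) - Fop M (gidx r s m) ** Eop M (gidx r s k) =
    (if k = m then (1 / (qpow q 1 - qpow q (- 1))) *\<^sub>C (Kop M (gidx r s k) - Kiop M (gidx r s k)) else 0)"
proof (cases "k = m")
  case True
  have ne: "qc - 1 / qc \<noteq> 0" using q0 q2 by (simp add: field_simps power2_eq_square)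
  have d: "(qc - 1 / qc) / (qc - 1 / qc) = 1" "(1 / qc - qc) / (qc - 1 / qc) = - 1"
    using ne by (auto simp: divide_eq_eq)
  have e: "(if a = inv l k then 1 else 0) - (if a = inv l (k + 1) then 1 else 0) =
      (1 / (qc - 1 / qc)) * (kchar qc k (l a) - 1 / kchar qc k (l a))" for a
    using bl(5)[of k a] bl(5)[of "k + 1" a] k d by (auto simp: kchar_def)
  have "unitm (inv l k) (inv l k) 1 - unitm (inv l (k + 1)) (inv l (k + 1)) 1 =
     (1 / (qc - 1 / qc)) *\<^sub>C (diagm (\<lambda>a. kchar qc k (l a)) - diagm (\<lambda>a. 1 / kchar qc k (l a)))"
    unfolding unitm_diff diagm_scale_diff by (simp only: e)
  then show ?thesis
    using True mats[OF m] by (simp add: unitm_mult qpow_values[OF q(1)])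
next
  case False
  then show ?thesis using bl(4)[of "k+1" "m+1"] bl(4)[of k m] k m by (simp add: mats unitm_mult)
qed

text \<open>For neighbouring roots in a chain the square of an operator and the product \<open>X Y X\<close> vanish, and with them all three terms
  of the Serre relation.\<close>

lemma serre_nilpotent:
  assumes "X ** X = 0" "X ** Y ** X = 0"
  shows "serre q X Y"
proof -
  have "Y ** X ** X = 0" using assms(1) by (simp add: matrix_mul_assoc[symmetric])
  then show ?thesis using assms by (simp add: serre_def)
qed

lemma mats_serre:
  assumes k: "k < r" and m: "m < r" and km: "k = m + 1 \<or> m = k + 1"
  shows "serre q (Eop M (gidx r s k)) (Eop M (gidx r s m))" "serre q (Fop M (gidx r s k)) (Fop M (gidx r s m))"
  by (rule serre_nilpotent; use bl(4) k m km in \<open>auto simp: mats unitm_mult\<close>)+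

lemma mats_far:
  assumes k: "k < r" and m: "m < r" and km: "\<not> (k = m + 1 \<or> m = k + 1)"
  shows "Eop M (gidx r s k) ** Eop M (gidx r s m) = Eop M (gidx r s m) ** Eop M (gidx r s k)"
    "Fop M (gidx r s k) ** Fop M (gidx r s m) = Fop M (gidx r s m) ** Fop M (gidx r s k)"
  using bl(4)[of "k + 1" m] bl(4)[of "m + 1" k] k m km by (auto simp: mats unitm_mult)

lemma mats_K:
  assumes k: "k < r" and m: "m < r"
  shows "Kop M (gidx r s k) ** Kop M (gidx r s m) = Kop M (gidx r s m) ** Kop M (gidx r s k)"
    "Kop M (gidx r s k) ** Kiop M (gidx r s k) = mat 1" "Kiop M (gidx r s k) ** Kop M (gidx r s k) = mat 1"
proof -
  have one: "diagm (\<lambda>a::'i. 1) = mat 1" by (auto simp: diagm_def mat_def vec_eq_iff)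
  show "Kop M (gidx r s k) ** Kop M (gidx r s m) = Kop M (gidx r s m) ** Kop M (gidx r s k)"
    "Kop M (gidx r s k) ** Kiop M (gidx r s k) = mat 1" "Kiop M (gidx r s k) ** Kop M (gidx r s k) = mat 1"
    using k m by (simp_all add: mats diagm_mult mult.commute kchar0 one)
qed

lemma is_module: "is_uq_module r q M"
  unfolding is_uq_module_def
proof (intro conjI ballI)
  fix i assume "i \<in> {1..r}"
  then obtain k where k: "k < r" "i = gidx r s k" using gidx_cases[OF s] by blast
  show "Kop M i ** Kiop M i = mat 1" "Kiop M i ** Kop M i = mat 1"
    unfolding k(2) by (rule mats_K[OF k(1) k(1)])+
  fix j assume "j \<in> {1..r}"
  then obtain m where m: "m < r" "j = gidx r s m" using gidx_cases[OF s] by blast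
  note gp = gidx_props[OF s k(1) m(1)]
  have w: "wform r (simple_root i) (simple_root j) = (if k = m then 2 else if k = m + 1 \<or> m = k + 1 then - 1 else 0)"
    using wform_simple_simple[OF gp(1) gidx_props(1)[OF s m(1) m(1)]] gp by (simp add: k m)
  show "Kop M i ** Kop M j = Kop M j ** Kop M i" unfolding k(2) m(2) by (rule mats_K[OF k(1) m(1)])
  show "Kop M i ** Eop M j ** Kiop M i = qpow q (wform r (simple_root i) (simple_root j)) *\<^sub>C Eop M j"
    "Kop M i ** Fop M j ** Kiop M i = qpow q (- wform r (simple_root i) (simple_root j)) *\<^sub>C Fop M j"
    unfolding w unfolding k(2) m(2) by (rule mats_comm[OF k(1) m(1)])+
  show "Eop M i ** Fop M j - Fop M j ** Eop M i
          = (if i = j then (1 / (qpow q 1 - qpow q (- 1))) *\<^sub>C (Kop M i - Kiop M i) else 0)"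
    unfolding k(2) m(2) gp(2) by (rule mats_EF[OF k(1) m(1)])
  show "i = j + 1 \<or> j = i + 1 \<longrightarrow> serre q (Eop M i) (Eop M j) \<and> serre q (Fop M i) (Fop M j)"
    unfolding k(2) m(2) gp(3) using mats_serre[OF k(1) m(1)] by blast
  show "i > j + 1 \<or> j > i + 1 \<longrightarrow>
          Eop M i ** Eop M j = Eop M j ** Eop M i \<and> Fop M i ** Fop M j = Fop M j ** Fop M i"
  proof
    assume "i > j + 1 \<or> j > i + 1"
    then have "\<not> (i = j + 1 \<or> j = i + 1)" by linarith
    then have "\<not> (k = m + 1 \<or> m = k + 1)" using gp(3) unfolding k(2) m(2) by simp
    from mats_far[OF k(1) m(1) this]
    show "Eop M i ** Eop M j = Eop M j ** Eop M i \<and> Fop M i ** Fop M j = Fop M j ** Fop M i"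
      unfolding k(2) m(2) by (rule conjI)
  qed
qed

lemma span_v:
  assumes "complex_space.subspace U" "\<And>k. k \<le> r \<Longrightarrow> v k \<in> U"
  shows "U = UNIV"
proof -
  have "y \<in> U" for y
  proof -
    have "axis i 1 \<in> U" for i using assms(2)[of "l i"] bl by simp
    then have "(\<Sum>i\<in>UNIV. y $ i *\<^sub>C axis i 1) \<in> U"
      by (intro complex_space.subspace_sum complex_space.subspace_scale assms(1)) auto
    then show ?thesis using vec_expand[of y] by simp
  qed
  then show ?thesis by auto
qed

text \<open>The raising and lowering operators are matrix units, so a single one of them extracts a basis vector
  from a nonzero vector of a submodule; from there they reach the whole basis.\<close>

lemma is_simple: "simple_uq_module r q M"
  unfolding simple_uq_module_def
proof (intro conjI allI impI)
  show "is_uq_module r q M" by (rule is_module)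
  fix U :: "(complex ^ 'i) set"
  assume "complex_space.subspace U \<and> (\<forall>i\<in>{1..r}. \<forall>v\<in>U. Kop M i *v v \<in> U \<and> Kiop M i *v v \<in> U \<and> Eop M i *v v \<in> U \<and> Fop M i *v v \<in> U)"
  then have U: "complex_space.subspace U"
    and EU: "k < r \<Longrightarrow> y \<in> U \<Longrightarrow> Eop M (gidx r s k) *v y \<in> U"
    and FU: "k < r \<Longrightarrow> y \<in> U \<Longrightarrow> Fop M (gidx r s k) *v y \<in> U" for k y
    using gidx_props(1)[OF s] by auto
  have sc: "y \<in> U" if "c *\<^sub>C y \<in> U" "c \<noteq> 0" for c y
    using complex_space.subspace_scale[OF U that(1), of "1 / c"] that(2) by (simp add: scaleC_scaleC)
  show "U = {0} \<or> U = UNIV"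
  proof (cases "U = {0}")
    case False
    then obtain y where y: "y \<in> U" "y \<noteq> 0"
      using complex_space.subspace_0[OF U] by auto
    then obtain a where a: "y $ a \<noteq> 0" by (auto simp: vec_eq_iff)
    define j where "j = l a"
    have j: "j \<le> r" "y $ inv l j \<noteq> 0" using a bl(2,3)[of a] by (simp_all add: j_def)
    have up: "v (k + 1) \<in> U" if "k < r" "v k \<in> U" for k
      using FU[OF that] F_v[OF that(1), of k] that(1) mats(1)[OF that(1)] sc[of "1 / x k"] by simp
    have down: "v k \<in> U" if "k < r" "v (k + 1) \<in> U" for k
      using EU[OF that] E_v[OF that(1), of "k + 1"] that(1) mats(1)[OF that(1)] sc[of "x k"] by simp
    have "v j \<in> U"
    proof (cases "j < r")
      case True
      have "Fop M (gidx r s j) *v y \<in> U" using FU[OF True y(1)] .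
      then have "v (j + 1) \<in> U" using True j mats[OF True] sc[of "y $ inv l j * (1 / x j)"] by (simp add: unitm_vec)
      then show ?thesis using down[OF True] by simp
    next
      case False
      then have jr: "j = (r - 1) + 1" "r - 1 < r" using j r by auto
      have "Eop M (gidx r s (r - 1)) *v y \<in> U" using EU[OF jr(2) y(1)] .
      then have "v (r - 1) \<in> U" using j mats[OF jr(2)] sc[of "y $ inv l j * x (r - 1)"] jr by (simp add: unitm_vec)
      then show ?thesis using up[OF jr(2)] jr by simp
    qed
    have "v (j + d) \<in> U" if "j + d \<le> r" for d
      using that by (induction d) (use \<open>v j \<in> U\<close> up in auto)
    note up_all = this
    have down_all: "v (j - d) \<in> U" for d
    proof (induction d)
      case (Suc d)
      show ?case
      proof (cases "d < j")
        case True
        then have "j - d = (j - Suc d) + 1" "j - Suc d < r" using j(1) by auto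
        then show ?thesis using down Suc by metis
      qed (use Suc in auto)
    qed (use \<open>v j \<in> U\<close> in auto)
    have "v k \<in> U" if "k \<le> r" for k
      using up_all[of "k - j"] down_all[of "j - k"] that by (cases "j \<le> k") simp_all
    then show ?thesis using span_v[OF U] by auto
  qed auto
qed

lemma kchar_exponent: "kchar qc k j = qpow q ((if j = k then 1 else 0) - (if j = k + 1 then 1 else 0))"
  using qpow_values[OF q(1)] by (auto simp: kchar_def)

lemma weight_v:
  assumes "j \<le> r" "\<And>k. k < r \<Longrightarrow> wform r (simple_root (gidx r s k)) \<mu> = (if j = k then 1 else 0) - (if j = k + 1 then 1 else 0)"
  shows "weight_vector r q M \<mu> (v j)"
  unfolding weight_vector_def
proof (intro conjI ballI)
  show "v j \<noteq> 0" by (simp add: axis_eq_0_iff)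
  fix i assume i: "i \<in> {1..r}"
  obtain k where "k < r" "i = gidx r s k" using gidx_cases[OF s i] .
  then show "Kop M i *v v j = qpow q (wform r (simple_root i) \<mu>) *\<^sub>C v j"
    using assms K_v(1) kchar_exponent by simp
qed

lemma hw: "highest_weight_vector r q M (fund_weight r s) (v 0)"
  unfolding highest_weight_vector_def
proof (intro conjI ballI)
  show "weight_vector r q M (fund_weight r s) (v 0)"
    by (rule weight_v) (use gidx_props[OF s] s_range in \<open>auto simp: wform_simple_fund\<close>)
  fix i assume i: "i \<in> {1..r}"
  obtain k where "k < r" "i = gidx r s k" using gidx_cases[OF s i] .
  then show "Eop M i *v v 0 = 0" using E_v[of k 0] by simp
qed

lemma lw: "lowest_weight_vector r q M (w0 r (fund_weight r s)) (v r)"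
  unfolding lowest_weight_vector_def
proof (intro conjI ballI)
  show "weight_vector r q M (w0 r (fund_weight r s)) (v r)"
    by (rule weight_v) (use gidx_props[OF s] s_range in \<open>auto simp: wform_simple_fund wform_w0_fund\<close>)
  fix i assume i: "i \<in> {1..r}"
  obtain k where "k < r" "i = gidx r s k" using gidx_cases[OF s i] .
  then show "Fop M i *v v r = 0" using F_v[of k r] by simp
qed

lemma isV: "is_V r q M (fund_weight r s)"
  unfolding is_V_def using is_simple hw fund_weight_lattice s_range by blast

text \<open>A vector killed by all raising operators is a multiple of the first basis vector; the
  eigenvalues of the \<open>K\<^sub>i\<close> on it determine its weight.\<close>

lemma hw_unique:
  assumes "highest_weight_vector r q M \<mu> y" "\<mu> \<in> weight_lattice r"
  shows "\<mu> = fund_weight r s" "\<exists>c. y = c *\<^sub>C v 0"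
proof -
  have E: "Eop M i *v y = 0" and K: "Kop M i *v y = qpow q (wform r (simple_root i) \<mu>) *\<^sub>C y" if "i \<in> {1..r}" for i
    using assms that by (auto simp: highest_weight_vector_def weight_vector_def)
  have y0: "y \<noteq> 0" using assms by (auto simp: highest_weight_vector_def weight_vector_def)
  have z: "y $ inv l (k + 1) = 0" if "k < r" for k
    using E[OF gidx_props(1)[OF s that that]] mats[OF that]
    by (simp add: unitm_vec axis_eq_0_iff)
  have y: "y = (y $ inv l 0) *\<^sub>C v 0"
  proof -
    have ya: "y $ a = (if l a = 0 then y $ inv l 0 else 0)" for a
    proof (cases "l a = 0")
      case True
      then have "inv l 0 = a" using bl(2)[of a] by simp
      with True show ?thesis by simp
    next
      case False
      then have "l a - 1 < r" "l a - 1 + 1 = l a" using bl(3)[of a] by auto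
      then have "y $ inv l (l a) = 0" using z[of "l a - 1"] by simp
      with False show ?thesis by (simp add: bl(2))
    qed
    have "y $ a = ((y $ inv l 0) *\<^sub>C v 0) $ a" for a
      unfolding ya[of a] using bl(5)[of 0 a] by (simp add: axis_def scaleC_complex_def)
    then show ?thesis unfolding vec_eq_iff by blast
  qed
  show "\<exists>c. y = c *\<^sub>C v 0" by (rule exI) (rule y)
  have c: "y $ inv l 0 \<noteq> 0"
  proof
    assume "y $ inv l 0 = 0"
    then have "y = 0" by (subst y) simp
    with y0 show False by simp
  qed
  show "\<mu> = fund_weight r s"
  proof (rule lattice_eqI[OF assms(2)])
    show "fund_weight r s \<in> weight_lattice r" using fund_weight_lattice s_range by blast
    fix i assume i: "i \<in> {1..r}"
    obtain k where k: "k < r" "i = gidx r s k" using gidx_cases[OF s i] .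
    have "(Kop M i *v y) $ inv l 0 = kchar qc k 0 * y $ inv l 0"
      by (simp add: k mats diagm_vec bl)
    then have "kchar qc k 0 = qpow q (wform r (simple_root i) \<mu>)"
      using K[OF i] c by (simp add: scaleC_complex_def)
    then have "q powr (if k = 0 then 1 else 0) = q powr (wform r (simple_root i) \<mu>)"
      by (auto simp: kchar_exponent qpow_def split: if_splits)
    then have "(if k = 0 then 1 else 0) = wform r (simple_root i) \<mu>"
      using q by (simp add: powr_inj del: powr_zero_eq_one split del: if_split)
    then show "wform r (simple_root i) \<mu> = wform r (simple_root i) (fund_weight r s)"
      using gidx_props[OF s k(1) k(1)] s_range i by (simp add: wform_simple_fund k)
  qed
qed

lemma lw_unique:
  assumes "lowest_weight_vector r q M \<mu> y"
  shows "\<exists>c. y = c *\<^sub>C v r"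
proof -
  have F: "Fop M i *v y = 0" if "i \<in> {1..r}" for i
    using assms that by (auto simp: lowest_weight_vector_def)
  have z: "y $ inv l k = 0" if "k < r" for k
    using F[OF gidx_props(1)[OF s that that]] mats[OF that]
    by (simp add: unitm_vec axis_eq_0_iff)
  have ya: "y $ a = (if l a = r then y $ inv l r else 0)" for a
  proof (cases "l a = r")
    case True
    then have "inv l r = a" using bl(2)[of a] by simp
    with True show ?thesis by simp
  next
    case False
    then have "y $ inv l (l a) = 0" using z bl(3)[of a] by simp
    with False show ?thesis by (simp add: bl(2))
  qed
  have "y $ a = ((y $ inv l r) *\<^sub>C v r) $ a" for a
    unfolding ya[of a] using bl(5)[of r a] by (simp add: axis_def scaleC_complex_def)
  then have "y = (y $ inv l r) *\<^sub>C v r" unfolding vec_eq_iff by blast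
  then show ?thesis by (rule exI)
qed

lemma isV_unique: "is_V r q M \<mu> \<Longrightarrow> \<mu> = fund_weight r s"
  using hw_unique(1) unfolding is_V_def by blast

end

lemma transpose_unitm: "transpose (unitm i j c) = unitm j i c"
  by (auto simp: transpose_def unitm_def vec_eq_iff)
lemma transpose_diagm: "transpose (diagm f) = diagm f"
  by (auto simp: transpose_def diagm_def vec_eq_iff)
lemma unitm_uminus: "- unitm i j c = unitm i j (- c)"
  by (auto simp: unitm_def vec_eq_iff)

context chain_rep begin

text \<open>Dualising reverses the chain. The antipode contributes a sign and a power of \<open>q\<close> to the
  scalars.\<close>

lemma dual_chain: "chain r qc (r + 1 - s) (dual_rep M) (\<lambda>a. r - l a) (\<lambda>k. - (x (r - 1 - k) * qc))"
  unfolding chain_def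
proof (intro conjI allI impI)
  have rf: "bij_betw (\<lambda>k. r - k) {0..r} {0..r}" by (rule bij_betw_byWitness[where f' = "\<lambda>k. r - k"]) auto
  show bij: "bij_betw (\<lambda>a. r - l a) UNIV {0..r}"
    using bij_betw_trans[OF l rf] by (simp add: comp_def)
  fix k assume k: "k < r"
  define m where "m = r - 1 - k"
  have m: "m < r" "m \<le> r" "m + 1 \<le> r" and mk: "r - k = m + 1" "r - (k + 1) = m" using k by (auto simp: m_def)
  have g: "gidx r (r + 1 - s) k = gidx r s m"
    using s k by (auto simp: gidx_def m_def)
  have i: "inv (\<lambda>a. r - l a) j = inv l (r - j)" if "j \<le> r" for j
  proof -
    have "(\<lambda>a. r - l a) (inv l (r - j)) = j" using bl(1)[of "r - j"] that by simp
    then show ?thesis using inv_f_f[of "\<lambda>a. r - l a" "inv l (r - j)"] bij by (simp add: bij_betw_def)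
  qed
  have i1: "inv (\<lambda>a. r - l a) k = inv l (m + 1)" "inv (\<lambda>a. r - l a) (k + 1) = inv l m"
    using i[of k] i[of "k + 1"] k unfolding mk by auto
  note mm = mats[OF m(1)]
  have lm: "l (inv l m) = m" "l (inv l (Suc m)) = Suc m" using bl(1)[of m] bl(1)[of "Suc m"] m by simp_all
  have kc: "kchar qc k (r - l a) = 1 / kchar qc m (l a)" for a
    using bl(3)[of a] k q0 by (auto simp: kchar_def m_def)
  show "- (x (r - 1 - k) * qc) \<noteq> 0" using mm(1) q0 by (simp add: m_def)
  show "Eop (dual_rep M) (gidx r (r + 1 - s) k) =
      unitm (inv (\<lambda>a. r - l a) k) (inv (\<lambda>a. r - l a) (k + 1)) (- (x (r - 1 - k) * qc))"
    unfolding g i1 m_def[symmetric]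
    by (simp add: dual_rep_def mm diagm_unitm unitm_uminus transpose_unitm lm)
       (simp add: kchar_def)
  show "Fop (dual_rep M) (gidx r (r + 1 - s) k) =
      unitm (inv (\<lambda>a. r - l a) (k + 1)) (inv (\<lambda>a. r - l a) k) (1 / - (x (r - 1 - k) * qc))"
    unfolding g i1 m_def[symmetric]
    by (simp add: dual_rep_def mm diagm_unitm unitm_uminus transpose_unitm lm)
       (simp add: kchar_def mult.commute)
  show "Kop (dual_rep M) (gidx r (r + 1 - s) k) = diagm (\<lambda>a. kchar qc k (r - l a))"
    unfolding g kc by (simp add: dual_rep_def mm transpose_diagm)
  show "Kiop (dual_rep M) (gidx r (r + 1 - s) k) = diagm (\<lambda>a. 1 / kchar qc k (r - l a))"
    unfolding g kc by (simp add: dual_rep_def mm transpose_diagm)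
qed

lemma dual_chain_rep: "chain_rep r (r + 1 - s) q (dual_rep M) (\<lambda>a. r - l a) (\<lambda>k. - (x (r - 1 - k) * qc))"
  using r s q dual_chain by unfold_locales auto

end

section \<open>Uniqueness of the braidings\<close>

lemma kron_mult_vec: "kron A B *v kron_vec x y = kron_vec (A *v x) (B *v y)"
proof -
  have "(\<Sum>u\<in>UNIV. A $ a $ fst u * B $ b $ snd u * (x $ fst u * y $ snd u)) =
      (\<Sum>i\<in>UNIV. A $ a $ i * x $ i) * (\<Sum>j\<in>UNIV. B $ b $ j * y $ j)" for a b
    by (simp add: sum_product sum.cartesian_product split_def mult_ac flip: UNIV_Times_UNIV)
  then show ?thesis by (simp add: vec_eq_iff kron_def kron_vec_def matrix_vector_mult_def)
qed

lemma kron_vec_lin: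
  "kron_vec (x + x') y = kron_vec x y + kron_vec x' y" "kron_vec x (y + y') = kron_vec x y + kron_vec x y'"
  "kron_vec (c *\<^sub>C x) y = c *\<^sub>C kron_vec x y" "kron_vec x (c *\<^sub>C y) = c *\<^sub>C kron_vec x y"
  "kron_vec 0 y = 0" "kron_vec x 0 = 0"
  by (auto simp: vec_eq_iff kron_vec_def scaleC_complex_def algebra_simps)

lemma matvec_scaleC: "A *v (c *\<^sub>C x) = c *\<^sub>C (A *v x)" for A :: "complex ^ 'n::finite ^ 'm"
  by (simp add: vec_eq_iff matrix_vector_mult_def scaleC_complex_def sum_distrib_left mult_ac)

lemma axis_pair: "axis (i, j) (1::complex) = kron_vec (axis i 1) (axis j 1)"
  by (auto simp: vec_eq_iff kron_vec_def axis_def)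

lemma tensor_E: "Eop (tensor_rep X Y) i *v kron_vec x y = kron_vec (Eop X i *v x) (Kop Y i *v y) + kron_vec x (Eop Y i *v y)"
  and tensor_F: "Fop (tensor_rep X Y) i *v kron_vec x y = kron_vec (Fop X i *v x) y + kron_vec (Kiop X i *v x) (Fop Y i *v y)"
  by (simp_all add: tensor_rep_def matrix_vector_mult_add_rdistrib kron_mult_vec)

lemma matrix_eq_axis:
  fixes A B :: "complex ^ 'n::finite ^ 'm"
  assumes "\<And>i. A *v axis i 1 = B *v axis i 1"
  shows "A = B"
proof -
  have "A $ a $ i = B $ a $ i" for a i
    using arg_cong[OF assms[of i], of "\<lambda>v. v $ a"]
    by (simp add: matrix_vector_mult_def axis_def if_distrib cong: if_cong)
  then show ?thesis by (simp add: vec_eq_iff)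
qed

locale chain_pair = X: chain_rep r sX q X lX xX + Y: chain_rep r sY q Y lY xY
  for r sX sY q and X :: "'i::finite uq_rep" and Y :: "'j::finite uq_rep" and lX xX lY xY
begin

text \<open>The vector \<open>v \<otimes> u\<close> with \<open>v\<close> of highest and \<open>u\<close> of lowest weight generates \<open>X \<otimes> Y\<close>. Raising operators
  kill \<open>v\<close>, so they move \<open>u\<close> up the chain and reach all \<open>v \<otimes> y\<close>. Lowering operators then move the first
  factor down, up to terms already reached. So the vectors on which two module maps agree are everything.\<close>

lemma module_map_unique:
  assumes R: "uq_module_map r (tensor_rep X Y) N R" and R': "uq_module_map r (tensor_rep X Y) N R'"
    and eq: "R *v kron_vec (X.v 0) (Y.v r) = R' *v kron_vec (X.v 0) (Y.v r)"
  shows "R = R'"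
proof -
  \<comment> \<open>the submodule on which the two maps agree; it is shown to be the whole space\<close>
  define U where "U = {y. R *v y = R' *v y}"
  have sc: "c *\<^sub>C y \<in> U \<Longrightarrow> c \<noteq> 0 \<Longrightarrow> y \<in> U" for c y
    by (simp add: U_def matvec_scaleC)
  have E: "Eop (tensor_rep X Y) i *v y \<in> U" and F: "Fop (tensor_rep X Y) i *v y \<in> U" if "y \<in> U" "i \<in> {1..r}" for y i
  proof -
    have i: "A *v (B *v y) \<in> U" if "R ** B = D ** R" "R' ** B = D ** R'" "A = mat 1" for A B D
    proof -
      have "R *v (B *v y) = D *v (R *v y)" "R' *v (B *v y) = D *v (R' *v y)"
        using that by (simp_all add: matrix_vector_mul_assoc)
      then show ?thesis using \<open>y \<in> U\<close> that(3) by (simp add: U_def)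
    qed
    show "Eop (tensor_rep X Y) i *v y \<in> U" "Fop (tensor_rep X Y) i *v y \<in> U"
      using i[OF _ _ refl] R R' that(2) unfolding uq_module_map_def by auto
  qed
  have diff: "y \<in> U \<Longrightarrow> y + y' \<in> U \<Longrightarrow> y' \<in> U" for y y'
    by (simp add: U_def matrix_vector_right_distrib)
  have 1: "kron_vec (X.v 0) (Y.v (r - d)) \<in> U" if "d \<le> r" for d
    using that
  proof (induction d)
    case 0
    then show ?case using eq by (simp add: U_def)
  next
    case (Suc d)
    define k where "k = r - Suc d"
    have k: "k < r" "r - d = k + 1" using Suc.prems by (auto simp: k_def)
    have g: "gidx r sY k \<in> {1..r}" using gidx_props(1)[OF Y.s k(1) k(1)] .
    obtain m where m: "m < r" "gidx r sY k = gidx r sX m" using gidx_cases[OF X.s g] .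
    have "Eop (tensor_rep X Y) (gidx r sY k) *v kron_vec (X.v 0) (Y.v (k + 1)) \<in> U"
      using E[OF _ g] Suc k by simp
    also have "Eop (tensor_rep X Y) (gidx r sY k) *v kron_vec (X.v 0) (Y.v (k + 1)) = xY k *\<^sub>C kron_vec (X.v 0) (Y.v k)"
      using Y.E_v[OF k(1), of "k + 1"] X.E_v[OF m(1), of 0] k
      by (simp add: tensor_E kron_vec_lin m(2)[symmetric])
    finally show ?case using sc Y.mats(1)[OF k(1)] by (simp add: k_def)
  qed
  have Uadd: "y \<in> U \<Longrightarrow> y' \<in> U \<Longrightarrow> y + y' \<in> U" and Usc: "y \<in> U \<Longrightarrow> c *\<^sub>C y \<in> U" and U0: "0 \<in> U" for y y' c
    by (simp_all add: U_def matrix_vector_right_distrib matvec_scaleC)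
  have sub: "{y. kron_vec z y \<in> U} = UNIV" if "\<And>j. j \<le> r \<Longrightarrow> kron_vec z (Y.v j) \<in> U" for z
  proof (rule Y.span_v)
    show "complex_space.subspace {y. kron_vec z y \<in> U}"
      unfolding complex_space.subspace_def using Uadd Usc U0 by (simp add: kron_vec_lin)
  qed (use that in simp)
  have 2: "kron_vec (X.v k) y \<in> U" if "k \<le> r" for k y
    using that
  proof (induction k arbitrary: y)
    case 0
    have "kron_vec (X.v 0) (Y.v j) \<in> U" if "j \<le> r" for j
      using 1[of "r - j"] that by simp
    then show ?case using sub[of "X.v 0"] by blast
  next
    case (Suc k)
    then have k: "k < r" by simp
    have g: "gidx r sX k \<in> {1..r}" using gidx_props(1)[OF X.s k k] .
    have "Fop (tensor_rep X Y) (gidx r sX k) *v kron_vec (X.v k) y \<in> U"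
      using F[OF _ g] Suc k by simp
    also have "Fop (tensor_rep X Y) (gidx r sX k) *v kron_vec (X.v k) y =
       (1 / kchar X.qc k k) *\<^sub>C kron_vec (X.v k) (Fop Y (gidx r sX k) *v y) + (1 / xX k) *\<^sub>C kron_vec (X.v (k + 1)) y"
      using X.F_v[OF k, of k] X.K_v(2)[OF k, of k] k by (simp add: tensor_F kron_vec_lin)
    finally have "(1 / xX k) *\<^sub>C kron_vec (X.v (k + 1)) y \<in> U"
      using diff Usc Suc.IH k by (meson less_imp_le_nat)
    then show ?case using sc X.mats(1)[OF k] by simp
  qed
  have "kron_vec (axis i 1) (axis j 1) \<in> U" for i j
    using 2[of "lX i" "axis j 1"] X.bl(2,3)[of i] by simp
  then have "R *v axis u 1 = R' *v axis u 1" for u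
    by (cases u) (simp add: axis_pair U_def)
  then show ?thesis by (rule matrix_eq_axis)
qed

text \<open>The definite description in \<open>braiding\<close> is resolved by exhibiting one module map with the right value on
  the generating vector. Highest and lowest weight vectors of the factors are unique up to scalars, so this value
  for one pair implies it for all.\<close>

lemma braiding_eqI:
  assumes R: "uq_module_map r (tensor_rep X Y) (tensor_rep Y X) R"
    and norm: "R *v kron_vec (X.v 0) (Y.v r) =
       qpow q (wform r (fund_weight r sX) (w0 r (fund_weight r sY))) *\<^sub>C kron_vec (Y.v r) (X.v 0)"
  shows "braiding r q X Y = R"
  unfolding braiding_def
proof (rule the_equality)
  show "uq_module_map r (tensor_rep X Y) (tensor_rep Y X) R \<and>
     (\<forall>\<nu> \<mu> v u. is_V r q X \<nu> \<and> is_V r q Y \<mu> \<and>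
        highest_weight_vector r q X \<nu> v \<and> lowest_weight_vector r q Y (w0 r \<mu>) u \<longrightarrow>
        R *v kron_vec v u = qpow q (wform r \<nu> (w0 r \<mu>)) *\<^sub>C kron_vec u v)"
  proof (intro conjI allI impI R)
    fix \<nu> \<mu> v u
    assume h: "is_V r q X \<nu> \<and> is_V r q Y \<mu> \<and> highest_weight_vector r q X \<nu> v \<and> lowest_weight_vector r q Y (w0 r \<mu>) u"
    have n: "\<nu> = fund_weight r sX" and m: "\<mu> = fund_weight r sY"
      using h X.isV_unique Y.isV_unique by auto
    obtain c where c: "v = c *\<^sub>C X.v 0"
      using X.hw_unique(2) h unfolding is_V_def by blast
    obtain d where d: "u = d *\<^sub>C Y.v r" using Y.lw_unique h by blast
    show "R *v kron_vec v u = qpow q (wform r \<nu> (w0 r \<mu>)) *\<^sub>C kron_vec u v"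
      unfolding n m c d by (simp add: kron_vec_lin matvec_scaleC norm scaleC_scaleC mult_ac)
  qed
next
  fix R' assume h: "uq_module_map r (tensor_rep X Y) (tensor_rep Y X) R' \<and>
     (\<forall>\<nu> \<mu> v u. is_V r q X \<nu> \<and> is_V r q Y \<mu> \<and>
        highest_weight_vector r q X \<nu> v \<and> lowest_weight_vector r q Y (w0 r \<mu>) u \<longrightarrow>
        R' *v kron_vec v u = qpow q (wform r \<nu> (w0 r \<mu>)) *\<^sub>C kron_vec u v)"
  show "R' = R"
    by (rule module_map_unique[OF conjunct1[OF h] R]) (use h X.isV Y.isV X.hw Y.lw norm in auto)
qed

end

text \<open>The eigenvalues of the \<open>K\<^sub>i\<close> separate the basis vectors of a chain.\<close>

lemma kchar_sep:
  assumes q: "q \<noteq> 0" "q \<noteq> 1" "q\<^sup>2 \<noteq> 1" and "j \<le> r" "k \<le> r" and eq: "\<And>m. m < r \<Longrightarrow> kchar q m j = kchar q m k"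
  shows "j = k"
proof -
  have ne: "q \<noteq> 1 / q" using q by (simp add: field_simps power2_eq_square)
  have "\<not> a < b" if "b \<le> r" "kchar q a a = kchar q a b" for a b
    using that(2) ne q by (auto simp: kchar_def split: if_splits)
  then show ?thesis using assms by (metis linorder_neqE_nat order_less_le_trans)
qed

text \<open>Lowering the highest weight vector along the chain of simple roots gives nonzero vectors of distinct
  weights, \<open>r + 1\<close> in number and hence a basis. As the weights are distinct, each of them is a multiple of a vector
  of the given weight basis. The other matrix entries of the raising and lowering operators vanish, since they would lead
  to eigenvalues of the \<open>K\<^sub>i\<close> that do not occur.\<close>

lemma quantum_chain:
  fixes V :: "'i::finite uq_rep"
  assumes qd: "quantum_data r s q V wt"
  obtains l x where "chain r (complex_of_real q) s V l x"
    "\<And>i m. m < r \<Longrightarrow> qpow q (wform r (simple_root (gidx r s m)) (wt i)) = kchar (complex_of_real q) m (l i)"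
proof -
  have r: "1 \<le> r" and s: "s \<in> {1, r}" and q: "0 < q" "q < 1" and card: "CARD('i) = r + 1"
    and V: "is_V r q V (fund_weight r s)" and wb: "weight_basis r q V wt"
    using qd by (auto simp: quantum_data_def)
  let ?q = "complex_of_real q"
  let ?g = "gidx r s"
  have q0: "?q \<noteq> 0" "?q \<noteq> 1" using q by auto
  have "q\<^sup>2 < 1" using q by (simp add: power_less_one_iff)
  then have q2: "?q\<^sup>2 \<noteq> 1" by (metis of_real_eq_1_iff of_real_power less_irrefl)
  have um: "is_uq_module r q V" using V by (simp add: is_V_def simple_uq_module_def)
  obtain v where hw: "highest_weight_vector r q V (fund_weight r s) v" using V by (auto simp: is_V_def)
  have s1: "s \<in> {1..r}" using r s by auto
  have gr: "m < r \<Longrightarrow> ?g m \<in> {1..r}" for m using gidx_props(1)[OF s] by blast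
  define cf where "cf m n = (if m = n then 2 else if m = n + 1 \<or> n = m + 1 then - 1 else 0 :: real)" for m n :: nat
  have cf: "wform r (simple_root (?g m)) (simple_root (?g n)) = cf m n" if "m < r" "n < r" for m n
    using wform_simple_simple[OF gr[OF that(1)] gr[OF that(2)]] gidx_props[OF s that] by (simp add: cf_def)
  have KK: "Kop V (?g m) ** Kiop V (?g m) = mat 1" "Kiop V (?g m) ** Kop V (?g m) = mat 1" if "m < r" for m
    using um gr[OF that] by (auto simp: is_uq_module_def)
  have rel: "Kop V (?g m) ** Eop V (?g n) ** Kiop V (?g m) = qpow q (cf m n) *\<^sub>C Eop V (?g n)"
    "Kop V (?g m) ** Fop V (?g n) ** Kiop V (?g m) = qpow q (- cf m n) *\<^sub>C Fop V (?g n)"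
    "Eop V (?g m) ** Fop V (?g n) - Fop V (?g n) ** Eop V (?g m) = (if m = n then (1 / (qpow q 1 - qpow q (- 1))) *\<^sub>C (Kop V (?g m) - Kiop V (?g m)) else 0)"
    if "m < r" "n < r" for m n
    using um gr[OF that(1)] gr[OF that(2)] gidx_props(2)[OF s that] cf[OF that] by (auto simp: is_uq_module_def)
  have move: "A *v (B *v y) = c *\<^sub>C (B *v (A *v y))" if "A ** B ** A' = c *\<^sub>C B" "A' ** A = mat 1"
    for A B A' :: "complex ^ 'i ^ 'i" and c y
  proof -
    have "A ** B ** A' ** A = A ** B" using that(2) by (simp add: matrix_mul_assoc[symmetric])
    then have "A *v (B *v y) = (c *\<^sub>C B) *v (A *v y)" using that(1) by (metis matrix_vector_mul_assoc)
    then show ?thesis by (simp add: vec_eq_iff matrix_vector_mult_def scaleC_vec_def scaleC_complex_def sum_distrib_left mult_ac)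
  qed
  have KE: "Kop V (?g m) *v (Eop V (?g n) *v y) = qpow q (cf m n) *\<^sub>C (Eop V (?g n) *v (Kop V (?g m) *v y))"
    and KF: "Kop V (?g m) *v (Fop V (?g n) *v y) = qpow q (- cf m n) *\<^sub>C (Fop V (?g n) *v (Kop V (?g m) *v y))"
    if "m < r" "n < r" for m n y
    by (rule move[OF rel(1)[OF that] KK(2)[OF that(1)]], rule move[OF rel(2)[OF that] KK(2)[OF that(1)]])
  define vs where "vs k = rec_nat v (\<lambda>k u. Fop V (?g k) *v u) k" for k
  have vs: "vs 0 = v" "vs (Suc k) = Fop V (?g k) *v vs k" for k by (simp_all add: vs_def)
  have Kvs: "Kop V (?g m) *v vs k = kchar ?q m k *\<^sub>C vs k" if "m < r" "k \<le> r" for m k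
    using that(2)
  proof (induction k)
    case 0
    have "Kop V (?g m) *v v = qpow q (if m = 0 then 1 else 0) *\<^sub>C v"
      using hw gr[OF that(1)] gidx_props[OF s that(1) that(1)] s1
      by (auto simp: highest_weight_vector_def weight_vector_def wform_simple_fund)
    then show ?case by (simp add: vs kchar_def qpow_values[OF q(1)] split: if_splits)
  next
    case (Suc k)
    have "qpow q (- cf m k) * kchar ?q m k = kchar ?q m (Suc k)"
      using q0 by (auto simp: cf_def kchar_def qpow_values[OF q(1)] power2_eq_square)
    then show ?case using Suc KF[OF that(1), of k "vs k"] by (simp add: vs matvec_scaleC scaleC_scaleC)
  qed
  have EF: "Eop V (?g m) *v (Fop V (?g n) *v y) = Fop V (?g n) *v (Eop V (?g m) *v y)" if "m < r" "n < r" "m \<noteq> n" for m n y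
    using rel(3)[OF that(1,2)] that(3) by (simp add: matrix_vector_mul_assoc)
  have Evs: "Eop V (?g m) *v vs k = 0" if "m < r" "k \<le> m" for m k
    using that(2)
  proof (induction k)
    case 0
    then show ?case using hw gr[OF that(1)] by (simp add: vs highest_weight_vector_def)
  next
    case (Suc k)
    then show ?case using EF[of m k "vs k"] that(1) by (simp add: vs)
  qed
  have Evs': "Eop V (?g k) *v vs (Suc k) = vs k" if "k < r" for k
  proof -
    have ne: "?q - 1 / ?q \<noteq> 0" using q0 q2 by (simp add: field_simps power2_eq_square)
    have K: "Kop V (?g k) *v vs k = ?q *\<^sub>C vs k" using Kvs[OF that, of k] that by (simp add: kchar_def)
    have "Kiop V (?g k) *v (Kop V (?g k) *v vs k) = vs k"
      using KK(2)[OF that] by (simp add: matrix_vector_mul_assoc)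
    then have "?q *\<^sub>C (Kiop V (?g k) *v vs k) = vs k" by (simp add: K matvec_scaleC)
    then have Ki: "Kiop V (?g k) *v vs k = (1 / ?q) *\<^sub>C vs k"
      using q0 by (metis nonzero_divide_eq_eq scaleC_one scaleC_scaleC)
    have "Eop V (?g k) *v (Fop V (?g k) *v vs k) - Fop V (?g k) *v (Eop V (?g k) *v vs k) =
      (Eop V (?g k) ** Fop V (?g k) - Fop V (?g k) ** Eop V (?g k)) *v vs k"
      by (simp add: matrix_vector_mul_assoc matrix_vector_mult_diff_rdistrib)
    also have "\<dots> = (1 / (?q - 1 / ?q)) *\<^sub>C (Kop V (?g k) *v vs k - Kiop V (?g k) *v vs k)"
      unfolding rel(3)[OF that that]
      by (simp add: qpow_values[OF q(1)] vec_eq_iff matrix_vector_mult_def scaleC_vec_def scaleC_complex_def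
          sum_divide_distrib sum_subtractf left_diff_distrib diff_divide_distrib)
    also have "\<dots> = ((1 / (?q - 1 / ?q)) * (?q - 1 / ?q)) *\<^sub>C vs k"
      unfolding K Ki complex_space.scale_left_diff_distrib[symmetric] scaleC_scaleC ..
    also have "\<dots> = vs k" using ne by simp
    finally show ?thesis using Evs[OF that, of k] by (simp add: vs)
  qed
  have vs0: "vs k \<noteq> 0" if "k \<le> r" for k
    using that
  proof (induction k)
    case 0
    then show ?case using hw by (simp add: vs highest_weight_vector_def weight_vector_def)
  next
    case (Suc k)
    then show ?case using Evs'[of k] by auto
  qed
  define D where "D m i = qpow q (wform r (simple_root (?g m)) (wt i))" for m i
  have Kd: "Kop V (?g m) = diagm (D m)" if "m < r" for m
  proof (rule matrix_eq_axis)
    fix i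
    have "Kop V (?g m) *v axis i 1 = D m i *\<^sub>C axis i 1"
      using wb gr[OF that] by (simp add: weight_basis_def weight_vector_def D_def)
    then show "Kop V (?g m) *v axis i 1 = diagm (D m) *v axis i 1"
      by (auto simp: diagm_vec vec_eq_iff axis_def scaleC_complex_def)
  qed
  have supp: "D m i = c" if "m < r" "Kop V (?g m) *v y = c *\<^sub>C y" "y $ i \<noteq> 0" for m i c y
  proof -
    have "(Kop V (?g m) *v y) $ i = D m i * y $ i" unfolding Kd[OF that(1)] by (simp add: diagm_vec)
    then show ?thesis using that(2,3) by (simp add: scaleC_complex_def)
  qed
  define lab where "lab k = (SOME i. vs k $ i \<noteq> 0)" for k
  have lab: "vs k $ lab k \<noteq> 0" if "k \<le> r" for k
    unfolding lab_def by (rule someI_ex) (use vs0[OF that] in \<open>auto simp: vec_eq_iff\<close>)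
  have Dlab: "D m (lab k) = kchar ?q m k" if "m < r" "k \<le> r" for m k
    by (rule supp[OF that(1) Kvs[OF that] lab[OF that(2)]])
  have inj: "inj_on lab {0..r}"
  proof (rule inj_onI)
    fix j k assume h: "j \<in> {0..r}" "k \<in> {0..r}" "lab j = lab k"
    have "kchar ?q m j = kchar ?q m k" if "m < r" for m
      using Dlab[OF that, of j] Dlab[OF that, of k] h by simp
    then show "j = k" using h by (intro kchar_sep[OF q0 q2, of j r k]) auto
  qed
  have surj: "lab ` {0..r} = UNIV"
    by (rule card_subset_eq) (use card in \<open>simp_all add: card_image[OF inj]\<close>)
  define l where "l = inv_into {0..r} lab"
  have bij: "bij_betw l UNIV {0..r}"
    unfolding l_def by (rule bij_betw_inv_into) (use inj surj in \<open>simp add: bij_betw_def\<close>)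
  have l_lab: "l (lab k) = k" if "k \<le> r" for k
    unfolding l_def using that by (intro inv_into_f_f[OF inj]) simp
  note bl = bijl[OF bij]
  have lab_l: "lab (l i) = i" and l_le: "l i \<le> r" for i
  proof -
    show "lab (l i) = i" unfolding l_def by (rule f_inv_into_f) (simp add: surj)
    show "l i \<le> r" by (rule bl(3))
  qed
  have invl: "inv l k = lab k" if "k \<le> r" for k using bl(6)[OF that, of "lab k"] l_lab[OF that] by simp
  have Dl: "D m i = kchar ?q m (l i)" if "m < r" for m i
    using Dlab[OF that l_le[of i]] lab_l[of i] by simp
  define c where "c k = vs k $ lab k" for k
  have c0: "c k \<noteq> 0" if "k \<le> r" for k using lab[OF that] by (simp add: c_def)
  have vsc: "vs k = c k *\<^sub>C axis (lab k) 1" if k: "k \<le> r" for k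
  proof -
    have "vs k $ i = 0" if "i \<noteq> lab k" for i
    proof (rule ccontr)
      assume nz: "vs k $ i \<noteq> 0"
      have "kchar ?q m (l i) = kchar ?q m k" if "m < r" for m
        using supp[OF that Kvs[OF that k] nz] Dl[OF that] by simp
      then have "l i = k" using l_le k by (intro kchar_sep[OF q0 q2]) auto
      then show False using lab_l[of i] that by simp
    qed
    then show ?thesis by (auto simp: vec_eq_iff c_def axis_def scaleC_complex_def)
  qed
  have Kax: "Kop V (?g m) *v axis (lab k) 1 = kchar ?q m k *\<^sub>C axis (lab k) 1" if "m < r" "k \<le> r" for m k
    using Dlab[OF that] by (auto simp: Kd that(1) diagm_vec vec_eq_iff axis_def scaleC_complex_def)
  have qr: "q ^ 2 < q" "q ^ 3 < q ^ 2" "1 < 1 / q" "0 < q ^ 3"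
    using q by (auto simp: power2_eq_square power3_eq_cube)
  define kr where "kr m j = (if j = m then q else if j = m + 1 then 1 / q else 1)" for m j :: nat
  have kv: "kchar ?q m j = of_real (kr m j)" for m j
    by (simp add: kchar_def kr_def)
  have kr3: "kr m j = q \<or> kr m j = 1 / q \<or> kr m j = 1" for m j by (simp add: kr_def)
  have F0: "Fop V (?g n) *v axis (lab k) 1 = 0" if "n < r" "k \<le> r" "n \<noteq> k" for n k
  proof (rule ccontr)
    assume "Fop V (?g n) *v axis (lab k) 1 \<noteq> 0"
    then obtain i where i: "(Fop V (?g n) *v axis (lab k) 1) $ i \<noteq> 0" by (auto simp: vec_eq_iff)
    have "Kop V (?g n) *v (Fop V (?g n) *v axis (lab k) 1) = (qpow q (- 2) * kchar ?q n k) *\<^sub>C (Fop V (?g n) *v axis (lab k) 1)"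
      unfolding KF[OF that(1,1)] Kax[OF that(1,2)] by (simp add: cf_def matvec_scaleC scaleC_scaleC)
    from supp[OF that(1) this i] have "complex_of_real (kr n (l i)) = complex_of_real ((1 / q\<^sup>2) * kr n k)"
      unfolding Dl[OF that(1)] kv qpow_values[OF q(1)] by simp
    then have "kr n (l i) = (1 / q\<^sup>2) * kr n k" by (simp only: of_real_eq_iff)
    then have "q\<^sup>2 * kr n (l i) = kr n k" using q by simp
    moreover have "kr n k = 1 \<or> kr n k = 1 / q" using that(3) by (simp add: kr_def)
    moreover have "q\<^sup>2 * kr n (l i) < 1"
    proof -
      have "q\<^sup>2 * q = q ^ 3" "q\<^sup>2 * (1 / q) = q" using q by (simp_all add: power2_eq_square power3_eq_cube)
      then have "q\<^sup>2 * q < 1" "q\<^sup>2 * (1 / q) < 1" "q\<^sup>2 * 1 < 1" using qr(1,2) q(2) by linarith+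
      then show ?thesis using kr3[of n "l i"] by (elim disjE) simp_all
    qed
    ultimately show False using qr(3) by auto
  qed
  have E0: "Eop V (?g n) *v axis (lab k) 1 = 0" if "n < r" "k \<le> r" "k \<noteq> n + 1" for n k
  proof (rule ccontr)
    assume "Eop V (?g n) *v axis (lab k) 1 \<noteq> 0"
    then obtain i where i: "(Eop V (?g n) *v axis (lab k) 1) $ i \<noteq> 0" by (auto simp: vec_eq_iff)
    have "Kop V (?g n) *v (Eop V (?g n) *v axis (lab k) 1) = (qpow q 2 * kchar ?q n k) *\<^sub>C (Eop V (?g n) *v axis (lab k) 1)"
      unfolding KE[OF that(1,1)] Kax[OF that(1,2)] by (simp add: cf_def matvec_scaleC scaleC_scaleC)
    from supp[OF that(1) this i] have "complex_of_real (kr n (l i)) = complex_of_real (q\<^sup>2 * kr n k)"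
      unfolding Dl[OF that(1)] kv qpow_values[OF q(1)] by simp
    then have "kr n (l i) = q\<^sup>2 * kr n k" by (simp only: of_real_eq_iff)
    moreover have "kr n k = 1 \<or> kr n k = q" using that(3) by (simp add: kr_def)
    moreover have "q\<^sup>2 * kr n k < q"
    proof -
      have "q\<^sup>2 * q < 1 * q" using \<open>q\<^sup>2 < 1\<close> q(1) by (intro mult_strict_right_mono)
      then have "q\<^sup>2 * q < q" by simp
      then show ?thesis using \<open>kr n k = 1 \<or> kr n k = q\<close> qr(1) by auto
    qed
    ultimately show False using kr3[of n "l i"] qr(3) q by auto
  qed
  have scl: "y = (d / e) *\<^sub>C w" if "e *\<^sub>C y = d *\<^sub>C w" "e \<noteq> 0" for y w :: "complex ^ 'i" and d e
  proof -
    have "(1 / e) *\<^sub>C e *\<^sub>C y = (1 / e) *\<^sub>C d *\<^sub>C w" using that(1) by simp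
    then show ?thesis using that(2) by (simp add: scaleC_scaleC)
  qed
  have F1: "Fop V (?g k) *v axis (lab k) 1 = (c (k + 1) / c k) *\<^sub>C axis (lab (k + 1)) 1" if "k < r" for k
    by (rule scl) (use vs(2)[of k] vsc[of k] vsc[of "k + 1"] c0[of k] that in \<open>simp_all add: matvec_scaleC\<close>)
  have E1: "Eop V (?g k) *v axis (lab (k + 1)) 1 = (c k / c (k + 1)) *\<^sub>C axis (lab k) 1" if "k < r" for k
    by (rule scl) (use Evs'[of k] vsc[of k] vsc[of "k + 1"] c0[of "k + 1"] that in \<open>simp_all add: matvec_scaleC\<close>)
  have ax: "axis i 1 $ lab j = (if l i = j then 1 else (0::complex))" if "j \<le> r" for i j
    using that l_lab[OF that] lab_l[of i] by (auto simp: axis_def)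
  have "chain r ?q s V l (\<lambda>k. c k / c (k + 1))"
    unfolding chain_def
  proof (intro conjI allI impI bij)
    fix k assume k: "k < r"
    then have k': "k \<le> r" "k + 1 \<le> r" by auto
    show "c k / c (k + 1) \<noteq> 0" using c0 k' by simp
    show "Eop V (?g k) = unitm (inv l k) (inv l (k + 1)) (c k / c (k + 1))"
    proof (rule matrix_eq_axis)
      fix i
      show "Eop V (?g k) *v axis i 1 = unitm (inv l k) (inv l (k + 1)) (c k / c (k + 1)) *v axis i 1"
        unfolding invl[OF k'(1)] invl[OF k'(2)] unitm_vec ax[OF k'(2)]
        using E0[OF k l_le[of i]] E1[OF k] lab_l[of i] by (cases "l i = k + 1") simp_all
    qed
    show "Fop V (?g k) = unitm (inv l (k + 1)) (inv l k) (1 / (c k / c (k + 1)))"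
    proof (rule matrix_eq_axis)
      fix i
      show "Fop V (?g k) *v axis i 1 = unitm (inv l (k + 1)) (inv l k) (1 / (c k / c (k + 1))) *v axis i 1"
        unfolding invl[OF k'(1)] invl[OF k'(2)] unitm_vec ax[OF k'(1)]
        using F0[OF k l_le[of i]] F1[OF k] lab_l[of i] by (cases "l i = k") auto
    qed
    show K: "Kop V (?g k) = diagm (\<lambda>a. kchar ?q k (l a))"
    proof -
      have "D k = (\<lambda>a. kchar ?q k (l a))" using Dl[OF k] by (simp add: fun_eq_iff)
      then show ?thesis using Kd[OF k] by simp
    qed
    have one: "diagm (\<lambda>a::'i. 1) = mat 1" by (auto simp: diagm_def mat_def vec_eq_iff)
    have nz: "kchar ?q k j \<noteq> 0" for j using q0 by (auto simp: kchar_def)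
    have "Kiop V (?g k) = (diagm (\<lambda>a. 1 / kchar ?q k (l a)) ** Kop V (?g k)) ** Kiop V (?g k)"
      by (simp add: K diagm_mult nz one)
    also have "\<dots> = diagm (\<lambda>a. 1 / kchar ?q k (l a))"
      by (simp add: matrix_mul_assoc[symmetric] KK[OF k])
    finally show "Kiop V (?g k) = diagm (\<lambda>a. 1 / kchar ?q k (l a))" .
  qed
  then show ?thesis using that[of l] Dl unfolding D_def by blast
qed

lemma weight_two_rho:
  assumes r: "1 \<le> r" and s: "s \<in> {1, r}" and q: "0 < q" "q < 1" and j: "j \<le> r"
    and D: "\<And>m. m < r \<Longrightarrow> qpow q (wform r (simple_root (gidx r s m)) \<mu>) = kchar (complex_of_real q) m j"
  shows "wform r \<mu> (two_rho r) = real r - 2 * real j"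
proof -
  have e: "wform r (simple_root (gidx r s m)) \<mu> = (if j = m then 1 else 0) - (if j = m + 1 then 1 else 0)" if "m < r" for m
  proof -
    have "q powr (wform r (simple_root (gidx r s m)) \<mu>) = q powr ((if j = m then 1 else 0) - (if j = m + 1 then 1 else 0))"
    proof -
      have "qpow q (wform r (simple_root (gidx r s m)) \<mu>) = qpow q ((if j = m then 1 else 0) - (if j = m + 1 then 1 else 0))"
        using D[OF that] qpow_values[OF q(1)] by (auto simp: kchar_def)
      then show ?thesis by (simp add: qpow_def)
    qed
    then show ?thesis using q by (simp add: powr_inj split del: if_split)
  qed
  have "wform r \<mu> (two_rho r) = (\<Sum>k<r. real (gidx r s k) * (real r + 1 - real (gidx r s k)) * wform r (simple_root (gidx r s k)) \<mu>)"
    unfolding wform_two_rho by (rule sum.reindex_bij_betw[OF gidx_bij[OF s], symmetric])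
  also have "\<dots> = (\<Sum>k<r. (if j = k then (real k + 1) * (real r - real k) else 0) - (if j = k + 1 then (real k + 1) * (real r - real k) else 0))"
  proof (rule sum.cong[OF refl])
    fix k assume "k \<in> {..<r}"
    then have k: "k < r" by simp
    have "real (gidx r s k) * (real r + 1 - real (gidx r s k)) = (real k + 1) * (real r - real k)"
      using s k by (auto simp: gidx_def of_nat_diff algebra_simps)
    then show "real (gidx r s k) * (real r + 1 - real (gidx r s k)) * wform r (simple_root (gidx r s k)) \<mu> =
        (if j = k then (real k + 1) * (real r - real k) else 0) - (if j = k + 1 then (real k + 1) * (real r - real k) else 0)"
      by (simp add: e[OF k])
  qed
  also have "\<dots> = (real j + 1) * (real r - real j) - real j * (real r - real j + 1)"
  proof -
    have 1: "(\<Sum>k<r. if j = k then (real k + 1) * (real r - real k) else 0) = (real j + 1) * (real r - real j)"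
      using j by (cases "j = r") auto
    have 2: "(\<Sum>k<r. if j = k + 1 then (real k + 1) * (real r - real k) else 0) = real j * (real r - real j + 1)"
    proof (cases j)
      case (Suc i)
      then have "i < r" using j by simp
      then show ?thesis by (simp add: Suc)
    qed simp
    show ?thesis by (simp only: sum_subtractf 1 2)
  qed
  also have "\<dots> = real r - 2 * real j" by (simp add: algebra_simps)
  finally show ?thesis .
qed

section \<open>The braidings as R-matrices\<close>

lemma Rmat_mult_left:
  "(Rmat z q l ** M) $ u $ v = (z * (if fst u = snd u then q else 1)) * M $ (snd u, fst u) $ v +
     (z * (if l (snd u) < l (fst u) then q - 1 / q else 0)) * M $ u $ v"
proof -
  have "(\<Sum>k\<in>UNIV. Rmat z q l $ u $ k * M $ k $ v) =
    (\<Sum>k\<in>UNIV. (if k = (snd u, fst u) then (z * (if fst u = snd u then q else 1)) * M $ k $ v else 0) +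
       (if k = u then (z * (if l (snd u) < l (fst u) then q - 1 / q else 0)) * M $ k $ v else 0))"
    by (rule sum.cong) (auto simp: Rmat_def distrib_right)
  then show ?thesis by (simp add: matrix_matrix_mult_def sum.distrib)
qed

lemma Rmat_mult_right:
  "(M ** Rmat z q l) $ u $ v = M $ u $ (snd v, fst v) * (z * (if fst v = snd v then q else 1)) +
     M $ u $ v * (z * (if l (snd v) < l (fst v) then q - 1 / q else 0))"
proof -
  have "(\<Sum>k\<in>UNIV. M $ u $ k * Rmat z q l $ k $ v) =
    (\<Sum>k\<in>UNIV. (if k = (snd v, fst v) then M $ u $ k * (z * (if fst v = snd v then q else 1)) else 0) +
       (if k = v then M $ u $ k * (z * (if l (snd v) < l (fst v) then q - 1 / q else 0)) else 0))"
    by (rule sum.cong) (auto simp: Rmat_def distrib_left split: prod.splits)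
  then show ?thesis by (simp add: matrix_matrix_mult_def sum.distrib)
qed

text \<open>The intertwining property for one simple root, in terms of matrix units. Only the indices \<open>A\<close> and \<open>B\<close>, which
  are adjacent in the order, are touched.\<close>

lemma Rmat_commute_units:
  fixes A B :: "'i::finite" and l :: "'i \<Rightarrow> int" and q :: complex
  defines "\<kappa> \<equiv> \<lambda>a. if a = A then q else if a = B then 1 / q else 1"
  assumes q: "q \<noteq> 0" and AB: "l A < l B"
    and gap: "\<And>c. c \<noteq> A \<Longrightarrow> c \<noteq> B \<Longrightarrow> (l c < l A \<longleftrightarrow> l c < l B) \<and> (l A < l c \<longleftrightarrow> l B < l c)"
  shows "Rmat z q l ** (kron (unitm A B x) (diagm \<kappa>) + kron (mat 1) (unitm A B x)) =
      (kron (unitm A B x) (diagm \<kappa>) + kron (mat 1) (unitm A B x)) ** Rmat z q l"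
    "Rmat z q l ** (kron (unitm B A x) (mat 1) + kron (diagm (\<lambda>a. 1 / \<kappa> a)) (unitm B A x)) =
      (kron (unitm B A x) (mat 1) + kron (diagm (\<lambda>a. 1 / \<kappa> a)) (unitm B A x)) ** Rmat z q l"
proof -
  have AB': "A \<noteq> B" "B \<noteq> A" "\<not> l B < l A" using AB by auto
  have gap': "c \<noteq> A \<Longrightarrow> c \<noteq> B \<Longrightarrow> l c < l A \<longleftrightarrow> l c < l B" "c \<noteq> A \<Longrightarrow> c \<noteq> B \<Longrightarrow> l A < l c \<longleftrightarrow> l B < l c" for c
    using gap by auto
  have "(Rmat z q l ** (kron (unitm A B x) (diagm \<kappa>) + kron (mat 1) (unitm A B x))) $ (a, b) $ (i, j) =
      ((kron (unitm A B x) (diagm \<kappa>) + kron (mat 1) (unitm A B x)) ** Rmat z q l) $ (a, b) $ (i, j)" for a b i j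
    unfolding Rmat_mult_left Rmat_mult_right
    using q AB AB' gap'[of a] gap'[of b]
    by (cases "i = B"; cases "j = B"; cases "a = A"; cases "b = A"; cases "a = B"; cases "b = B")
       (auto simp: kron_def unitm_def diagm_def mat_def \<kappa>_def field_simps)
  then show "Rmat z q l ** (kron (unitm A B x) (diagm \<kappa>) + kron (mat 1) (unitm A B x)) =
      (kron (unitm A B x) (diagm \<kappa>) + kron (mat 1) (unitm A B x)) ** Rmat z q l"
    by (auto simp: vec_eq_iff)
  have "(Rmat z q l ** (kron (unitm B A x) (mat 1) + kron (diagm (\<lambda>a. 1 / \<kappa> a)) (unitm B A x))) $ (a, b) $ (i, j) =
      ((kron (unitm B A x) (mat 1) + kron (diagm (\<lambda>a. 1 / \<kappa> a)) (unitm B A x)) ** Rmat z q l) $ (a, b) $ (i, j)" for a b i j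
    unfolding Rmat_mult_left Rmat_mult_right
    using q AB AB' gap'[of a] gap'[of b]
    by (cases "i = A"; cases "j = A"; cases "a = A"; cases "b = A"; cases "a = B"; cases "b = B")
       (auto simp: kron_def unitm_def diagm_def mat_def \<kappa>_def field_simps)
  then show "Rmat z q l ** (kron (unitm B A x) (mat 1) + kron (diagm (\<lambda>a. 1 / \<kappa> a)) (unitm B A x)) =
      (kron (unitm B A x) (mat 1) + kron (diagm (\<lambda>a. 1 / \<kappa> a)) (unitm B A x)) ** Rmat z q l"
    by (auto simp: vec_eq_iff)
qed

lemma Rmat_commute_diag:
  "Rmat z q l ** kron (diagm f) (diagm f) = kron (diagm f) (diagm f) ** Rmat z q l"
proof -
  have "(Rmat z q l ** kron (diagm f) (diagm f)) $ (a, b) $ (i, j) = (kron (diagm f) (diagm f) ** Rmat z q l) $ (a, b) $ (i, j)" for a b i j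
    unfolding Rmat_mult_left Rmat_mult_right by (auto simp: kron_def diagm_def)
  then show ?thesis by (auto simp: vec_eq_iff)
qed

lemma (in chain_rep) Rmat_module_map:
  "uq_module_map r (tensor_rep M M) (tensor_rep M M) (Rmat z qc (\<lambda>a. int (l a)))"
  unfolding uq_module_map_def
proof
  fix i assume i: "i \<in> {1..r}"
  obtain k where k: "k < r" "i = gidx r s k" using gidx_cases[OF s i] .
  define A B where "A = inv l k" and "B = inv l (k + 1)"
  have lAB: "l A = k" "l B = k + 1" using bl(1)[of k] bl(1)[of "k + 1"] k by (auto simp: A_def B_def)
  have eq: "a = A \<longleftrightarrow> l a = k" "a = B \<longleftrightarrow> l a = k + 1" for a
    using bl(5)[of k a] bl(5)[of "k + 1" a] k by (auto simp: A_def B_def)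
  have kc: "(\<lambda>a. kchar qc k (l a)) = (\<lambda>a. if a = A then qc else if a = B then 1 / qc else 1)"
    unfolding eq by (simp add: kchar_def fun_eq_iff)
  have kc': "(\<lambda>a. 1 / kchar qc k (l a)) = (\<lambda>a. 1 / (if a = A then qc else if a = B then 1 / qc else 1))"
    using kc by (simp add: fun_eq_iff)
  have gap: "c \<noteq> A \<Longrightarrow> c \<noteq> B \<Longrightarrow> (int (l c) < int (l A) \<longleftrightarrow> int (l c) < int (l B)) \<and> (int (l A) < int (l c) \<longleftrightarrow> int (l B) < int (l c))" for c
    unfolding eq lAB by auto
  have m: "Kop M i = diagm (\<lambda>a. if a = A then qc else if a = B then 1 / qc else 1)"
    "Kiop M i = diagm (\<lambda>a. 1 / (if a = A then qc else if a = B then 1 / qc else 1))"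
    "Eop M i = unitm A B (x k)" "Fop M i = unitm B A (1 / x k)"
    unfolding k(2) mats[OF k(1)] kc kc' A_def B_def by (rule refl)+
  note c = Rmat_commute_units[where A = A and B = B and l = "\<lambda>a. int (l a)", OF q0 _ gap]
  show "Rmat z qc (\<lambda>a. int (l a)) ** Kop (tensor_rep M M) i = Kop (tensor_rep M M) i ** Rmat z qc (\<lambda>a. int (l a)) \<and>
     Rmat z qc (\<lambda>a. int (l a)) ** Kiop (tensor_rep M M) i = Kiop (tensor_rep M M) i ** Rmat z qc (\<lambda>a. int (l a)) \<and>
     Rmat z qc (\<lambda>a. int (l a)) ** Eop (tensor_rep M M) i = Eop (tensor_rep M M) i ** Rmat z qc (\<lambda>a. int (l a)) \<and>
     Rmat z qc (\<lambda>a. int (l a)) ** Fop (tensor_rep M M) i = Fop (tensor_rep M M) i ** Rmat z qc (\<lambda>a. int (l a))"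
    unfolding tensor_rep_def uq_rep.select_convs m
    by (intro conjI Rmat_commute_diag c) (simp_all add: lAB)
qed

lemma sum_pair: "(\<Sum>u\<in>UNIV. g u) = (\<Sum>i\<in>UNIV. \<Sum>j\<in>UNIV. g (i, j))"
  for g :: "'i::finite \<times> 'j::finite \<Rightarrow> 'x::comm_monoid_add"
  by (simp add: sum.cartesian_product flip: UNIV_Times_UNIV)

lemma mult_kron1:
  fixes M :: "complex ^ ('i::finite \<times> 'j::finite) ^ 'k"
  shows "(M ** kron A (diagm f)) $ u $ (i, j) = (\<Sum>x\<in>UNIV. M $ u $ (x, j) * A $ x $ i) * f j"
    "(M ** kron (diagm g) B) $ u $ (i, j) = (\<Sum>x\<in>UNIV. M $ u $ (i, x) * B $ x $ j) * g i"
proof -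
  have "(M ** kron A (diagm f)) $ u $ (i, j) = (\<Sum>x\<in>UNIV. \<Sum>y\<in>UNIV. (M $ u $ (x, y) * A $ x $ i) * (if y = j then f y else 0))"
    by (simp add: matrix_matrix_mult_def sum_pair kron_def diagm_def mult.assoc cong: if_cong)
  also have "\<dots> = (\<Sum>x\<in>UNIV. M $ u $ (x, j) * A $ x $ i * f j)"
    by (intro sum.cong refl) (simp add: if_distrib[where f = "\<lambda>x. _ * x"] cong: if_cong)
  finally show "(M ** kron A (diagm f)) $ u $ (i, j) = (\<Sum>x\<in>UNIV. M $ u $ (x, j) * A $ x $ i) * f j"
    by (simp add: sum_distrib_right)
  have "(M ** kron (diagm g) B) $ u $ (i, j) = (\<Sum>y\<in>UNIV. \<Sum>x\<in>UNIV. (M $ u $ (x, y) * B $ y $ j) * (if x = i then g x else 0))"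
    by (simp add: matrix_matrix_mult_def sum_pair kron_def diagm_def mult_ac cong: if_cong) (rule sum.swap)
  also have "\<dots> = (\<Sum>y\<in>UNIV. M $ u $ (i, y) * B $ y $ j * g i)"
    by (intro sum.cong refl) (simp add: if_distrib[where f = "\<lambda>x. _ * x"] cong: if_cong)
  finally show "(M ** kron (diagm g) B) $ u $ (i, j) = (\<Sum>x\<in>UNIV. M $ u $ (i, x) * B $ x $ j) * g i"
    by (simp add: sum_distrib_right)
qed

lemma mult_kron2:
  fixes M :: "complex ^ 'k ^ ('i::finite \<times> 'j::finite)"
  shows "(kron A (diagm f) ** M) $ (a, b) $ v = f b * (\<Sum>x\<in>UNIV. A $ a $ x * M $ (x, b) $ v)"
    "(kron (diagm g) B ** M) $ (a, b) $ v = g a * (\<Sum>x\<in>UNIV. B $ b $ x * M $ (a, x) $ v)"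
proof -
  have "(kron A (diagm f) ** M) $ (a, b) $ v = (\<Sum>x\<in>UNIV. \<Sum>y\<in>UNIV. (A $ a $ x * M $ (x, y) $ v) * (if b = y then f b else 0))"
    by (simp add: matrix_matrix_mult_def sum_pair kron_def diagm_def mult_ac cong: if_cong)
  also have "\<dots> = (\<Sum>x\<in>UNIV. A $ a $ x * M $ (x, b) $ v * f b)"
    by (intro sum.cong refl) (simp add: if_distrib[where f = "\<lambda>x. _ * x"] cong: if_cong)
  finally show "(kron A (diagm f) ** M) $ (a, b) $ v = f b * (\<Sum>x\<in>UNIV. A $ a $ x * M $ (x, b) $ v)"
    by (simp add: sum_distrib_left mult_ac)
  have "(kron (diagm g) B ** M) $ (a, b) $ v = (\<Sum>y\<in>UNIV. \<Sum>x\<in>UNIV. (B $ b $ y * M $ (x, y) $ v) * (if a = x then g a else 0))"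
    by (simp add: matrix_matrix_mult_def sum_pair kron_def diagm_def mult_ac cong: if_cong) (rule sum.swap)
  also have "\<dots> = (\<Sum>y\<in>UNIV. B $ b $ y * M $ (a, y) $ v * g a)"
    by (intro sum.cong refl) (simp add: if_distrib[where f = "\<lambda>x. _ * x"] cong: if_cong)
  finally show "(kron (diagm g) B ** M) $ (a, b) $ v = g a * (\<Sum>x\<in>UNIV. B $ b $ x * M $ (a, x) $ v)"
    by (simp add: sum_distrib_left mult_ac)
qed

lemma mm_add_rdistrib: "(A + B) ** Z = A ** Z + B ** Z" for A B :: "complex ^ 'n::finite ^ 'm"
  by (simp add: matrix_matrix_mult_def vec_eq_iff distrib_right sum.distrib)

lemma mat1_diagm: "mat 1 = diagm (\<lambda>_. 1)"
  by (auto simp: mat_def diagm_def vec_eq_iff)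

lemma mult_diagm: "(M ** diagm f) $ a $ b = M $ a $ b * f b" "(diagm f ** M') $ a $ b = f a * M' $ a $ b"
  for f :: "'i::finite \<Rightarrow> complex"
  by (simp_all add: matrix_matrix_mult_def diagm_def if_distrib[where f = "\<lambda>x. _ * x"] if_distrib[where f = "\<lambda>x. x * _"] cong: if_cong)

text \<open>Rotating a module map \<open>X \<otimes> Y \<rightarrow> Y \<otimes> X\<close> gives a module map \<open>Y\<^sup>* \<otimes> X \<rightarrow> X \<otimes> Y\<^sup>*\<close>. It is
  verified on components, the antipode in the dual module accounting for the change of side.\<close>

lemma rot_module_map_aux:
  fixes M :: "complex ^ ('i::finite \<times> 'j::finite) ^ ('j \<times> 'i)"
  assumes nz: "\<And>a. kx a \<noteq> 0" "\<And>a. ky a \<noteq> 0"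
    and K: "M ** kron (diagm kx) (diagm ky) = kron (diagm ky) (diagm kx) ** M"
    and E: "M ** (kron eX (diagm ky) + kron (mat 1) eY) = (kron eY (diagm kx) + kron (mat 1) eX) ** M"
    and F: "M ** (kron fX (mat 1) + kron (diagm (\<lambda>a. 1 / kx a)) fY) = (kron fY (mat 1) + kron (diagm (\<lambda>a. 1 / ky a)) fX) ** M"
  shows "rot M ** kron (diagm (\<lambda>a. 1 / ky a)) (diagm kx) = kron (diagm kx) (diagm (\<lambda>a. 1 / ky a)) ** rot M"
    "rot M ** kron (diagm ky) (diagm (\<lambda>a. 1 / kx a)) = kron (diagm (\<lambda>a. 1 / kx a)) (diagm ky) ** rot M"
    "rot M ** (kron (transpose (- (eY ** diagm (\<lambda>a. 1 / ky a)))) (diagm kx) + kron (mat 1) eX) =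
      (kron eX (diagm (\<lambda>a. 1 / ky a)) + kron (mat 1) (transpose (- (eY ** diagm (\<lambda>a. 1 / ky a))))) ** rot M"
    "rot M ** (kron (transpose (- (diagm ky ** fY))) (mat 1) + kron (diagm ky) fX) =
      (kron fX (mat 1) + kron (diagm (\<lambda>a. 1 / kx a)) (transpose (- (diagm ky ** fY)))) ** rot M"
proof -
  have D: "(Z ** kron (diagm f) (diagm g)) $ u $ (i, j) = Z $ u $ (i, j) * f i * g j"
    for Z :: "complex ^ ('p::finite \<times> 'r::finite) ^ 'u" and f g u i j
    by (simp add: mult_kron1) (simp add: diagm_def if_distrib[where f = "\<lambda>x. _ * x"] cong: if_cong)
  have D': "(kron (diagm f) (diagm g) ** Z) $ (i, j) $ u = f i * g j * Z $ (i, j) $ u"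
    for Z :: "complex ^ 'u ^ ('p::finite \<times> 'r::finite)" and f g u i j
    by (simp add: mult_kron2) (simp add: diagm_def if_distrib[where f = "\<lambda>x. x * _"] cong: if_cong)
  have k: "M $ (a, b) $ (i, j) * (kx i * ky j) = M $ (a, b) $ (i, j) * (ky a * kx b)" for a b i j
    using arg_cong[OF K, of "\<lambda>Z. Z $ (a, b) $ (i, j)"] by (simp add: D D' mult_ac)
  have e: "(\<Sum>x\<in>UNIV. M $ (a, b) $ (x, j) * eX $ x $ i) * ky j + (\<Sum>x\<in>UNIV. M $ (a, b) $ (i, x) * eY $ x $ j) =
      kx b * (\<Sum>x\<in>UNIV. eY $ a $ x * M $ (x, b) $ (i, j)) + (\<Sum>x\<in>UNIV. eX $ b $ x * M $ (a, x) $ (i, j))" for a b i j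
    using arg_cong[OF E, of "\<lambda>Z. Z $ (a, b) $ (i, j)"]
    by (simp add: matrix_add_ldistrib mm_add_rdistrib mat1_diagm mult_kron1 mult_kron2)
  have f: "(\<Sum>x\<in>UNIV. M $ (a, b) $ (x, j) * fX $ x $ i) + (\<Sum>x\<in>UNIV. M $ (a, b) $ (i, x) * fY $ x $ j) * (1 / kx i) =
      (\<Sum>x\<in>UNIV. fY $ a $ x * M $ (x, b) $ (i, j)) + (1 / ky a) * (\<Sum>x\<in>UNIV. fX $ b $ x * M $ (a, x) $ (i, j))" for a b i j
    using arg_cong[OF F, of "\<lambda>Z. Z $ (a, b) $ (i, j)"]
    by (simp add: matrix_add_ldistrib mm_add_rdistrib mat1_diagm mult_kron1 mult_kron2)
  have k': "M $ (a, b) $ (i, j) * (kx i / ky a) = M $ (a, b) $ (i, j) * (kx b / ky j)"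
    "M $ (a, b) $ (i, j) * (ky a / kx i) = M $ (a, b) $ (i, j) * (ky j / kx b)" for a b i j
    using k[of a b i j] nz by (auto simp: field_simps)
  have r: "rot M $ (b, j) $ (a, i) = M $ (a, b) $ (i, j)" for a b i j by (simp add: rot_def)
  have "(rot M ** kron (diagm (\<lambda>a. 1 / ky a)) (diagm kx)) $ (b, j) $ (a, i) = (kron (diagm kx) (diagm (\<lambda>a. 1 / ky a)) ** rot M) $ (b, j) $ (a, i)" for a b i j
    using k'(1)[of a b i j] by (simp add: D D' r mult_ac)
  then show "rot M ** kron (diagm (\<lambda>a. 1 / ky a)) (diagm kx) = kron (diagm kx) (diagm (\<lambda>a. 1 / ky a)) ** rot M"
    by (auto simp: vec_eq_iff)
  have "(rot M ** kron (diagm ky) (diagm (\<lambda>a. 1 / kx a))) $ (b, j) $ (a, i) = (kron (diagm (\<lambda>a. 1 / kx a)) (diagm ky) ** rot M) $ (b, j) $ (a, i)" for a b i j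
    using k'(2)[of a b i j] by (simp add: D D' r mult_ac)
  then show "rot M ** kron (diagm ky) (diagm (\<lambda>a. 1 / kx a)) = kron (diagm (\<lambda>a. 1 / kx a)) (diagm ky) ** rot M"
    by (auto simp: vec_eq_iff)
  have "(rot M ** (kron (transpose (- (eY ** diagm (\<lambda>a. 1 / ky a)))) (diagm kx) + kron (mat 1) eX)) $ (b, j) $ (a, i) =
      ((kron eX (diagm (\<lambda>a. 1 / ky a)) + kron (mat 1) (transpose (- (eY ** diagm (\<lambda>a. 1 / ky a))))) ** rot M) $ (b, j) $ (a, i)" for a b i j
  proof -
    have 1: "(\<Sum>x\<in>UNIV. M $ (x, b) $ (i, j) * (eY $ a $ x / ky x)) * kx i = (\<Sum>x\<in>UNIV. eY $ a $ x * M $ (x, b) $ (i, j)) * (kx b / ky j)"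
      unfolding sum_distrib_right by (rule sum.cong[OF refl]) (use k'(1)[of _ b i j] in \<open>simp add: field_simps nz\<close>)
    have hh: "kx i * (\<Sum>x\<in>UNIV. eY $ a $ x * M $ (x, b) $ (i, j) / ky x) = kx b * (\<Sum>x\<in>UNIV. eY $ a $ x * M $ (x, b) $ (i, j)) / ky j"
      using 1 by (simp add: mult_ac)
    have "((\<Sum>x\<in>UNIV. M $ (a, b) $ (x, j) * eX $ x $ i) * ky j + (\<Sum>x\<in>UNIV. M $ (a, b) $ (i, x) * eY $ x $ j)) / ky j =
      (kx b * (\<Sum>x\<in>UNIV. eY $ a $ x * M $ (x, b) $ (i, j)) + (\<Sum>x\<in>UNIV. eX $ b $ x * M $ (a, x) $ (i, j))) / ky j"
      by (simp only: e)
    then have 2: "(\<Sum>x\<in>UNIV. M $ (a, b) $ (x, j) * eX $ x $ i) - (\<Sum>x\<in>UNIV. eY $ a $ x * M $ (x, b) $ (i, j)) * (kx b / ky j) =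
       (\<Sum>x\<in>UNIV. eX $ b $ x * M $ (a, x) $ (i, j)) * (1 / ky j) - (\<Sum>x\<in>UNIV. M $ (a, b) $ (i, x) * eY $ x $ j) / ky j"
      using nz by (simp add: field_simps)
    show ?thesis
      using 2 by (simp add: matrix_add_ldistrib mm_add_rdistrib mat1_diagm mult_kron1 mult_kron2 r transpose_def mult_diagm
          sum_negf hh mult_ac) (simp add: sum_divide_distrib)
  qed
  then show "rot M ** (kron (transpose (- (eY ** diagm (\<lambda>a. 1 / ky a)))) (diagm kx) + kron (mat 1) eX) =
      (kron eX (diagm (\<lambda>a. 1 / ky a)) + kron (mat 1) (transpose (- (eY ** diagm (\<lambda>a. 1 / ky a))))) ** rot M"
    by (auto simp: vec_eq_iff)
  have "(rot M ** (kron (transpose (- (diagm ky ** fY))) (mat 1) + kron (diagm ky) fX)) $ (b, j) $ (a, i) =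
      ((kron fX (mat 1) + kron (diagm (\<lambda>a. 1 / kx a)) (transpose (- (diagm ky ** fY)))) ** rot M) $ (b, j) $ (a, i)" for a b i j
  proof -
    have 1: "(\<Sum>x\<in>UNIV. ky x * fY $ x $ j * M $ (a, b) $ (i, x)) * (1 / kx b) = (\<Sum>x\<in>UNIV. M $ (a, b) $ (i, x) * fY $ x $ j) * (ky a / kx i)"
      unfolding sum_distrib_right
    proof (rule sum.cong[OF refl])
      fix x
      show "ky x * fY $ x $ j * M $ (a, b) $ (i, x) * (1 / kx b) = M $ (a, b) $ (i, x) * fY $ x $ j * (ky a / kx i)"
        using k'(2)[of a b i x] by (simp add: mult_ac)
    qed
    have cross: "p' * y - w * y = v - u * (y / k)" if "p' + u * (1 / k) = w + (1 / y) * v" "y \<noteq> 0" for p' u k w y v :: complex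
    proof -
      have p: "p' = w + v / y - u / k" using that(1) by (simp add: algebra_simps)
      show ?thesis unfolding p using that(2) by (simp add: algebra_simps)
    qed
    have 2: "(\<Sum>x\<in>UNIV. M $ (a, b) $ (x, j) * fX $ x $ i) * ky a - (\<Sum>x\<in>UNIV. fY $ a $ x * M $ (x, b) $ (i, j)) * ky a =
       (\<Sum>x\<in>UNIV. fX $ b $ x * M $ (a, x) $ (i, j)) - (\<Sum>x\<in>UNIV. M $ (a, b) $ (i, x) * fY $ x $ j) * (ky a / kx i)"
      by (rule cross[OF f nz(2)])
    have "(rot M ** (kron (transpose (- (diagm ky ** fY))) (mat 1) + kron (diagm ky) fX)) $ (b, j) $ (a, i) =
      (\<Sum>x\<in>UNIV. M $ (a, b) $ (x, j) * fX $ x $ i) * ky a - (\<Sum>x\<in>UNIV. fY $ a $ x * M $ (x, b) $ (i, j)) * ky a"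
      by (simp add: matrix_add_ldistrib mat1_diagm mult_kron1 r transpose_def mult_diagm sum_negf sum_distrib_left sum_distrib_right mult_ac)
    also note 2
    also have "(\<Sum>x\<in>UNIV. fX $ b $ x * M $ (a, x) $ (i, j)) - (\<Sum>x\<in>UNIV. M $ (a, b) $ (i, x) * fY $ x $ j) * (ky a / kx i) =
      ((kron fX (mat 1) + kron (diagm (\<lambda>a. 1 / kx a)) (transpose (- (diagm ky ** fY)))) ** rot M) $ (b, j) $ (a, i)"
      unfolding 1[symmetric]
      by (simp add: mm_add_rdistrib mat1_diagm mult_kron2 r transpose_def mult_diagm sum_negf mult_ac)
    finally show ?thesis .
  qed
  then show "rot M ** (kron (transpose (- (diagm ky ** fY))) (mat 1) + kron (diagm ky) fX) =
      (kron fX (mat 1) + kron (diagm (\<lambda>a. 1 / kx a)) (transpose (- (diagm ky ** fY)))) ** rot M"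
    by (auto simp: vec_eq_iff)
qed

lemma (in chain_pair) rot_module_map:
  assumes "uq_module_map r (tensor_rep X Y) (tensor_rep Y X) R"
  shows "uq_module_map r (tensor_rep (dual_rep Y) X) (tensor_rep X (dual_rep Y)) (rot R)"
  unfolding uq_module_map_def
proof
  fix i assume i: "i \<in> {1..r}"
  obtain k where k: "k < r" "i = gidx r sX k" using gidx_cases[OF X.s i] .
  obtain m where m: "m < r" "i = gidx r sY m" using gidx_cases[OF Y.s i] .
  have KX: "Kop X i = diagm (\<lambda>a. kchar X.qc k (lX a))" "Kiop X i = diagm (\<lambda>a. 1 / kchar X.qc k (lX a))"
    unfolding k(2) by (rule X.mats[OF k(1)])+
  have KY: "Kop Y i = diagm (\<lambda>a. kchar X.qc m (lY a))" "Kiop Y i = diagm (\<lambda>a. 1 / kchar X.qc m (lY a))"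
    unfolding m(2) by (rule Y.mats[OF m(1)])+
  have h: "R ** Kop (tensor_rep X Y) i = Kop (tensor_rep Y X) i ** R"
    "R ** Eop (tensor_rep X Y) i = Eop (tensor_rep Y X) i ** R"
    "R ** Fop (tensor_rep X Y) i = Fop (tensor_rep Y X) i ** R"
    using assms i by (auto simp: uq_module_map_def)
  note aux = rot_module_map_aux[where kx = "\<lambda>a. kchar X.qc k (lX a)" and ky = "\<lambda>a. kchar X.qc m (lY a)", OF X.kchar0 X.kchar0
      h[unfolded tensor_rep_def uq_rep.select_convs KX KY]]
  have tr: "transpose (diagm g) = diagm g" for g :: "'j \<Rightarrow> complex" by (rule transpose_diagm)
  show "rot R ** Kop (tensor_rep (dual_rep Y) X) i = Kop (tensor_rep X (dual_rep Y)) i ** rot R \<and>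
     rot R ** Kiop (tensor_rep (dual_rep Y) X) i = Kiop (tensor_rep X (dual_rep Y)) i ** rot R \<and>
     rot R ** Eop (tensor_rep (dual_rep Y) X) i = Eop (tensor_rep X (dual_rep Y)) i ** rot R \<and>
     rot R ** Fop (tensor_rep (dual_rep Y) X) i = Fop (tensor_rep X (dual_rep Y)) i ** rot R"
    unfolding tensor_rep_def dual_rep_def uq_rep.select_convs KX KY tr
    by (intro conjI aux)
qed

lemma leg2_vec: "leg2 M 0 (\<lambda>f. y $ (f 0, f 1)) = (\<lambda>f. (M *v y) $ (f 0, f 1))"
  by (simp add: leg2_def matrix_vector_mult_def scaleC_complex_def fun_eq_iff)

lemma leg3_vec: "leg3 M 0 (\<lambda>f. y $ (f 0, f 1, f 2)) = (\<lambda>f. (M *v y) $ (f 0, f 1, f 2))"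
  by (simp add: leg3_def matrix_vector_mult_def scaleC_complex_def fun_eq_iff numeral_2_eq_2)

lemma matrix_inv_both:
  fixes A :: "complex ^ 'n::finite ^ 'n"
  assumes "invertible A"
  shows "A ** matrix_inv A = mat 1" "matrix_inv A ** A = mat 1"
  using someI_ex[OF assms[unfolded invertible_def]] unfolding matrix_inv_def by auto

lemma invertible_kerI:
  fixes A :: "complex ^ 'n::finite ^ 'n"
  assumes "\<And>x. A *v x = 0 \<Longrightarrow> x = 0"
  shows "A ** matrix_inv A = mat 1" "matrix_inv A ** A = mat 1"
proof -
  obtain B where "B ** A = mat 1" using assms matrix_left_invertible_ker[of A] by blast
  then have "invertible A" using matrix_left_right_inverse unfolding invertible_def by blast
  then show "A ** matrix_inv A = mat 1" "matrix_inv A ** A = mat 1"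
    by (rule matrix_inv_both)+
qed

lemma Rmat_ker:
  fixes y :: "complex ^ ('i::finite \<times> 'i)"
  assumes "inj l" "q \<noteq> 0" "z \<noteq> 0" "Rmat z q l *v y = 0"
  shows "y = 0"
proof -
  define x :: "('i, complex) fam" where "x = (\<lambda>f. y $ (f 0, f 1))"
  have "leg2 (Rmat z q l) 0 x = 0" unfolding x_def leg2_vec assms(4) by (simp add: fun_eq_iff)
  then have "z\<^sup>2 *\<^sub>C x = 0"
    using Rmat_hecke[OF assms(1,2), of z 0 x] by (simp add: leg2_def fun_eq_iff)
  then have x: "x f = 0" for f using assms(3) by (auto simp: fun_eq_iff scaleC_complex_def)
  have "y $ (a, b) = 0" for a b using x[of "\<lambda>n. if n = 0 then a else b"] by (simp add: x_def)
  then show ?thesis by (auto simp: vec_eq_iff)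
qed

lemma Rmat_nth: "Rmat z q l $ (a, b) $ (i, j) =
    (if i = b \<and> j = a then z * (if a = b then q else 1) else 0) +
    (if i = a \<and> j = b then z * (if l b < l a then q - 1 / q else 0) else 0)"
  unfolding Rmat_def vec_lambda_beta fst_conv snd_conv prod.inject ..

text \<open>The rotated R-matrix is a flip off the diagonal and triangular with respect to the order of the indices on the span of the
  \<open>v\<^sub>i \<otimes> f\<^sup>i\<close>, so its kernel vanishes by downward induction along the order.\<close>

lemma rot_Rmat_ker:
  fixes y :: "complex ^ ('i::finite \<times> 'i)" and l :: "'i \<Rightarrow> int"
  assumes "inj l" "q \<noteq> 0" "z \<noteq> 0" "rot (Rmat z q l) *v y = 0"
  shows "y = 0"
proof -
  have eq: "(rot (Rmat z q l) *v y) $ (a, k) = (z * (if k = a then q else 1)) * y $ (k, a) +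
     (if a = k then (\<Sum>i\<in>UNIV. (z * (if l a < l i then q - 1 / q else 0)) * y $ (i, i)) else 0)" for a k
  proof -
    have "(rot (Rmat z q l) *v y) $ (a, k) = (\<Sum>i\<in>UNIV. \<Sum>j\<in>UNIV.
       (if j = a then if i = k then (z * (if k = a then q else 1)) * y $ (k, a) else 0 else 0) +
       (if j = i then if a = k then (z * (if l a < l i then q - 1 / q else 0)) * y $ (i, i) else 0 else 0))"
      unfolding matrix_vector_mult_def vec_lambda_beta sum_pair
    proof (intro sum.cong refl)
      fix i j
      show "rot (Rmat z q l) $ (a, k) $ (i, j) * y $ (i, j) =
       (if j = a then if i = k then (z * (if k = a then q else 1)) * y $ (k, a) else 0 else 0) +
       (if j = i then if a = k then (z * (if l a < l i then q - 1 / q else 0)) * y $ (i, i) else 0 else 0)"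
        unfolding rot_def vec_lambda_beta fst_conv snd_conv Rmat_nth distrib_right
        by (cases "j = a"; cases "k = i"; cases "j = i"; cases "k = a") simp_all
    qed
    then show ?thesis by (simp add: sum.distrib)
  qed
  have off: "y $ (k, a) = 0" if "k \<noteq> a" for a k
    using eq[of a k] assms that by simp
  have "\<forall>a. Max (range l) - l a = int n \<longrightarrow> y $ (a, a) = 0" for n
  proof (induction n rule: less_induct)
    case (less n)
    show ?case
    proof (intro allI impI)
      fix a assume a: "Max (range l) - l a = int n"
      have "(\<Sum>i\<in>UNIV. (z * (if l a < l i then q - 1 / q else 0)) * y $ (i, i)) = 0"
      proof (rule sum.neutral, rule ballI)
        fix i :: 'i
        show "(z * (if l a < l i then q - 1 / q else 0)) * y $ (i, i) = 0"
        proof (cases "l a < l i")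
          case True
          have "l i \<le> Max (range l)" by (rule Max_ge) auto
          then have "Max (range l) - l i = int (nat (Max (range l) - l i))" "nat (Max (range l) - l i) < n"
            using a True by (simp_all add: nat_less_iff)
          then have "y $ (i, i) = 0" using less by blast
          then show ?thesis by simp
        qed simp
      qed
      then show "y $ (a, a) = 0" using eq[of a a] assms by simp
    qed
  qed
  then have diag: "y $ (a, a) = 0" for a
  proof -
    have "l a \<le> Max (range l)" by (rule Max_ge) auto
    then have "Max (range l) - l a = int (nat (Max (range l) - l a))" by simp
    then show ?thesis using \<open>\<And>n. \<forall>a. Max (range l) - l a = int n \<longrightarrow> y $ (a, a) = 0\<close> by blast
  qed
  have "y $ (a, b) = 0" for a b by (cases "a = b") (simp_all add: diag off)
  then show ?thesis by (auto simp: vec_eq_iff)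
qed

lemma matvec_axis:
  fixes A :: "complex ^ 'n::finite ^ 'm::finite"
  shows "(A *v axis k 1) $ a = A $ a $ k"
proof -
  have "(A *v axis k 1) $ a = (\<Sum>j\<in>UNIV. if j = k then A $ a $ k else 0)"
    unfolding matrix_vector_mult_def vec_lambda_beta axis_def by (rule sum.cong) simp_all
  then show ?thesis by simp
qed

lemma axis_component: "axis k c $ a = (if a = k then c else 0)"
  by (simp add: axis_def)

lemma Rmat_kron_axis:
  "Rmat z q l *v kron_vec (axis i 1) (axis j 1) =
     (z * (if i = j then q else 1)) *\<^sub>C kron_vec (axis j 1) (axis i 1) +
     (z * (if l j < l i then q - 1 / q else 0)) *\<^sub>C kron_vec (axis i 1) (axis j 1)"
  unfolding axis_pair[symmetric] vec_eq_iff split_paired_All matvec_axis vector_add_component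
    vec_scaleC_nth axis_component Rmat_nth scaleC_complex_def prod.inject
proof (intro allI)
  fix a b
  show "(if i = b \<and> j = a then z * (if a = b then q else 1) else 0) +
      (if i = a \<and> j = b then z * (if l b < l a then q - 1 / q else 0) else 0) =
    z * (if i = j then q else 1) * (if a = j \<and> b = i then 1 else 0) +
      z * (if l j < l i then q - 1 / q else 0) * (if a = i \<and> b = j then 1 else 0)"
    by (cases "i = b"; cases "j = a"; cases "i = a"; cases "j = b") simp_all
qed

lemma inv_module_map:
  fixes A :: "complex ^ 'n::finite ^ 'n"
  assumes "A ** matrix_inv A = mat 1" "matrix_inv A ** A = mat 1" "A ** K = K' ** A"
  shows "matrix_inv A ** K' = K ** matrix_inv A"
proof -
  have "matrix_inv A ** K' = matrix_inv A ** (K' ** A) ** matrix_inv A"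
    by (simp add: matrix_mul_assoc[symmetric] assms(1))
  also have "\<dots> = K ** matrix_inv A"
    unfolding assms(3)[symmetric] by (simp add: matrix_mul_assoc assms(2))
  finally show ?thesis .
qed

lemma matrix_inv_unique':
  fixes A :: "complex ^ 'n::finite ^ 'n"
  assumes "B ** A = mat 1" "A ** B = mat 1"
  shows "matrix_inv A = B"
proof -
  have "invertible A" using assms unfolding invertible_def by blast
  then have "matrix_inv A ** A = mat 1" by (rule matrix_inv_both)
  then have "matrix_inv A ** A ** B = B" by simp
  then show ?thesis by (simp add: matrix_mul_assoc[symmetric] assms(2))
qed

text \<open>The partial quantum traces of the R-matrix telescope, which makes the closure of the
  crossing a scalar.\<close>

lemma sum_q_telescope:
  assumes "0 < q"
  shows "(\<Sum>k<n. qpow q (real r - 2 * real k) * (of_real q - 1 / of_real q)) = qpow q (real r + 1) - qpow q (real r + 1 - 2 * real n)"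
proof (induction n)
  case (Suc n)
  have "qpow q (real r - 2 * real n) * of_real q = qpow q (real r + 1 - 2 * real n)"
    "qpow q (real r - 2 * real n) * (1 / of_real q) = qpow q (real r + 1 - 2 * real (Suc n))"
    using qpow_values(6)[OF assms, of "real r - 2 * real n" 1] qpow_values(6)[OF assms, of "real r - 2 * real n" "-1"]
    by (simp_all add: qpow_values(1,2)[OF assms] algebra_simps)
  then show ?case unfolding sum.lessThan_Suc Suc unfolding right_diff_distrib by simp
qed simp

text \<open>The exponents of the braidings on extremal vectors are \<open>- 1 / (r + 1)\<close> for two equal factors and
  \<open>- w\<close> for \<open>V\<close> and \<open>V\<^sup>*\<close>. The first fixes the scalar \<open>z\<close> of the R-matrix; the second then holds for the inverse
  of its rotation, as \<open>w = 1 - 1 / (r + 1)\<close>. The trace condition follows from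
  \<open>(\<lambda>\<^sub>i, 2\<rho>) = r - 2 l i\<close> for the position \<open>l i\<close> in the chain.\<close>

lemma quantum_braidings:
  fixes V :: "'i::finite uq_rep"
  assumes qd: "quantum_data r s q V wt"
  obtains l :: "'i \<Rightarrow> int" and z \<kappa> :: complex where
    "leg_calculus (of_real q) z l (braiding r q V (dual_rep V)) (matrix_inv (braiding r q (dual_rep V) (dual_rep V)))
       (\<lambda>i. qpow q (wform r (wt i) (two_rho r))) \<kappa>"
    "braiding r q V V = Rmat z (of_real q) l"
    "matrix_inv (braiding r q V (dual_rep V)) = rot (Rmat z (of_real q) l)"
    "z * of_real q = qpow q (w_const r s)" "\<kappa> = z * of_real q * qpow q (m_const r s)"
proof -
  have r: "1 \<le> r" and s: "s \<in> {1, r}" and q: "0 < q" "q < 1"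
    using qd by (auto simp: quantum_data_def)
  let ?q = "complex_of_real q"
  obtain l x where ch: "chain r ?q s V l x"
    and D: "\<And>i m. m < r \<Longrightarrow> qpow q (wform r (simple_root (gidx r s m)) (wt i)) = kchar ?q m (l i)"
    using quantum_chain[OF qd] by blast
  interpret V: chain_rep r s q V l x using r s q ch by unfold_locales
  note dV = V.dual_chain_rep
  interpret dV: chain_rep r "r + 1 - s" q "dual_rep V" "\<lambda>a. r - l a" "\<lambda>k. - (x (r - 1 - k) * ?q)" by (rule dV)
  \<comment> \<open>the value of the braiding on a highest times a lowest weight vector, read off from the flip part of \<open>Rmat\<close>\<close>
  define z where "z = qpow q (- (1 / (real r + 1)))"
  define L where "L = (\<lambda>a. int (l a))"
  define R where "R = Rmat z ?q L"
  have z0: "z \<noteq> 0" using q by (simp add: z_def qpow_def)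
  have q0: "?q \<noteq> 0" using q by simp
  have injL: "inj L" "inj (\<lambda>a. - L a)" using V.bl(2) by (auto simp: L_def inj_on_def intro: bij_betw_imp_inj_on[OF V.l, THEN injD])
  have zq: "z * ?q = qpow q (w_const r s)"
  proof -
    have "z * ?q = qpow q (- (1 / (real r + 1)) + 1)" by (simp only: z_def qpow_values[OF q(1)])
    also have "- (1 / (real r + 1)) + 1 = w_const r s" by (simp add: const_values[OF r s] field_simps)
    finally show ?thesis .
  qed
  have ss: "r + 1 - (r + 1 - s) = s" using V.s_range by auto
  have s': "r + 1 - s \<in> {1, r}" using V.s_range by auto
  have f1: "wform r (fund_weight r s) (w0 r (fund_weight r s)) = - (1 / (real r + 1))"
    by (simp only: wform_w0_fund[OF V.s_range(1)] minuscule_forms[OF r s])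
  have f2: "wform r (fund_weight r s) (w0 r (fund_weight r (r + 1 - s))) = - w_const r s"
    unfolding wform_w0_fund[OF V.s_range(2)] ss w_const_def ..
  have f3: "wform r (fund_weight r (r + 1 - s)) (w0 r (fund_weight r (r + 1 - s))) = - (1 / (real r + 1))"
    by (simp only: wform_w0_fund[OF V.s_range(2)] minuscule_forms[OF r s'])
  define u where "u = inv l 0"
  define e where "e = inv l r"
  have lo: "l u = 0" "l e = r" using V.bl(1) by (simp_all add: u_def e_def)
  have oe: "u \<noteq> e" using lo r by auto
  have dv: "inv (\<lambda>a. r - l a) r = u" "inv (\<lambda>a. r - l a) 0 = e"
    using dV.bl(6)[of r u] dV.bl(6)[of 0 e] lo by auto
  interpret VV: chain_pair r s s q V V l x l x by unfold_locales
  have mR: "uq_module_map r (tensor_rep V V) (tensor_rep V V) R" unfolding R_def L_def by (rule V.Rmat_module_map)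
  have bVV: "braiding r q V V = R"
  proof (rule VV.braiding_eqI[OF mR])
    show "R *v kron_vec (axis (inv l 0) 1) (axis (inv l r) 1) =
      qpow q (wform r (fund_weight r s) (w0 r (fund_weight r s))) *\<^sub>C kron_vec (axis (inv l r) 1) (axis (inv l 0) 1)"
      unfolding f1 R_def Rmat_kron_axis u_def[symmetric] e_def[symmetric] using oe lo by (simp add: L_def z_def)
  qed
  have mC: "uq_module_map r (tensor_rep (dual_rep V) V) (tensor_rep V (dual_rep V)) (rot R)"
    by (rule VV.rot_module_map[OF mR])
  have inv: "rot R ** matrix_inv (rot R) = mat 1" "matrix_inv (rot R) ** rot R = mat 1"
    using invertible_kerI[of "rot R"] rot_Rmat_ker[OF injL(1) q0 z0] unfolding R_def by auto
  interpret VdV: chain_pair r s "r + 1 - s" q V "dual_rep V" l x "\<lambda>a. r - l a" "\<lambda>k. - (x (r - 1 - k) * ?q)" by unfold_locales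
  have bVdV: "braiding r q V (dual_rep V) = matrix_inv (rot R)"
  proof (rule VdV.braiding_eqI)
    show "uq_module_map r (tensor_rep V (dual_rep V)) (tensor_rep (dual_rep V) V) (matrix_inv (rot R))"
      using mC unfolding uq_module_map_def by (simp add: inv_module_map[OF inv])
    have "rot R *v axis (u, u) 1 = (z * ?q) *\<^sub>C axis (u, u) 1"
    proof -
      have "rot R $ (a, k) $ (u, u) = (if a = u \<and> k = u then z * ?q else 0)" for a k
        by (auto simp: rot_def R_def Rmat_nth L_def lo)
      then show ?thesis
        unfolding vec_eq_iff
        by (simp add: split_paired_all matvec_axis axis_component scaleC_complex_def)
    qed
    then have "matrix_inv (rot R) *v (rot R *v axis (u, u) 1) = (z * ?q) *\<^sub>C (matrix_inv (rot R) *v axis (u, u) 1)"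
      by (simp add: matvec_scaleC)
    then have "axis (u, u) 1 = (z * ?q) *\<^sub>C (matrix_inv (rot R) *v axis (u, u) 1)"
      by (simp add: matrix_vector_mul_assoc inv)
    from arg_cong[OF this, of "scaleC (1 / (z * ?q))"]
    have "(1 / (z * ?q)) *\<^sub>C axis (u, u) 1 = ((1 / (z * ?q)) * (z * ?q)) *\<^sub>C (matrix_inv (rot R) *v axis (u, u) 1)"
      unfolding scaleC_scaleC .
    then have "(1 / (z * ?q)) *\<^sub>C axis (u, u) 1 = matrix_inv (rot R) *v axis (u, u) 1"
      using z0 q0 by (simp add: scaleC_one)
    moreover have "1 / (z * ?q) = qpow q (- w_const r s)" by (simp only: zq qpow_values[OF q(1)])
    ultimately show "matrix_inv (rot R) *v kron_vec (axis (inv l 0) 1) (axis (inv (\<lambda>a. r - l a) r) 1) =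
      qpow q (wform r (fund_weight r s) (w0 r (fund_weight r (r + 1 - s)))) *\<^sub>C kron_vec (axis (inv (\<lambda>a. r - l a) r) 1) (axis (inv l 0) 1)"
      unfolding f2 dv u_def[symmetric] axis_pair[symmetric] by simp
  qed
  interpret dVV: chain_pair r "r + 1 - s" s q "dual_rep V" V "\<lambda>a. r - l a" "\<lambda>k. - (x (r - 1 - k) * ?q)" l x by unfold_locales
  interpret dVdV: chain_pair r "r + 1 - s" "r + 1 - s" q "dual_rep V" "dual_rep V"
      "\<lambda>a. r - l a" "\<lambda>k. - (x (r - 1 - k) * ?q)" "\<lambda>a. r - l a" "\<lambda>k. - (x (r - 1 - k) * ?q)" by unfold_locales
  have bdVdV: "braiding r q (dual_rep V) (dual_rep V) = Rmat z ?q (\<lambda>a. - L a)"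
  proof (rule dVdV.braiding_eqI)
    show "uq_module_map r (tensor_rep (dual_rep V) (dual_rep V)) (tensor_rep (dual_rep V) (dual_rep V)) (Rmat z ?q (\<lambda>a. - L a))"
      using dVV.rot_module_map[OF mC] by (simp add: R_def rot_rot_Rmat)
    show "Rmat z ?q (\<lambda>a. - L a) *v kron_vec (axis (inv (\<lambda>a. r - l a) 0) 1) (axis (inv (\<lambda>a. r - l a) r) 1) =
       qpow q (wform r (fund_weight r (r + 1 - s)) (w0 r (fund_weight r (r + 1 - s)))) *\<^sub>C
        kron_vec (axis (inv (\<lambda>a. r - l a) r) 1) (axis (inv (\<lambda>a. r - l a) 0) 1)"
      unfolding f3 Rmat_kron_axis dv using oe lo by (simp add: L_def z_def)
  qed
  have mi: "matrix_inv (matrix_inv (rot R)) = rot R"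
    by (rule matrix_inv_unique'[OF inv])
  have wt: "wform r (wt i) (two_rho r) = real r - 2 * real (l i)" for i
    by (rule weight_two_rho[OF r s q V.bl(3) D])
  have lbij: "bij_betw l {b. l b < n} {..<n}" if "n \<le> r" for n
    unfolding bij_betw_def
  proof
    show "inj_on l {b. l b < n}" using bij_betw_imp_inj_on[OF V.l] by (rule inj_on_subset) simp
    show "l ` {b. l b < n} = {..<n}"
    proof
      show "{..<n} \<subseteq> l ` {b. l b < n}"
      proof
        fix k assume "k \<in> {..<n}"
        then have "l (inv l k) = k" "k < n" using V.bl(1)[of k] that by auto
        then show "k \<in> l ` {b. l b < n}" by (metis (mono_tags, lifting) image_eqI mem_Collect_eq)
      qed
    qed auto
  qed
  define \<kappa> where "\<kappa> = z * ?q * qpow q (m_const r s)"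
  have "leg_calculus ?q z L (matrix_inv (rot R)) (matrix_inv (Rmat z ?q (\<lambda>a. - L a)))
       (\<lambda>i. qpow q (wform r (wt i) (two_rho r))) \<kappa>"
  proof
    show "?q \<noteq> 0" "z \<noteq> 0" "inj L" by (fact q0 z0 injL)+
    show "\<kappa> \<noteq> 0" using q0 z0 qpow_values(8)[OF q(1)] by (simp add: \<kappa>_def)
    show "matrix_inv (rot R) ** rot (Rmat z ?q L) = mat 1" "rot (Rmat z ?q L) ** matrix_inv (rot R) = mat 1"
      using inv by (simp_all add: R_def)
    show "matrix_inv (Rmat z ?q (\<lambda>a. - L a)) ** Rmat z ?q (\<lambda>i. - L i) = mat 1"
      "Rmat z ?q (\<lambda>i. - L i) ** matrix_inv (Rmat z ?q (\<lambda>a. - L a)) = mat 1"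
      using invertible_kerI[of "Rmat z ?q (\<lambda>a. - L a)"] Rmat_ker[OF injL(2) q0 z0] by auto
    fix i j
    show "(\<Sum>b\<in>UNIV. qpow q (wform r (wt b) (two_rho r)) * rot (Rmat z ?q L) $ (b, b) $ (i, j)) = (if i = j then \<kappa> else 0)"
    proof (cases "i = j")
      case False
      then show ?thesis by (auto simp: rot_def Rmat_nth intro!: sum.neutral)
    next
      case True
      have "(\<Sum>b\<in>UNIV. qpow q (wform r (wt b) (two_rho r)) * rot (Rmat z ?q L) $ (b, b) $ (i, j)) =
        (\<Sum>b\<in>UNIV. (if b = i then qpow q (real r - 2 * real (l i)) * (z * ?q) else 0) +
           (if l b < l i then z * (qpow q (real r - 2 * real (l b)) * (?q - 1 / ?q)) else 0))"
        by (rule sum.cong) (auto simp: rot_def Rmat_nth True wt L_def distrib_left)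
      also have "\<dots> = qpow q (real r - 2 * real (l i)) * (z * ?q) + (\<Sum>b\<in>{b. l b < l i}. z * (qpow q (real r - 2 * real (l b)) * (?q - 1 / ?q)))"
        by (simp add: sum.distrib sum.If_cases)
      also have "(\<Sum>b\<in>{b. l b < l i}. z * (qpow q (real r - 2 * real (l b)) * (?q - 1 / ?q))) =
          (\<Sum>k<l i. z * (qpow q (real r - 2 * real k) * (?q - 1 / ?q)))"
        by (rule sum.reindex_bij_betw[OF lbij[OF V.bl(3)]])
      also have "\<dots> = z * (qpow q (real r + 1) - qpow q (real r + 1 - 2 * real (l i)))"
        by (simp only: sum_distrib_left[symmetric] sum_q_telescope[OF q(1)])
      also have "qpow q (real r - 2 * real (l i)) * (z * ?q) = z * qpow q (real r + 1 - 2 * real (l i))"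
        using qpow_values(6)[OF q(1), of "real r - 2 * real (l i)" 1] by (simp add: qpow_values(1)[OF q(1)] algebra_simps)
      finally show ?thesis using True qpow_values(6)[OF q(1), of "real r" 1]
        by (simp add: \<kappa>_def const_values[OF r s] qpow_values(1)[OF q(1)] algebra_simps)
    qed
  qed
  then show ?thesis
    using that[of z L \<kappa>] bVV mi zq unfolding bVdV bdVdV R_def \<kappa>_def by simp
qed

section \<open>Presentations by generators and relations\<close>

lemma lookup_scaleC: "Poly_Mapping.lookup (c *\<^sub>C f) x = c * Poly_Mapping.lookup f x"
  by (simp add: scaleC_poly_mapping_def Poly_Mapping.map.rep_eq when_def scaleC_complex_def)

lemma lin_ext_superset:
  assumes "finite K" "Poly_Mapping.keys f \<subseteq> K"
  shows "lin_ext \<phi> f = (\<Sum>x\<in>K. Poly_Mapping.lookup f x *\<^sub>C \<phi> x)"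
  unfolding lin_ext_def
  by (rule sum.mono_neutral_left) (use assms in \<open>auto simp: in_keys_iff\<close>)

lemma lin_lin_ext: "lin (lin_ext \<phi>)"
  unfolding lin_def
proof (intro conjI allI)
  fix f g :: "'a \<Rightarrow>\<^sub>0 complex" and c :: complex
  let ?K = "Poly_Mapping.keys f \<union> Poly_Mapping.keys g"
  have "lin_ext \<phi> (f + g) = (\<Sum>x\<in>?K. Poly_Mapping.lookup (f + g) x *\<^sub>C \<phi> x)"
    by (rule lin_ext_superset) (auto dest: subsetD[OF Poly_Mapping.keys_add])
  moreover have "lin_ext \<phi> f = (\<Sum>x\<in>?K. Poly_Mapping.lookup f x *\<^sub>C \<phi> x)"
    "lin_ext \<phi> g = (\<Sum>x\<in>?K. Poly_Mapping.lookup g x *\<^sub>C \<phi> x)"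
    by (rule lin_ext_superset; simp)+
  ultimately show "lin_ext \<phi> (f + g) = lin_ext \<phi> f + lin_ext \<phi> g"
    by (simp add: lookup_add scaleC_add_left sum.distrib)
  have "lin_ext \<phi> (c *\<^sub>C f) = (\<Sum>x\<in>Poly_Mapping.keys f. Poly_Mapping.lookup (c *\<^sub>C f) x *\<^sub>C \<phi> x)"
    by (rule lin_ext_superset) (auto simp: in_keys_iff lookup_scaleC)
  then show "lin_ext \<phi> (c *\<^sub>C f) = c *\<^sub>C lin_ext \<phi> f"
    by (simp add: lin_ext_def scaleC_sum scaleC_scaleC lookup_scaleC)
qed

lemma lin_ext_single: "lin_ext \<phi> (Poly_Mapping.single w c) = c *\<^sub>C \<phi> w"
  using lin_ext_superset[of "{w}" "Poly_Mapping.single w c" \<phi>] by (simp split: if_splits)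

text \<open>Used to see a relation \<open>\<rho>\<close> as the element \<open>u \<rho> v\<close> of the ideal with empty words \<open>u\<close> and \<open>v\<close>.\<close>

lemma lin_ext_ident:
  fixes f :: "'x \<Rightarrow>\<^sub>0 complex"
  shows "lin_ext (\<lambda>w. Poly_Mapping.single w 1) f = f"
proof (rule poly_mapping_eqI)
  fix w :: 'x
  have "Poly_Mapping.lookup (lin_ext (\<lambda>w. Poly_Mapping.single w 1) f) w =
      (\<Sum>x\<in>Poly_Mapping.keys f. Poly_Mapping.lookup f x * Poly_Mapping.lookup (Poly_Mapping.single x 1) w)"
    by (simp add: lin_ext_def lookup_sum lookup_scaleC)
  also have "\<dots> = (\<Sum>x\<in>Poly_Mapping.keys f. if x = w then Poly_Mapping.lookup f w else 0)"
    by (rule sum.cong) (auto simp: lookup_single when_def)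
  also have "\<dots> = Poly_Mapping.lookup f w" by (auto simp: in_keys_iff)
  finally show "Poly_Mapping.lookup (lin_ext (\<lambda>w. Poly_Mapping.single w 1) f) w = Poly_Mapping.lookup f w" .
qed

lemma lin_diff: "lin h \<Longrightarrow> h (x - y) = h x - h y"
  using linD(1)[of h "x - y" y] by simp

lemma presented_algebra_relation:
  assumes "presented_algebra gen R" "\<rho> \<in> R"
  shows "lin_ext (\<lambda>w. prod_list (map gen w)) \<rho> = 0"
proof -
  let ?I = "{lin_ext (\<lambda>w. Poly_Mapping.single (u @ w @ v) (1 :: complex)) \<rho> | u v \<rho>. \<rho> \<in> R}"
  have "lin_ext (\<lambda>w. Poly_Mapping.single ([] @ w @ []) (1 :: complex)) \<rho> \<in> ?I" using assms(2) by blast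
  then have "\<rho> \<in> ?I" by (simp only: append_Nil append_Nil2 lin_ext_ident)
  then have "\<rho> \<in> complex_space.span ?I" by (rule complex_space.span_base)
  then show ?thesis
    by (rule iffD2[OF spec[OF conjunct2[OF assms(1)[unfolded presented_algebra_def presented_space_def]]]])
qed

lemma act_lin:
  assumes "lin h"
  shows "h (act123 A x i j k m) = act123 A (\<lambda>i j k m. h (x i j k m)) i j k m"
    "h (act234 A x i j k m) = act234 A (\<lambda>i j k m. h (x i j k m)) i j k m"
    "h (E'12 r q wt y) = E'12 r q wt (\<lambda>i j. h (y i j))"
  by (simp_all add: act123_def act234_def E'12_def lin_sum[OF assms] linD[OF assms] split_def)

lemma algebra_B_relations:
  assumes "is_algebra_B r s q V wt p"
  shows "act123 (S_map r q V) (fam_prod (*) p p) = qpow q (w_const r s) *\<^sub>C fam_prod (*) p p"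
    "act234 (St_map r q V) (fam_prod (*) p p) = qpow q (- w_const r s) *\<^sub>C fam_prod (*) p p"
    "E'12 r q wt p = qpow q (m_const r s) *\<^sub>C 1"
proof -
  define h where "h = lin_ext (\<lambda>w. prod_list (map (\<lambda>(i, j). p i j) w))"
  have lin: "lin h" unfolding h_def by (rule lin_lin_ext)
  have rel: "h \<rho> = 0" if "\<rho> \<in> algebra_relations r s q V wt" for \<rho>
    using presented_algebra_relation[OF assms[unfolded is_algebra_B_def] that] by (simp add: h_def)
  have pp: "(\<lambda>i j k m. h (Poly_Mapping.single [(i, j), (k, m)] 1)) = fam_prod (*) p p"
    "(\<lambda>i j. h (Poly_Mapping.single [(i, j)] 1)) = p" "h (Poly_Mapping.single [] c) = c *\<^sub>C 1" for c
    by (simp_all add: h_def lin_ext_single fam_prod_def scaleC_one)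
  note pp' = fun_cong[OF fun_cong[OF fun_cong[OF fun_cong[OF pp(1)]]]]
  show "act123 (S_map r q V) (fam_prod (*) p p) = qpow q (w_const r s) *\<^sub>C fam_prod (*) p p"
  proof (intro ext)
    fix i j k m
    let ?pp = "\<lambda>i j k m. Poly_Mapping.single [(i, j), (k, m)] 1"
    have "h (act123 (S_map r q V) ?pp i j k m - qpow q (w_const r s) *\<^sub>C ?pp i j k m) = 0"
      by (rule rel) (unfold algebra_relations_def Let_def, blast)
    then show "act123 (S_map r q V) (fam_prod (*) p p) i j k m = (qpow q (w_const r s) *\<^sub>C fam_prod (*) p p) i j k m"
      by (simp add: lin_diff[OF lin] linD[OF lin] act_lin[OF lin] pp pp')
  qed
  show "act234 (St_map r q V) (fam_prod (*) p p) = qpow q (- w_const r s) *\<^sub>C fam_prod (*) p p"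
  proof (intro ext)
    fix i j k m
    let ?pp = "\<lambda>i j k m. Poly_Mapping.single [(i, j), (k, m)] 1"
    have "h (act234 (St_map r q V) ?pp i j k m - qpow q (- w_const r s) *\<^sub>C ?pp i j k m) = 0"
      by (rule rel) (unfold algebra_relations_def Let_def, blast)
    then show "act234 (St_map r q V) (fam_prod (*) p p) i j k m = (qpow q (- w_const r s) *\<^sub>C fam_prod (*) p p) i j k m"
      by (simp add: lin_diff[OF lin] linD[OF lin] act_lin[OF lin] pp pp')
  qed
  have "h (E'12 r q wt (\<lambda>i j. Poly_Mapping.single [(i, j)] 1) - Poly_Mapping.single [] (qpow q (m_const r s))) = 0"
    by (rule rel) (unfold algebra_relations_def Let_def, blast)
  then show "E'12 r q wt p = qpow q (m_const r s) *\<^sub>C 1"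
    by (simp add: lin_diff[OF lin] act_lin[OF lin] pp)
qed

text \<open>Evaluation of the free module at the generators kills the relations. Applied to the
  formal relations of a calculus, it turns them into identities between families of forms.\<close>

lemma left_module_evaluation:
  assumes "bimodule M" "presented_left_module M gen R"
  obtains h where "lin h" "\<And>b c. h (b *s c) = lact M b (h c)" "\<And>k. h (axis k 1) = gen k"
    "\<And>c. c \<in> R \<Longrightarrow> h c = 0"
proof
  note bl = bilinD[OF bimodule_bilin(1)[OF assms(1)]] and ll = bimodule_bilin[OF assms(1)]
  define h where "h = (\<lambda>c. \<Sum>k\<in>UNIV. lact M (c $ k) (gen k))"
  show "lin h" by (simp add: lin_def h_def bl sum.distrib scaleC_sum)
  have "lin (lact M b)" for b using ll(1) by (simp add: bilin_def)
  then show "h (b *s c) = lact M b (h c)" for b c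
    by (simp add: h_def lin_sum ll(3))
  show "h (axis k 1) = gen k" for k
  proof -
    have "h (axis k 1) = (\<Sum>j\<in>UNIV. if j = k then lact M 1 (gen k) else 0)"
      unfolding h_def by (rule sum.cong) (auto simp: axis_def bl)
    then show ?thesis using ll(6)[of 1 "gen k"] by (simp add: scaleC_one)
  qed
  show "c \<in> R \<Longrightarrow> h c = 0" for c
    using assms(2) left_submodule_generated.base unfolding presented_left_module_def h_def by blast
qed

lemma Omega_plus_relations:
  assumes "is_Omega_plus r s q V wt p M del"
  defines "dp \<equiv> \<lambda>i j. del (p i j)"
  shows "bimodule M"
    "act234 (St_map r q V) (fam_prod (lact M) p dp) = qpow q (- w_const r s) *\<^sub>C fam_prod (lact M) p dp"
    "E'12 r q wt dp = 0"
    "fam_prod (ract M) dp p = qpow q (a_const r s) *\<^sub>C T_act r q V (fam_prod (lact M) p dp)"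
    "\<exists>c. x = (\<Sum>k\<in>UNIV. lact M (c k) (dp (fst k) (snd k)))"
proof -
  note o = assms(1)[unfolded is_Omega_plus_def Let_def, folded dp_def]
  show M: "bimodule M" using o by blast
  show "fam_prod (ract M) dp p = qpow q (a_const r s) *\<^sub>C T_act r q V (fam_prod (lact M) p dp)"
    using o by (simp add: fun_eq_iff dp_def)
  have pl: "presented_left_module M (\<lambda>(i, j). del (p i j)) (plus_relations r s q V wt p)"
    using assms(1) unfolding is_Omega_plus_def by blast
  obtain c where "x = (\<Sum>k\<in>UNIV. lact M (c $ k) (case k of (i, j) \<Rightarrow> del (p i j)))"
    using pl unfolding presented_left_module_def by blast
  then show "\<exists>c. x = (\<Sum>k\<in>UNIV. lact M (c k) (dp (fst k) (snd k)))"
    unfolding split_def dp_def by blast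
  obtain h where lin: "lin h" and h: "\<And>b c. h (b *s c) = lact M b (h c)"
    "\<And>k. h (axis k 1) = (case k of (i, j) \<Rightarrow> del (p i j))" "\<And>c. c \<in> plus_relations r s q V wt p \<Longrightarrow> h c = 0"
    using left_module_evaluation[OF M pl] by blast
  let ?dp = "\<lambda>i j. axis (i, j) 1 :: 'b ^ ('a \<times> 'a)"
  have "h (act234 (St_map r q V) (fam_prod (*s) p ?dp) i j k l - qpow q (- w_const r s) *\<^sub>C fam_prod (*s) p ?dp i j k l) = 0" for i j k l
    by (rule h(3)) (auto simp: plus_relations_def Let_def)
  then show "act234 (St_map r q V) (fam_prod (lact M) p dp) = qpow q (- w_const r s) *\<^sub>C fam_prod (lact M) p dp"
    by (simp add: lin_diff[OF lin] linD[OF lin] act_lin[OF lin] fam_prod_def h(1,2) fun_eq_iff dp_def)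
  have "h (E'12 r q wt ?dp) = 0" by (rule h(3)) (auto simp: plus_relations_def Let_def)
  then show "E'12 r q wt dp = 0" by (simp add: act_lin[OF lin] h(2) dp_def)
qed

lemma Omega_minus_relations:
  assumes "is_Omega_minus r s q V wt p M delbar"
  defines "dp \<equiv> \<lambda>i j. delbar (p i j)"
  shows "bimodule M"
    "act123 (S_map r q V) (fam_prod (lact M) p dp) = qpow q (w_const r s) *\<^sub>C fam_prod (lact M) p dp"
    "E'12 r q wt dp = 0"
    "fam_prod (ract M) dp p = qpow q (- a_const r s) *\<^sub>C T_act r q V (fam_prod (lact M) p dp)"
    "\<exists>c. x = (\<Sum>k\<in>UNIV. lact M (c k) (dp (fst k) (snd k)))"
proof -
  note o = assms(1)[unfolded is_Omega_minus_def Let_def, folded dp_def]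
  show M: "bimodule M" using o by blast
  show "fam_prod (ract M) dp p = qpow q (- a_const r s) *\<^sub>C T_act r q V (fam_prod (lact M) p dp)"
    using o by (simp add: fun_eq_iff dp_def)
  have pl: "presented_left_module M (\<lambda>(i, j). delbar (p i j)) (minus_relations r s q V wt p)"
    using assms(1) unfolding is_Omega_minus_def by blast
  obtain c where "x = (\<Sum>k\<in>UNIV. lact M (c $ k) (case k of (i, j) \<Rightarrow> delbar (p i j)))"
    using pl unfolding presented_left_module_def by blast
  then show "\<exists>c. x = (\<Sum>k\<in>UNIV. lact M (c k) (dp (fst k) (snd k)))"
    unfolding split_def dp_def by blast
  obtain h where lin: "lin h" and h: "\<And>b c. h (b *s c) = lact M b (h c)"
    "\<And>k. h (axis k 1) = (case k of (i, j) \<Rightarrow> delbar (p i j))" "\<And>c. c \<in> minus_relations r s q V wt p \<Longrightarrow> h c = 0"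
    using left_module_evaluation[OF M pl] by blast
  let ?dp = "\<lambda>i j. axis (i, j) 1 :: 'b ^ ('a \<times> 'a)"
  have "h (act123 (S_map r q V) (fam_prod (*s) p ?dp) i j k l - qpow q (w_const r s) *\<^sub>C fam_prod (*s) p ?dp i j k l) = 0" for i j k l
    by (rule h(3)) (auto simp: minus_relations_def Let_def)
  then show "act123 (S_map r q V) (fam_prod (lact M) p dp) = qpow q (w_const r s) *\<^sub>C fam_prod (lact M) p dp"
    by (simp add: lin_diff[OF lin] linD[OF lin] act_lin[OF lin] fam_prod_def h(1,2) fun_eq_iff dp_def)
  have "h (E'12 r q wt ?dp) = 0" by (rule h(3)) (auto simp: minus_relations_def Let_def)
  then show "E'12 r q wt dp = 0" by (simp add: act_lin[OF lin] h(2) dp_def)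
qed

section \<open>Tensor products over the algebra\<close>

lemma bimodule_bimod_sum: "bimodule M \<Longrightarrow> bimodule N \<Longrightarrow> bimodule (bimod_sum M N)"
  by (simp add: bimodule_def bimod_sum_def scaleC_prod_def)

lemma bimodule_hom_lin:
  assumes "bimodule M" "bimodule N" "bimodule_hom M N h"
  shows "lin h"
  unfolding lin_def
proof (intro conjI allI)
  show "h (x + y) = h x + h y" for x y using assms(3) by (simp add: bimodule_hom_def)
  fix c x
  have "h (lact M (c *\<^sub>C 1) x) = lact N (c *\<^sub>C 1) (h x)" using assms(3) by (simp add: bimodule_hom_def)
  then show "h (c *\<^sub>C x) = c *\<^sub>C h x" by (simp add: bimodule_bilin[OF assms(1)] bimodule_bilin[OF assms(2)])
qed

lemma tensor_product_balanced:
  assumes M: "bimodule M" and N: "bimodule N" and T: "tensor_product M N T tens"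
  shows "bilin tens" "tens (ract M x b) y = tens x (lact N b y)"
proof -
  have z: "lin_ext (\<lambda>(x, y). tens x y) f = 0" if "f \<in> tensor_relations M N" for f
    using T that complex_space.span_base unfolding tensor_product_def presented_space_def by blast
  note s = lin_diff[OF lin_lin_ext] linD[OF lin_lin_ext] lin_ext_single
  have add1: "tens (x + x') y = tens x y + tens x' y" for x x' y
  proof -
    have "Poly_Mapping.single (x + x', y) 1 - Poly_Mapping.single (x, y) 1 - Poly_Mapping.single (x', y) 1 \<in> tensor_relations M N"
      unfolding tensor_relations_def by blast
    from z[OF this] show ?thesis by (simp add: s scaleC_one diff_diff_eq)
  qed
  have add2: "tens x (y + y') = tens x y + tens x y'" for x y y'
  proof -
    have "Poly_Mapping.single (x, y + y') 1 - Poly_Mapping.single (x, y) 1 - Poly_Mapping.single (x, y') 1 \<in> tensor_relations M N"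
      unfolding tensor_relations_def by blast
    from z[OF this] show ?thesis by (simp add: s scaleC_one diff_diff_eq)
  qed
  have sc: "tens (c *\<^sub>C x) y = c *\<^sub>C tens x y" for c x y
  proof -
    have "Poly_Mapping.single (c *\<^sub>C x, y) 1 - c *\<^sub>C Poly_Mapping.single (x, y) 1 \<in> tensor_relations M N"
      unfolding tensor_relations_def by blast
    from z[OF this] show ?thesis by (simp add: s scaleC_one)
  qed
  show bal: "tens (ract M x b) y = tens x (lact N b y)" for x b y
  proof -
    have "Poly_Mapping.single (ract M x b, y) 1 - Poly_Mapping.single (x, lact N b y) 1 \<in> tensor_relations M N"
      unfolding tensor_relations_def by blast
    from z[OF this] show ?thesis by (simp add: s scaleC_one)
  qed
  have "tens x (c *\<^sub>C y) = c *\<^sub>C tens x y" for c x y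
    using bal[of x "c *\<^sub>C 1" y] by (simp add: bimodule_bilin[OF M] bimodule_bilin[OF N] sc)
  then show "bilin tens" by (simp add: bilin_def lin_def add1 add2 sc)
qed

lemma tensor_product_induct:
  assumes M: "bimodule M" and N: "bimodule N" and T: "tensor_product M N T tens"
    and add: "\<And>u v. Q u \<Longrightarrow> Q v \<Longrightarrow> Q (u + v)" and pure: "\<And>x y. Q (tens x y)"
  shows "Q z"
proof -
  note b = bilinD[OF tensor_product_balanced(1)[OF M N T]]
  obtain f where "z = lin_ext (\<lambda>(x, y). tens x y) f"
    using T unfolding tensor_product_def presented_space_def by (meson surjD)
  then have z: "z = (\<Sum>x\<in>Poly_Mapping.keys f. tens (Poly_Mapping.lookup f x *\<^sub>C fst x) (snd x))"
    by (simp add: lin_ext_def b split_def)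
  have Q0: "Q 0" using pure[of 0 0] by (simp add: b)
  have "Q (\<Sum>x\<in>K. tens (Poly_Mapping.lookup f x *\<^sub>C fst x) (snd x))" if "finite K" for K
    using that Q0 by (induction K rule: finite_induct) (simp_all add: add pure)
  then show ?thesis by (simp add: z)
qed

text \<open>The map induced on representatives vanishes on the tensor relations, hence exists. It is the only additive
  map with the given values, because pure tensors generate additively.\<close>

lemma tensor_map_hom:
  assumes M: "bimodule M" and N: "bimodule N" and T: "tensor_product M N T tens"
    and M': "bimodule M'" and N': "bimodule N'" and T': "tensor_product M' N' T' tens'"
    and f: "bimodule_hom M M' f" and g: "bimodule_hom N N' g"
  shows "bimodule_hom T T' (tensor_map tens tens' f g)" "tensor_map tens tens' f g (tens x y) = tens' (f x) (g y)"
proof -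
  note b' = bilinD[OF tensor_product_balanced(1)[OF M' N' T']]
  have fl: "lin f" "lin g" using bimodule_hom_lin[OF M M' f] bimodule_hom_lin[OF N N' g] .
  define \<phi> where "\<phi> = (\<lambda>(x, y). tens x y)"
  define \<psi> where "\<psi> = (\<lambda>(x, y). tens' (f x) (g y))"
  have pres: "surj (lin_ext \<phi>)" "\<And>w. lin_ext \<phi> w = 0 \<longleftrightarrow> w \<in> complex_space.span (tensor_relations M N)"
    using T unfolding tensor_product_def presented_space_def \<phi>_def by blast+
  have rel: "lin_ext \<psi> w = 0" if "w \<in> tensor_relations M N" for w
    using that f g unfolding tensor_relations_def
    by (auto simp: lin_diff[OF lin_lin_ext] linD[OF lin_lin_ext] lin_ext_single \<psi>_def linD[OF fl(1)] linD[OF fl(2)]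
        b' bimodule_hom_def tensor_product_balanced(2)[OF M' N' T'])
  have ker: "lin_ext \<psi> w = 0" if "w \<in> complex_space.span (tensor_relations M N)" for w
    using that by (induction rule: complex_space.span_induct_alt)
      (simp_all add: lin_zero[OF lin_lin_ext] linD[OF lin_lin_ext] rel)
  have wd: "lin_ext \<psi> w = lin_ext \<psi> w'" if "lin_ext \<phi> w = lin_ext \<phi> w'" for w w'
    using ker[of "w - w'"] pres(2)[of "w - w'"] that by (simp add: lin_diff[OF lin_lin_ext])
  define h where "h = (\<lambda>z. lin_ext \<psi> (SOME w. lin_ext \<phi> w = z))"
  have h: "h (lin_ext \<phi> w) = lin_ext \<psi> w" for w
    unfolding h_def by (rule wd) (rule someI[of "\<lambda>w'. lin_ext \<phi> w' = lin_ext \<phi> w" w], rule refl)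
  have hadd: "h (u + v) = h u + h v" for u v
  proof -
    obtain w w' where "u = lin_ext \<phi> w" "v = lin_ext \<phi> w'" using pres(1) by (meson surjD)
    then show ?thesis using h[of "w + w'"] by (simp add: linD[OF lin_lin_ext] h)
  qed
  have hpure: "h (tens x y) = tens' (f x) (g y)" for x y
    using h[of "Poly_Mapping.single (x, y) 1"] by (simp add: lin_ext_single \<phi>_def \<psi>_def scaleC_one)
  have eq: "tensor_map tens tens' f g = h"
    unfolding tensor_map_def
  proof (rule the_equality)
    fix h' assume h': "(\<forall>x y. h' (x + y) = h' x + h' y) \<and> (\<forall>x y. h' (tens x y) = tens' (f x) (g y))"
    have "h' z = h z" for z
      by (rule tensor_product_induct[OF M N T]) (simp_all add: h' hadd hpure)
    then show "h' = h" by blast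
  qed (simp add: hadd hpure)
  show "tensor_map tens tens' f g (tens x y) = tens' (f x) (g y)" by (simp add: eq hpure)
  note t = T[unfolded tensor_product_def] and t' = T'[unfolded tensor_product_def]
  have BT: "bimodule T" "bimodule T'" using t t' by auto
  have l: "h (lact T b z) = lact T' b (h z)" for b z
    by (rule tensor_product_induct[OF M N T])
      (use t t' f in \<open>simp_all add: hadd hpure bilinD[OF bimodule_bilin(1)[OF BT(1)]] bilinD[OF bimodule_bilin(1)[OF BT(2)]] bimodule_hom_def\<close>)
  have r: "h (ract T z b) = ract T' (h z) b" for b z
    by (rule tensor_product_induct[OF M N T])
      (use t t' g in \<open>simp_all add: hadd hpure bilinD[OF bimodule_bilin(2)[OF BT(1)]] bilinD[OF bimodule_bilin(2)[OF BT(2)]] bimodule_hom_def\<close>)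
  show "bimodule_hom T T' (tensor_map tens tens' f g)" by (simp add: bimodule_hom_def eq hadd l r)
qed

context leg_calculus begin

section \<open>From the relations to the braid equation\<close>

text \<open>By the Hecke relation, \<open>S\<close> has trivial kernel, so that \<open>matrix_inv\<close> is a true inverse and
  equals the inverse furnished by that relation.\<close>

lemma matrix_inv_S:
  fixes x :: "('i, 'x::complex_space) fam"
  shows "leg3 (matrix_inv S) n x = (1 / (z * q)) *\<^sub>C hinv t (a n) x"
proof -
  have ker: "y = 0" if "S *v y = 0" for y
  proof -
    define x :: "('i, complex) fam" where "x = (\<lambda>f. y $ (f 0, f 1, f 2))"
    have "leg3 S 0 x = 0" unfolding x_def leg3_vec that by (simp add: fun_eq_iff)
    then have "a 0 x = 0" by (simp add: a_def)
    then have "(1 / t) *\<^sub>C x = 0"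
      using a_hecke[of 0 x] by (simp add: lin_zero[OF lin_a])
    then have x: "x f = 0" for f using t0 by (auto simp: fun_eq_iff scaleC_complex_def)
    have "y $ (i, j, k) = 0" for i j k
      using x[of "\<lambda>n. if n = 0 then i else if n = 1 then j else k"] by (simp add: x_def)
    then show ?thesis by (simp add: vec_eq_iff split_paired_All)
  qed
  have inv: "leg3 (matrix_inv S) n (leg3 S n y) = y" for y :: "('i, 'x) fam"
    by (simp add: leg3_comp invertible_kerI(2)[OF ker] leg3_one)
  have inv': "leg3 (matrix_inv S) n (a n y) = (1 / (z * q)) *\<^sub>C y" for y :: "('i, 'x) fam"
    unfolding a_def leg3_scale inv ..
  have "a n (hinv t (a n) x) = x"
    using t0 by (simp add: hinv_def linD[OF lin_a] a_hecke scaleC_add_right scaleC_scaleC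
        scaleC_collect right_diff_distrib add.assoc[symmetric] scaleC_one)
  then show ?thesis using inv'[of "hinv t (a n) x"] by simp
qed

lemma matrix_inv_St:
  fixes x :: "('i, 'x::complex_space) fam"
  shows "leg3 (matrix_inv St) n x = (z * q) *\<^sub>C hinv (1 / t) (b n) x"
proof -
  have ker: "y = 0" if "St *v y = 0" for y
  proof -
    define x :: "('i, complex) fam" where "x = (\<lambda>f. y $ (f 0, f 1, f 2))"
    have "leg3 St 0 x = 0" unfolding x_def leg3_vec that by (simp add: fun_eq_iff)
    then have "b 0 x = 0" by (simp add: b_def)
    then have "t *\<^sub>C x = 0"
      using b_hecke[of 0 x] by (simp add: lin_zero[OF lin_b])
    then have x: "x f = 0" for f using t0 by (auto simp: fun_eq_iff scaleC_complex_def)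
    have "y $ (i, j, k) = 0" for i j k
      using x[of "\<lambda>n. if n = 0 then i else if n = 1 then j else k"] by (simp add: x_def)
    then show ?thesis by (simp add: vec_eq_iff split_paired_All)
  qed
  have inv: "leg3 (matrix_inv St) n (leg3 St n y) = y" for y :: "('i, 'x) fam"
    by (simp add: leg3_comp invertible_kerI(2)[OF ker] leg3_one)
  have inv': "leg3 (matrix_inv St) n (b n y) = (z * q) *\<^sub>C y" for y :: "('i, 'x) fam"
    unfolding b_def leg3_scale inv ..
  have "b n (hinv (1 / t) (b n) x) = x"
    using t0 by (simp add: hinv_def linD[OF lin_b] b_hecke scaleC_add_right scaleC_scaleC
        scaleC_collect right_diff_distrib add.assoc[symmetric] scaleC_one)
  then show ?thesis using inv'[of "hinv (1 / t) (b n) x"] by simp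
qed

end

text \<open>The passage from families indexed by four arguments to families with arbitrarily many legs.\<close>

definition fam4 :: "('i \<Rightarrow> 'i \<Rightarrow> 'i \<Rightarrow> 'i \<Rightarrow> 'x) \<Rightarrow> ('i, 'x) fam" where
  "fam4 x = (\<lambda>f. x (f 0) (f 1) (f 2) (f 3))"

lemma fam4_act: "fam4 (act123 M x) = leg3 M 0 (fam4 x)" "fam4 (act234 M x) = leg3 M 1 (fam4 x)"
  by (simp_all add: fam4_def act123_def act234_def leg3_def split_def numeral_2_eq_2 numeral_3_eq_3)

lemma fam4_ops: "fam4 (c *\<^sub>C x) = c *\<^sub>C fam4 x" "fam4 (x + y) = fam4 x + fam4 y"
  by (simp_all add: fam4_def fun_eq_iff)

lemma fam4_fam_prod: "fam4 (fam_prod m x y) = prd m 2 (legs01 x) (legs01 y)"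
  by (simp add: fam4_def fam_prod_def prd_def legs01_def numeral_2_eq_2 numeral_3_eq_3)

lemma contr_E'12: "contr (\<lambda>i. qpow q (wform r (wt i) (two_rho r))) 0 (legs01 x) = konst (E'12 r q wt x)"
  by (simp add: contr_def legs01_def E'12_def ins2_def)

lemma ev_E23: "ev 1 (fam4 x) = legs01 (E23 x)"
  by (simp add: contr_def fam4_def legs01_def E23_def ins2_def scaleC_one)

context hk_calculus begin

text \<open>Both sides of the braid equation are additive and left linear. In \<open>x \<otimes> y \<otimes> w\<close> the last factor is reduced to a
  generator by moving its coefficient into \<open>y\<close>, then the coefficient of \<open>y\<close> moves into \<open>x\<close>, and that of \<open>x\<close> comes
  out by linearity.\<close>

lemma braid_everywhere:
  assumes Om_ind: "\<And>Q x. (\<And>u v. Q u \<Longrightarrow> Q v \<Longrightarrow> Q (u + v)) \<Longrightarrow> (\<And>b i j. Q (lact Om b (dp i j))) \<Longrightarrow>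
      (\<And>b i j. Q (lact Om b (dbp i j))) \<Longrightarrow> Q x"
    and T2_ind: "\<And>Q x2. (\<And>u v. Q u \<Longrightarrow> Q v \<Longrightarrow> Q (u + v)) \<Longrightarrow> (\<And>x y. Q (ten x y)) \<Longrightarrow> Q x2"
    and T3_ind: "\<And>Q x3. (\<And>u v. Q u \<Longrightarrow> Q v \<Longrightarrow> Q (u + v)) \<Longrightarrow> (\<And>x y2. Q (t12 x y2)) \<Longrightarrow> Q x3"
  shows "s1 (s2 (s1 x3)) = s2 (s1 (s2 x3))"
proof -
  \<comment> \<open>the generators of the bimodule of one-forms\<close>
  define G where "G = {g. \<exists>i j. g = dp i j \<or> g = dbp i j}"
  define Br where "Br = (\<lambda>x. s1 (s2 (s1 x)) = s2 (s1 (s2 x)))"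
  have Br_add: "Br u \<Longrightarrow> Br v \<Longrightarrow> Br (u + v)" for u v
    by (simp add: Br_def linD[OF s1(1)] linD[OF s2(1)])
  have Br_lact: "Br u \<Longrightarrow> Br (lact T3 v u)" for u v
    by (simp add: Br_def s1(2) s2(2))
  have ind: "Q x" if "\<And>u v. Q u \<Longrightarrow> Q v \<Longrightarrow> Q (u + v)" "\<And>v g. g \<in> G \<Longrightarrow> Q (lact Om v g)" for Q x
    by (rule Om_ind[of Q, OF that(1)]) (assumption | (rule that(2), unfold G_def, blast))+
  have gen: "Br (t12 x (ten y w))" if g: "x \<in> G" "y \<in> G" "w \<in> G" for x y w
  proof -
    have G: "\<exists>i j h. (h = d \<or> h = e) \<and> (\<forall>f. f 0 = i \<longrightarrow> f 1 = j \<longrightarrow> h f = g)" if gG: "g \<in> G" for g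
    proof -
      obtain i j where "g = dp i j \<or> g = dbp i j" using gG unfolding G_def by blast
      then show ?thesis
      proof
        assume "g = dp i j"
        then show ?thesis by (intro exI[of _ i] exI[of _ j] exI[of _ d]) (simp add: legs01_def)
      next
        assume "g = dbp i j"
        then show ?thesis by (intro exI[of _ i] exI[of _ j] exI[of _ e]) (simp add: legs01_def)
      qed
    qed
    from G[OF g(1)] obtain i j X where X: "(X = d \<or> X = e) \<and> (\<forall>f. f 0 = i \<longrightarrow> f 1 = j \<longrightarrow> X f = x)"
      by (elim exE) (rule that)
    from G[OF g(2)] obtain i' j' Y where Y: "(Y = d \<or> Y = e) \<and> (\<forall>f. f 0 = i' \<longrightarrow> f 1 = j' \<longrightarrow> Y f = y)"
      by (elim exE) (rule that)
    from G[OF g(3)] obtain i'' j'' W where W: "(W = d \<or> W = e) \<and> (\<forall>f. f 0 = i'' \<longrightarrow> f 1 = j'' \<longrightarrow> W f = w)"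
      by (elim exE) (rule that)
    define f where "f = (\<lambda>n :: nat. [i, j, i', j', i'', j''] ! n)"
    have "Z X Y W f = t12 x (ten y w)"
    proof -
      have "X f = x" using X by (simp add: f_def)
      moreover have "Y (\<lambda>n. f (n + 2)) = y" using Y by (simp add: f_def)
      moreover have "W (\<lambda>n. f (n + 2 + 2)) = w" using W by (simp add: f_def)
      ultimately show ?thesis by (simp add: Z_def prd_def add.assoc)
    qed
    then show ?thesis using fun_cong[OF braid_Z[OF conjunct1[OF X] conjunct1[OF Y] conjunct1[OF W]], of f] by (simp add: Br_def)
  qed
  have gen1: "Br (t12 x (ten y w))" if "y \<in> G" "w \<in> G" for x y w
    by (rule ind[of "\<lambda>x. Br (t12 x (ten y w))"])
      (simp_all add: bilinD[OF bil(3)] Br_add t12(1)[symmetric] Br_lact gen that)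
  have gen2: "Br (t12 x (ten y w))" if "w \<in> G" for x y w
  proof -
    have "\<forall>x. Br (t12 x (ten y w))"
      by (rule ind[of "\<lambda>y. \<forall>x. Br (t12 x (ten y w))"])
        (simp_all add: bilinD[OF bil(1)] bilinD[OF bil(3)] Br_add ten(1)[symmetric] t12(3)[symmetric] gen1 that)
    then show ?thesis ..
  qed
  have gen3: "Br (t12 x (ten y w))" for x y w
  proof -
    have "\<forall>y. Br (t12 x (ten y w))"
      by (rule ind[of "\<lambda>w. \<forall>y. Br (t12 x (ten y w))"])
        (simp_all add: bilinD[OF bil(1)] bilinD[OF bil(3)] Br_add ten(3)[symmetric] gen2)
    then show ?thesis ..
  qed
  have gen4: "Br (t12 x y2)" for x y2
    by (rule T2_ind[of "\<lambda>y2. Br (t12 x y2)"]) (simp_all add: bilinD[OF bil(3)] Br_add gen3)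
  have "Br x3" by (rule T3_ind[of Br]) (erule (1) Br_add, rule gen4)
  then show ?thesis by (simp add: Br_def)
qed

end

text \<open>The relations of each half of the calculus hold in the direct sum of the two.\<close>

lemma relations_hom:
  fixes x :: "('i::finite, 'm::complex_space) fam2" and h :: "'m \<Rightarrow> 'n::complex_space"
  assumes M: "bimodule M" and N: "bimodule N" and h: "bimodule_hom M N h"
  defines "y \<equiv> \<lambda>i j. h (x i j)"
  shows "act123 A (fam_prod (lact M) p x) = c *\<^sub>C fam_prod (lact M) p x \<Longrightarrow>
      act123 A (fam_prod (lact N) p y) = c *\<^sub>C fam_prod (lact N) p y"
    "act234 A (fam_prod (lact M) p x) = c *\<^sub>C fam_prod (lact M) p x \<Longrightarrow>
      act234 A (fam_prod (lact N) p y) = c *\<^sub>C fam_prod (lact N) p y"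
    "E'12 r q wt x = 0 \<Longrightarrow> E'12 r q wt y = 0"
    "fam_prod (ract M) x p = c *\<^sub>C T_act r q V (fam_prod (lact M) p x) \<Longrightarrow>
      fam_prod (ract N) y p = c *\<^sub>C T_act r q V (fam_prod (lact N) p y)"
proof -
  have L: "lin h" by (rule bimodule_hom_lin[OF M N h])
  have act: "act123 A (\<lambda>i j k m. h (u i j k m)) = (\<lambda>i j k m. h (act123 A u i j k m))"
    "act234 A (\<lambda>i j k m. h (u i j k m)) = (\<lambda>i j k m. h (act234 A u i j k m))" for A u
    by (intro ext; rule act_lin[OF L, symmetric])+
  have prod: "fam_prod (lact N) p y = (\<lambda>i j k m. h (fam_prod (lact M) p x i j k m))"
    "fam_prod (ract N) y p = (\<lambda>i j k m. h (fam_prod (ract M) x p i j k m))"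
    using h by (simp_all add: fam_prod_def y_def bimodule_hom_def)
  show "act123 A (fam_prod (lact M) p x) = c *\<^sub>C fam_prod (lact M) p x \<Longrightarrow>
      act123 A (fam_prod (lact N) p y) = c *\<^sub>C fam_prod (lact N) p y"
    "act234 A (fam_prod (lact M) p x) = c *\<^sub>C fam_prod (lact M) p x \<Longrightarrow>
      act234 A (fam_prod (lact N) p y) = c *\<^sub>C fam_prod (lact N) p y"
    unfolding prod act by (simp_all add: linD[OF L] fun_eq_iff)
  show "E'12 r q wt x = 0 \<Longrightarrow> E'12 r q wt y = 0"
    using act_lin(3)[OF L, of r q wt x] by (simp add: y_def lin_zero[OF L])
  show "fam_prod (ract M) x p = c *\<^sub>C T_act r q V (fam_prod (lact M) p x) \<Longrightarrow>
      fam_prod (ract N) y p = c *\<^sub>C T_act r q V (fam_prod (lact N) p y)"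
    unfolding prod T_act_def act by (simp add: linD[OF L] fun_eq_iff)
qed

lemma tensor_product_actions:
  assumes "tensor_product M N T tens"
  shows "lact T b (tens x y) = tens (lact M b x) y" "ract T (tens x y) b = tens x (ract N y b)"
  using assms by (simp_all add: tensor_product_def)

lemma fam4_comp: "fam4 (\<lambda>i j k m. h (x i j k m)) = h \<circ> fam4 x"
  by (simp add: fam4_def fun_eq_iff)

lemma sum_closed:
  assumes "finite K" "Q 0" "\<And>u v. Q u \<Longrightarrow> Q v \<Longrightarrow> Q (u + v)" "\<And>k. Q (f k)"
  shows "Q (sum f K)"
  using assms(1) by (induction K rule: finite_induct) (simp_all add: assms(2-4))

theorem proposition5p9:
  fixes r s :: nat and q :: real
    and V :: "'i::finite uq_rep" and wt :: "'i \<Rightarrow> weight"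
    and p :: "'i \<Rightarrow> 'i \<Rightarrow> 'b::complex_algebra_1"
    and Omp :: "('b, 'op::complex_space) bimod" and del :: "'b \<Rightarrow> 'op"
    and Omm :: "('b, 'om::complex_space) bimod" and delbar :: "'b \<Rightarrow> 'om"
    and Om :: "('b, 'op \<times> 'om) bimod" and d :: "'b \<Rightarrow> 'op \<times> 'om"
    and Om2 :: "('b, 't2::complex_space) bimod" and ten :: "'op \<times> 'om \<Rightarrow> 'op \<times> 'om \<Rightarrow> 't2"
    and Om3 :: "('b, 't3::complex_space) bimod"
    and ten21 :: "'t2 \<Rightarrow> 'op \<times> 'om \<Rightarrow> 't3" and ten12 :: "'op \<times> 'om \<Rightarrow> 't2 \<Rightarrow> 't3"
    and W :: "('b, 'w::complex_space) bimod" and wedge :: "'t2 \<Rightarrow> 'w"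
    and WOm :: "('b, 'wo::complex_space) bimod" and tenW :: "'w \<Rightarrow> 'op \<times> 'om \<Rightarrow> 'wo"
    and \<sigma> :: "'t2 \<Rightarrow> 't2"
  assumes "quantum_data r s q V wt"
    and "is_algebra_B r s q V wt p"
    and "is_Omega_plus r s q V wt p Omp del"
    and "is_Omega_minus r s q V wt p Omm delbar"
    and "Om = bimod_sum Omp Omm"
    and "d = (\<lambda>b. (del b, delbar b))"
    and "tensor_product Om Om Om2 ten"
    and "tensor_product Om2 Om Om3 ten21"
    and "tensor_product Om Om2 Om3 ten12"
    and "\<And>x y z. ten21 (ten x y) z = ten12 x (ten y z)"
    and "is_universal_two_forms Om d Om2 ten W wedge"
    and "tensor_product W Om WOm tenW"
    and "is_generalized_braiding r s q V wt p del delbar Om2 ten \<sigma>"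
  defines "\<sigma>1 \<equiv> tensor_map ten21 ten21 \<sigma> id"
    and "\<sigma>2 \<equiv> tensor_map ten12 ten12 id \<sigma>"
    and "wedge_id \<equiv> tensor_map ten21 tenW wedge id"
  shows "wedge_id \<circ> \<sigma>1 \<circ> \<sigma>2 \<circ> \<sigma>1 = wedge_id \<circ> \<sigma>2 \<circ> \<sigma>1 \<circ> \<sigma>2"
proof -
  have r: "1 \<le> r" and s: "s \<in> {1, r}" and q: "0 < q"
    using assms(1) by (auto simp: quantum_data_def)
  let ?q = "complex_of_real q"
  let ?C = "braiding r q V (dual_rep V)"
  let ?Ri = "matrix_inv (braiding r q (dual_rep V) (dual_rep V))"
  let ?\<tau> = "\<lambda>i. qpow q (wform r (wt i) (two_rho r))"
  obtain l :: "'i \<Rightarrow> int" and z \<kappa> :: complex where lc: "leg_calculus ?q z l ?C ?Ri ?\<tau> \<kappa>"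
    and braidings: "braiding r q V V = Rmat z ?q l" "matrix_inv ?C = rot (Rmat z ?q l)"
    and zq: "z * ?q = qpow q (w_const r s)" and \<kappa>: "\<kappa> = z * ?q * qpow q (m_const r s)"
    using quantum_braidings[OF assms(1)] .
  interpret L: leg_calculus ?q z l ?C ?Ri ?\<tau> \<kappa> by (rule lc)
  have maps: "S_map r q V = L.S" "St_map r q V = L.St"
    unfolding S_map_def St_map_def L.S_def L.St_def braidings by (rule refl)+
  have zq0: "z * ?q \<noteq> 0" using L.z0 L.q0 by simp
  have t: "qpow q (a_const r s) = L.t"
    unfolding const_values[OF r s] L.t_def by (rule qpow_values(3)[OF q])
  have mu: "qpow q (m_const r s) = L.\<mu>"
    using zq0 unfolding L.\<mu>_def unfolding \<kappa> by simp
  have pow_diff: "qpow q (2 * x - 2 * y) = (qpow q x)\<^sup>2 / (qpow q y)\<^sup>2" for x y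
  proof -
    have "2 * x - 2 * y = (x + x) + (- y + - y)" by simp
    then show ?thesis unfolding qpow_values(6,7)[OF q] power2_eq_square by (simp only: qpow_values(6,7)[OF q]) simp
  qed
  \<comment> \<open>the powers of \<open>q\<close> in the relations become \<open>t\<close>, \<open>\<mu>\<close> and powers of \<open>z q = q\<^sup>w\<close>\<close>
  have pows: "qpow q (w_const r s) = z * ?q" "qpow q (- w_const r s) = 1 / (z * ?q)"
    "qpow q (- a_const r s) = 1 / L.t" "qpow q (- m_const r s) = 1 / L.\<mu>"
    "qpow q (2 * a_const r s - 2 * w_const r s) = L.t\<^sup>2 / (z * ?q)\<^sup>2"
    "qpow q (2 * w_const r s - 2 * a_const r s) = (z * ?q)\<^sup>2 / L.t\<^sup>2"
    unfolding t[symmetric] mu[symmetric] zq pow_diff qpow_values(7)[OF q] by (rule refl)+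

  note plus = Omega_plus_relations[OF assms(3)] and minus = Omega_minus_relations[OF assms(4)]
  note rel_B = algebra_B_relations[OF assms(2)]
  have Om: "bimodule Om" unfolding assms(5) by (rule bimodule_bimod_sum[OF plus(1) minus(1)])
  have B2: "bimodule Om2" and B3: "bimodule Om3" using assms(7,8) by (simp_all add: tensor_product_def)
  note ten_bal = tensor_product_balanced[OF Om Om assms(7)]
    and ten21_bal = tensor_product_balanced[OF B2 Om assms(8)]
    and ten12_bal = tensor_product_balanced[OF Om B2 assms(9)]
  have \<sigma>: "bimodule_hom Om2 Om2 \<sigma>" using assms(13) by (simp add: is_generalized_braiding_def)
  have id: "bimodule_hom Om Om id" by (simp add: bimodule_hom_def)
  note \<sigma>1 = tensor_map_hom[OF B2 Om assms(8) B2 Om assms(8) \<sigma> id, folded \<sigma>1_def]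
  note \<sigma>2 = tensor_map_hom[OF Om B2 assms(9) Om B2 assms(9) id \<sigma>, folded \<sigma>2_def]
  have lin\<sigma>: "lin \<sigma>" "lin \<sigma>1" "lin \<sigma>2"
    using bimodule_hom_lin[OF B2 B2 \<sigma>] bimodule_hom_lin[OF B3 B3 \<sigma>1(1)] bimodule_hom_lin[OF B3 B3 \<sigma>2(1)] .

  define dp where "dp = (\<lambda>i j. (del (p i j), 0 :: 'om))"
  define dbp where "dbp = (\<lambda>i j. (0 :: 'op, delbar (p i j)))"
  note zeros = bilinD(6)[OF bimodule_bilin(1)[OF plus(1)]] bilinD(5)[OF bimodule_bilin(2)[OF plus(1)]]
    bilinD(6)[OF bimodule_bilin(1)[OF minus(1)]] bilinD(5)[OF bimodule_bilin(2)[OF minus(1)]]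
  \<comment> \<open>both halves of the calculus embed into \<open>\<Omega>\<close> as bimodules\<close>
  have in_plus: "bimodule_hom Omp Om (\<lambda>x. (x, 0))" and in_minus: "bimodule_hom Omm Om (\<lambda>x. (0, x))"
    unfolding assms(5) bimodule_hom_def bimod_sum_def by (simp_all add: zeros)
  note plus' = relations_hom[OF plus(1) Om in_plus, where x = "\<lambda>i j. del (p i j)", folded dp_def]
  note minus' = relations_hom[OF minus(1) Om in_minus, where x = "\<lambda>i j. delbar (p i j)", folded dbp_def]

  have ops: "fam4 (act123 (S_map r q V) x) = (z * ?q) *\<^sub>C L.a 0 (fam4 x)"
    "fam4 (act234 (St_map r q V) x) = (1 / (z * ?q)) *\<^sub>C L.b 1 (fam4 x)"
    "fam4 (act123 (matrix_inv (S_map r q V)) x) = (1 / (z * ?q)) *\<^sub>C hinv L.t (L.a 0) (fam4 x)"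
    "fam4 (act234 (matrix_inv (St_map r q V)) x) = (z * ?q) *\<^sub>C hinv (1 / L.t) (L.b 1) (fam4 x)"
    for x :: "('i, 'v::complex_space) fam4"
    unfolding fam4_act maps L.matrix_inv_S L.matrix_inv_St L.a_def L.b_def
    using L.z0 L.q0 by (simp_all add: scaleC_scaleC scaleC_one)
  have cancel: "x = y" if "c *\<^sub>C x = c *\<^sub>C y" "c \<noteq> 0" for c and x y :: "'v::complex_space"
    using that by (simp add: complex_space.scale_cancel_left)
  \<comment> \<open>an eigenvector relation of \<open>S\<close> or of \<open>S\<close>-tilde becomes invariance under \<open>a\<close> or \<open>b\<close>\<close>
  have fix_a: "L.a 0 (fam4 x) = fam4 x" if "act123 (S_map r q V) x = qpow q (w_const r s) *\<^sub>C x"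
    for x :: "('i, 'v::complex_space) fam4"
    using arg_cong[OF that, of fam4] zq0 unfolding ops fam4_ops pows by (rule cancel)
  have fix_b: "L.b 1 (fam4 x) = fam4 x" if "act234 (St_map r q V) x = qpow q (- w_const r s) *\<^sub>C x"
    for x :: "('i, 'v::complex_space) fam4"
  proof (rule cancel[of "1 / (z * ?q)"])
    show "(1 / (z * ?q)) *\<^sub>C L.b 1 (fam4 x) = (1 / (z * ?q)) *\<^sub>C fam4 x"
      using arg_cong[OF that, of fam4] unfolding ops fam4_ops pows .
  qed (use zq0 in simp)
  have T: "fam4 (T_act r q V x) = L.a 0 (L.b 1 (fam4 x))" for x :: "('i, 'v::complex_space) fam4"
    unfolding T_act_def ops linD(2)[OF L.lin_a] scaleC_scaleC using zq0 by (simp add: scaleC_one)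

  define gmp where "gmp = E'12 r q wt (E23 (fam_prod ten dbp dp))"
  define gpm where "gpm = E'12 r q wt (E23 (fam_prod ten dp dbp))"
  have pgp: "fam4 (fam_prod (\<lambda>x y. ract Om2 (lact Om2 x g) y) p p) =
      (\<lambda>f. ract Om2 (lact Om2 (p (f 0) (f 1)) g) (p (f 2) (f 3)))" for g
    by (simp add: fam4_def fam_prod_def)
  note br = conjunct2[OF assms(13)[unfolded is_generalized_braiding_def Let_def, folded dp_def dbp_def gmp_def gpm_def], rule_format]
  have br_fam: "\<sigma> \<circ> fam4 x = fam4 y" if "\<And>i j k m. \<sigma> (x i j k m) = y i j k m" for x y
    unfolding fam4_comp[symmetric] that ..
  note to_fam4 = fam4_fam_prod[symmetric]

  interpret H: hk_calculus ?q z l ?C ?Ri ?\<tau> \<kappa> p dp dbp Om Om2 Om3 ten ten21 ten12 \<sigma> \<sigma>1 \<sigma>2 gmp gpm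
  proof
    show "bimodule Om" "bimodule Om2" "bimodule Om3" by (fact Om B2 B3)+
    show "bilin ten" "bilin ten21" "bilin ten12" by (fact ten_bal ten21_bal ten12_bal)+
    fix v x y x2 y2 x' x3
    show "lact Om2 v (ten x y) = ten (lact Om v x) y" "ract Om2 (ten x y) v = ten x (ract Om y v)"
      by (fact tensor_product_actions[OF assms(7)])+
    show "lact Om3 v (ten21 x2 y) = ten21 (lact Om2 v x2) y" "ract Om3 (ten21 x2 y) v = ten21 x2 (ract Om y v)"
      by (fact tensor_product_actions[OF assms(8)])+
    show "lact Om3 v (ten12 x y2) = ten12 (lact Om v x) y2" "ract Om3 (ten12 x y2) v = ten12 x (ract Om2 y2 v)"
      by (fact tensor_product_actions[OF assms(9)])+
    show "ten (ract Om x v) y = ten x (lact Om v y)" "ten21 (ract Om2 x2 v) y = ten21 x2 (lact Om v y)"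
      "ten12 (ract Om x v) y2 = ten12 x (lact Om2 v y2)" by (fact ten_bal ten21_bal ten12_bal)+
    show "ten21 (ten x y) x' = ten12 x (ten y x')" by (fact assms(10))
    show "lin \<sigma>" "lin \<sigma>1" "lin \<sigma>2" by (fact lin\<sigma>)+
    show "\<sigma> (lact Om2 v x2) = lact Om2 v (\<sigma> x2)" "\<sigma> (ract Om2 x2 v) = ract Om2 (\<sigma> x2) v"
      using \<sigma> by (simp_all add: bimodule_hom_def)
    show "\<sigma>1 (lact Om3 v x3) = lact Om3 v (\<sigma>1 x3)" "\<sigma>1 (ract Om3 x3 v) = ract Om3 (\<sigma>1 x3) v"
      "\<sigma>2 (lact Om3 v x3) = lact Om3 v (\<sigma>2 x3)" "\<sigma>2 (ract Om3 x3 v) = ract Om3 (\<sigma>2 x3) v"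
      using \<sigma>1(1) \<sigma>2(1) by (simp_all add: bimodule_hom_def)
    show "\<sigma>1 (ten21 x2 y) = ten21 (\<sigma> x2) y" "\<sigma>2 (ten12 x y2) = ten12 x (\<sigma> y2)"
      by (simp_all add: \<sigma>1(2) \<sigma>2(2))
  next
    show "L.a 0 (prd (*) 2 (legs01 p) (legs01 p)) = prd (*) 2 (legs01 p) (legs01 p)"
      unfolding to_fam4 by (rule fix_a[OF rel_B(1)])
    show "L.b 1 (prd (*) 2 (legs01 p) (legs01 p)) = prd (*) 2 (legs01 p) (legs01 p)"
      unfolding to_fam4 by (rule fix_b[OF rel_B(2)])
    show "contr ?\<tau> 0 (legs01 p) = konst (L.\<mu> *\<^sub>C 1)"
      unfolding contr_E'12 rel_B(3) mu ..
    show "L.b 1 (prd (lact Om) 2 (legs01 p) (legs01 dp)) = prd (lact Om) 2 (legs01 p) (legs01 dp)"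
      unfolding to_fam4 by (rule fix_b[OF plus'(2)[OF plus(2)]])
    show "L.a 0 (prd (lact Om) 2 (legs01 p) (legs01 dbp)) = prd (lact Om) 2 (legs01 p) (legs01 dbp)"
      unfolding to_fam4 by (rule fix_a[OF minus'(1)[OF minus(2)]])
    show "contr ?\<tau> 0 (legs01 dp) = 0" "contr ?\<tau> 0 (legs01 dbp) = 0"
      unfolding contr_E'12 plus'(3)[OF plus(3)] minus'(3)[OF minus(3)] zero_fun_def by (rule refl)+
    show "prd (ract Om) 2 (legs01 dp) (legs01 p) = L.t *\<^sub>C L.a 0 (L.b 1 (prd (lact Om) 2 (legs01 p) (legs01 dp)))"
      unfolding to_fam4 plus'(4)[OF plus(4)] fam4_ops T t ..
    show "prd (ract Om) 2 (legs01 dbp) (legs01 p) = (1 / L.t) *\<^sub>C L.a 0 (L.b 1 (prd (lact Om) 2 (legs01 p) (legs01 dbp)))"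
      unfolding to_fam4 minus'(4)[OF minus(4)] fam4_ops T pows ..
    show "contr ?\<tau> 0 (ev 1 (prd ten 2 (legs01 dbp) (legs01 dp))) = konst gmp"
      "contr ?\<tau> 0 (ev 1 (prd ten 2 (legs01 dp) (legs01 dbp))) = konst gpm"
      unfolding to_fam4 ev_E23 contr_E'12 gmp_def gpm_def by (rule refl)+
    show "\<sigma> \<circ> prd ten 2 (legs01 dp) (legs01 dp) = L.t *\<^sub>C L.a 0 (L.b 1 (prd ten 2 (legs01 dp) (legs01 dp)))"
    proof -
      have "\<sigma> \<circ> fam4 (fam_prod ten dp dp) = fam4 (qpow q (a_const r s) *\<^sub>C T_act r q V (fam_prod ten dp dp))"
        by (rule br_fam) (simp add: T_act_def br)
      then show ?thesis unfolding fam4_ops T t unfolding fam4_fam_prod .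
    qed
    show "\<sigma> \<circ> prd ten 2 (legs01 dbp) (legs01 dbp) = (1 / L.t) *\<^sub>C L.a 0 (L.b 1 (prd ten 2 (legs01 dbp) (legs01 dbp)))"
    proof -
      have "\<sigma> \<circ> fam4 (fam_prod ten dbp dbp) = fam4 (qpow q (- a_const r s) *\<^sub>C T_act r q V (fam_prod ten dbp dbp))"
        by (rule br_fam) (simp add: T_act_def br)
      then show ?thesis unfolding fam4_ops T pows unfolding fam4_fam_prod .
    qed
    show "\<sigma> \<circ> prd ten 2 (legs01 dp) (legs01 dbp) =
        L.t\<^sup>2 *\<^sub>C L.a 0 (hinv (1 / L.t) (L.b 1) (prd ten 2 (legs01 dbp) (legs01 dp))) +
        ((1 - L.t) * L.t / L.\<mu>) *\<^sub>C (\<lambda>f. ract Om2 (lact Om2 (p (f 0) (f 1)) gmp) (p (f 2) (f 3)))"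
    proof -
      have "\<sigma> \<circ> fam4 (fam_prod ten dp dbp) = fam4 (qpow q (2 * a_const r s - 2 * w_const r s) *\<^sub>C
            act123 (S_map r q V) (act234 (matrix_inv (St_map r q V)) (fam_prod ten dbp dp)) +
          ((1 - qpow q (a_const r s)) * qpow q (a_const r s) * qpow q (- m_const r s)) *\<^sub>C
            fam_prod (\<lambda>x y. ract Om2 (lact Om2 x gmp) y) p p)"
        by (rule br_fam) (simp add: br)
      moreover have "L.t\<^sup>2 / (z * ?q)\<^sup>2 * (z * ?q * (z * ?q)) = L.t\<^sup>2"
        using zq0 by (simp add: power2_eq_square)
      ultimately show ?thesis
        unfolding fam4_ops ops pgp pows t linD(2)[OF L.lin_a] scaleC_scaleC unfolding fam4_fam_prod by simp
    qed
    show "\<sigma> \<circ> prd ten 2 (legs01 dbp) (legs01 dp) =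
        (1 / L.t\<^sup>2) *\<^sub>C hinv L.t (L.a 0) (L.b 1 (prd ten 2 (legs01 dp) (legs01 dbp))) +
        ((1 - 1 / L.t) / L.\<mu>) *\<^sub>C (\<lambda>f. ract Om2 (lact Om2 (p (f 0) (f 1)) gpm) (p (f 2) (f 3)))"
    proof -
      have "\<sigma> \<circ> fam4 (fam_prod ten dbp dp) = fam4 (qpow q (2 * w_const r s - 2 * a_const r s) *\<^sub>C
            act123 (matrix_inv (S_map r q V)) (act234 (St_map r q V) (fam_prod ten dp dbp)) +
          ((1 - qpow q (- a_const r s)) * qpow q (- m_const r s)) *\<^sub>C
            fam_prod (\<lambda>x y. ract Om2 (lact Om2 x gpm) y) p p)"
        by (rule br_fam) (simp add: br)
      moreover have "(z * ?q)\<^sup>2 / L.t\<^sup>2 * (1 / (z * ?q) * (1 / (z * ?q))) = 1 / L.t\<^sup>2"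
        using zq0 by (simp add: power2_eq_square)
      moreover have "hinv L.t (L.a 0) (c *\<^sub>C x) = c *\<^sub>C hinv L.t (L.a 0) x" for c and x :: "('i, 't2) fam"
        by (simp add: hinv_def linD(2)[OF L.lin_a] scaleC_add_right scaleC_scaleC mult.commute)
      ultimately show ?thesis
        unfolding fam4_ops ops pgp pows scaleC_scaleC unfolding fam4_fam_prod by (simp add: scaleC_scaleC mult.assoc)
    qed
  qed

  have comp: "\<sigma>1 (\<sigma>2 (\<sigma>1 x)) = \<sigma>2 (\<sigma>1 (\<sigma>2 x))" for x
  proof (rule H.braid_everywhere)
    fix Q and x :: "'op \<times> 'om"
    assume add: "\<And>u v. Q u \<Longrightarrow> Q v \<Longrightarrow> Q (u + v)"
      and Qp: "\<And>b i j. Q (lact Om b (dp i j))" and Qm: "\<And>b i j. Q (lact Om b (dbp i j))"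
    have Q0: "Q 0" using Qp[of 0] by (simp add: bilinD[OF bimodule_bilin(1)[OF Om]])
    have lp: "lact Om b (dp i j) = (lact Omp b (del (p i j)), 0)"
      and lm: "lact Om b (dbp i j) = (0, lact Omm b (delbar (p i j)))" for b i j
      by (simp_all add: assms(5) bimod_sum_def dp_def dbp_def zeros)
    obtain c where c: "fst x = (\<Sum>k\<in>UNIV. lact Omp (c k) (del (p (fst k) (snd k))))" using plus(5) by blast
    obtain c' where c': "snd x = (\<Sum>k\<in>UNIV. lact Omm (c' k) (delbar (p (fst k) (snd k))))" using minus(5) by blast
    have "x = (\<Sum>k\<in>UNIV. lact Om (c k) (dp (fst k) (snd k))) + (\<Sum>k\<in>UNIV. lact Om (c' k) (dbp (fst k) (snd k)))"
      by (simp add: lp lm prod_eq_iff fst_sum snd_sum c c')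
    then show "Q x"
      using add[OF sum_closed[OF finite Q0 add Qp] sum_closed[OF finite Q0 add Qm]] by simp
  next
    show "Q x2" if "\<And>u v. Q u \<Longrightarrow> Q v \<Longrightarrow> Q (u + v)" "\<And>x y. Q (ten x y)" for Q x2
      by (rule tensor_product_induct[OF Om Om assms(7), of Q]) (rule that; assumption)+
    show "Q x3" if "\<And>u v. Q u \<Longrightarrow> Q v \<Longrightarrow> Q (u + v)" "\<And>x y. Q (ten12 x y)" for Q x3
      by (rule tensor_product_induct[OF Om B2 assms(9), of Q]) (rule that; assumption)+
  qed
  show ?thesis by (simp add: fun_eq_iff comp)
qed

end
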